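(* Let $k$ be a field of characteristic zero. If $A$ is the symmetric algebra of a finite dimensional Lie $k$-algebra $\mathfrak g$, equipped with its natural Poisson bracket, then $A$ satisfies the Poisson Dixmier-Moeglin equivalence. That is, a prime Poisson ideal of $A$ is Poisson-locally closed if and only if it is Poisson-primitive, if and only if it is Poisson-rational.
   Context: Choosing a $k$-basis $x_1,\dots,x_s$ of $\mathfrak g$, the symmetric algebra is $A=k[x_1,\dots,x_s]$, and its natural Poisson bracket is $$\{f,g\}=\sum_{i<j}[x_i,x_j]\left(\frac{\partial f}{\partial x_i}\frac{\partial g}{\partial x_j}-\frac{\partial f}{\partial x_j}\frac{\partial g}{\partial x_i}\right),$$ where $[x_i,x_j]\in\mathfrak g\subseteq A$ is the Lie bracket of $\mathfrak g$. An ideal $I$ of $A$ is a Poisson ideal if $\{A,I\}\subseteq I$. $Spec_P A$ is the set of prime ideals of $A$ that are Poisson ideals. The Poisson core of an ideal $I$ is the largest Poisson ideal contained in $I$. The Poisson-center of a Poisson algebra $B$ is $Z_P(B)=\{b\in B:\{B,b\}=0\}$. If $P$ is a prime Poisson ideal, $A/P$ has the induced bracket, which extends to $\operatorname{Frac}(A/P)$ by the quotient rule. A prime Poisson ideal $P$ of $A$ is: - Poisson-locally closed if $\bigcap_{P\subsetneq Q\in Spec_P A}Q\neq P$ (the empty intersection being $A$); - Poisson-primitive if $P$ is the Poisson core of a maximal ideal of $A$; - Poisson-rational if $Z_P(\operatorname{Frac}(A/P))$ is an algebraic extension of $k$. *)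

theory Defs
  imports "HOL-Library.Poly_Mapping" "HOL-Algebra.QuotRing" "HOL-Algebra.Finite_Extensions"
begin

section \<open>Lie algebras\<close>

locale lie_algebra = vector_space scale
  for scale :: "'k::field \<Rightarrow> 'g::ab_group_add \<Rightarrow> 'g" +
  fixes lie :: "'g \<Rightarrow> 'g \<Rightarrow> 'g"
  assumes lie_linear_left: "Vector_Spaces.linear scale scale (\<lambda>x. lie x y)"
    and lie_linear_right: "Vector_Spaces.linear scale scale (lie x)"
    and lie_alternating: "lie x x = 0"
    and lie_jacobi: "lie x (lie y z) + lie y (lie z x) + lie z (lie x y) = 0"

section \<open>Polynomial rings\<close>

text \<open>
  A polynomial is a finitely supported map from exponent vectors to coefficients.
  The variables of the type are indexed by all natural numbers;
  \<open>mpoly_ring n\<close> is the ring in the first \<open>n\<close> of them, and \<open>n = 0\<close> is allowed.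
\<close>

type_synonym 'k mpoly = "(nat \<Rightarrow>\<^sub>0 nat) \<Rightarrow>\<^sub>0 'k"

definition mpoly_ring :: "nat \<Rightarrow> ('k::comm_ring_1) mpoly ring" where
  "mpoly_ring n =
    \<lparr>carrier = {p. \<forall>m\<in>Poly_Mapping.keys p. Poly_Mapping.keys m \<subseteq> {..<n}},
     mult = (*), one = 1, zero = 0, add = (+)\<rparr>"

definition mpoly_const :: "'k::zero \<Rightarrow> 'k mpoly" where
  "mpoly_const c = Poly_Mapping.single 0 c"

definition mpoly_var :: "nat \<Rightarrow> ('k::comm_ring_1) mpoly" where
  "mpoly_var i = Poly_Mapping.single (Poly_Mapping.single i 1) 1"

text \<open>
  The truncated subtraction of exponents is harmless: if \<open>i\<close> does not occur in the
  monomial \<open>m\<close>, then the coefficient below is zero.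
\<close>

definition mpoly_deriv :: "nat \<Rightarrow> ('k::comm_ring_1) mpoly \<Rightarrow> 'k mpoly" where
  "mpoly_deriv i p = (\<Sum>m\<in>Poly_Mapping.keys p.
     Poly_Mapping.single (m - Poly_Mapping.single i 1)
       (of_nat (Poly_Mapping.lookup m i) * Poly_Mapping.lookup p m))"

section \<open>The symmetric algebra of a Lie algebra\<close>

text \<open>
  The list \<open>xs\<close> is an ordered basis of the Lie algebra, so that the symmetric algebra is
  \<open>mpoly_ring (length xs)\<close>, where the \<open>i\<close>-th variable stands for \<open>xs ! i\<close>. The inclusion of
  the Lie algebra into it sends a vector to the linear form given by its coordinates.
\<close>

definition sym_incl :: "('k::field \<Rightarrow> 'g::ab_group_add \<Rightarrow> 'g) \<Rightarrow> 'g list \<Rightarrow> 'g \<Rightarrow> 'k mpoly" where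
  "sym_incl scale xs v =
    (\<Sum>l<length xs. mpoly_const (module.representation scale (set xs) v (xs ! l)) * mpoly_var l)"

definition sym_bracket ::
    "('k::field \<Rightarrow> 'g::ab_group_add \<Rightarrow> 'g) \<Rightarrow> ('g \<Rightarrow> 'g \<Rightarrow> 'g) \<Rightarrow> 'g list
      \<Rightarrow> 'k mpoly \<Rightarrow> 'k mpoly \<Rightarrow> 'k mpoly" where
  "sym_bracket scale lie xs f g =
    (\<Sum>j<length xs. \<Sum>i<j. sym_incl scale xs (lie (xs ! i) (xs ! j)) *
       (mpoly_deriv i f * mpoly_deriv j g - mpoly_deriv j f * mpoly_deriv i g))"

section \<open>Poisson ideals\<close>

text \<open>In the following, \<open>br\<close> is a Poisson bracket on the commutative ring \<open>R\<close>.\<close>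

definition poisson_ideal :: "('a, 'm) ring_scheme \<Rightarrow> ('a \<Rightarrow> 'a \<Rightarrow> 'a) \<Rightarrow> 'a set \<Rightarrow> bool" where
  "poisson_ideal R br I \<longleftrightarrow> ideal I R \<and> (\<forall>a\<in>carrier R. \<forall>b\<in>I. br a b \<in> I)"

definition poisson_spec :: "('a, 'm) ring_scheme \<Rightarrow> ('a \<Rightarrow> 'a \<Rightarrow> 'a) \<Rightarrow> 'a set set" where
  "poisson_spec R br = {P. primeideal P R \<and> poisson_ideal R br P}"

definition is_poisson_core ::
    "('a, 'm) ring_scheme \<Rightarrow> ('a \<Rightarrow> 'a \<Rightarrow> 'a) \<Rightarrow> 'a set \<Rightarrow> 'a set \<Rightarrow> bool" where
  "is_poisson_core R br I J \<longleftrightarrow> poisson_ideal R br J \<and> J \<subseteq> I \<and>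
     (\<forall>J'. poisson_ideal R br J' \<and> J' \<subseteq> I \<longrightarrow> J' \<subseteq> J)"

definition poisson_center :: "('a, 'm) ring_scheme \<Rightarrow> ('a \<Rightarrow> 'a \<Rightarrow> 'a) \<Rightarrow> 'a set" where
  "poisson_center R br = {b \<in> carrier R. \<forall>a\<in>carrier R. br a b = \<zero>\<^bsub>R\<^esub>}"

section \<open>Induced brackets on quotients and fraction fields\<close>

text \<open>
  As in the library's quotient ring, operations on classes are given by the
  union of the results over all representatives; these results all coincide when the
  operation is well defined.
\<close>

definition quot_bracket ::
    "('a, 'm) ring_scheme \<Rightarrow> ('a \<Rightarrow> 'a \<Rightarrow> 'a) \<Rightarrow> 'a set \<Rightarrow> 'a set \<Rightarrow> 'a set \<Rightarrow> 'a set" where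
  "quot_bracket R br I U V = (\<Union>x\<in>U. \<Union>y\<in>V. I +>\<^bsub>R\<^esub> br x y)"

definition frac_rel :: "('a, 'm) ring_scheme \<Rightarrow> (('a \<times> 'a) \<times> ('a \<times> 'a)) set" where
  "frac_rel R = {((a, b), (c, d)).
     a \<in> carrier R \<and> b \<in> carrier R - {\<zero>\<^bsub>R\<^esub>} \<and> c \<in> carrier R \<and> d \<in> carrier R - {\<zero>\<^bsub>R\<^esub>} \<and>
     a \<otimes>\<^bsub>R\<^esub> d = c \<otimes>\<^bsub>R\<^esub> b}"

definition fraction :: "('a, 'm) ring_scheme \<Rightarrow> 'a \<Rightarrow> 'a \<Rightarrow> ('a \<times> 'a) set" where
  "fraction R a b = frac_rel R `` {(a, b)}"

definition frac_field :: "('a, 'm) ring_scheme \<Rightarrow> ('a \<times> 'a) set ring" where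
  "frac_field R =
    \<lparr>carrier = (carrier R \<times> (carrier R - {\<zero>\<^bsub>R\<^esub>})) // frac_rel R,
     mult = (\<lambda>U V. \<Union>(a, b)\<in>U. \<Union>(c, d)\<in>V. fraction R (a \<otimes>\<^bsub>R\<^esub> c) (b \<otimes>\<^bsub>R\<^esub> d)),
     one = fraction R \<one>\<^bsub>R\<^esub> \<one>\<^bsub>R\<^esub>,
     zero = fraction R \<zero>\<^bsub>R\<^esub> \<one>\<^bsub>R\<^esub>,
     add = (\<lambda>U V. \<Union>(a, b)\<in>U. \<Union>(c, d)\<in>V.
              fraction R (a \<otimes>\<^bsub>R\<^esub> d \<oplus>\<^bsub>R\<^esub> c \<otimes>\<^bsub>R\<^esub> b) (b \<otimes>\<^bsub>R\<^esub> d))\<rparr>"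

text \<open>
  The quotient rule \<open>{a/b, y} = (b {a, y} - a {b, y}) / b^2\<close>, applied in both arguments, gives
  \<open>{a/b, c/d} = (b (d {a, c} - c {a, d}) - a (d {b, c} - c {b, d})) / (b^2 d^2)\<close>.
\<close>

definition frac_bracket ::
    "('a, 'm) ring_scheme \<Rightarrow> ('a \<Rightarrow> 'a \<Rightarrow> 'a) \<Rightarrow> ('a \<times> 'a) set \<Rightarrow> ('a \<times> 'a) set \<Rightarrow> ('a \<times> 'a) set" where
  "frac_bracket R br U V = (\<Union>(a, b)\<in>U. \<Union>(c, d)\<in>V.
     fraction R
       (b \<otimes>\<^bsub>R\<^esub> (d \<otimes>\<^bsub>R\<^esub> br a c \<ominus>\<^bsub>R\<^esub> c \<otimes>\<^bsub>R\<^esub> br a d) \<ominus>\<^bsub>R\<^esub>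
        a \<otimes>\<^bsub>R\<^esub> (d \<otimes>\<^bsub>R\<^esub> br b c \<ominus>\<^bsub>R\<^esub> c \<otimes>\<^bsub>R\<^esub> br b d))
       ((b \<otimes>\<^bsub>R\<^esub> b) \<otimes>\<^bsub>R\<^esub> (d \<otimes>\<^bsub>R\<^esub> d)))"

section \<open>The three properties of prime Poisson ideals\<close>

definition poisson_locally_closed ::
    "('a, 'm) ring_scheme \<Rightarrow> ('a \<Rightarrow> 'a \<Rightarrow> 'a) \<Rightarrow> 'a set \<Rightarrow> bool" where
  "poisson_locally_closed R br P \<longleftrightarrow> carrier R \<inter> \<Inter>{Q \<in> poisson_spec R br. P \<subset> Q} \<noteq> P"

definition poisson_primitive ::
    "('a, 'm) ring_scheme \<Rightarrow> ('a \<Rightarrow> 'a \<Rightarrow> 'a) \<Rightarrow> 'a set \<Rightarrow> bool" where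
  "poisson_primitive R br P \<longleftrightarrow> (\<exists>M. maximalideal M R \<and> is_poisson_core R br M P)"

text \<open>
  Here \<open>K\<close> is the copy of the ground field inside \<open>R\<close>; its image in the fraction field of
  \<open>R Quot P\<close> consists of the fractions with numerator in the image of \<open>K\<close> and denominator one.
\<close>

definition poisson_rational ::
    "('a, 'm) ring_scheme \<Rightarrow> 'a set \<Rightarrow> ('a \<Rightarrow> 'a \<Rightarrow> 'a) \<Rightarrow> 'a set \<Rightarrow> bool" where
  "poisson_rational R K br P \<longleftrightarrow>
    (\<forall>z \<in> poisson_center (frac_field (R Quot P)) (frac_bracket (R Quot P) (quot_bracket R br P)).
       (ring.algebraic (frac_field (R Quot P)) over
         (\<lambda>c. fraction (R Quot P) (P +>\<^bsub>R\<^esub> c) \<one>\<^bsub>R Quot P\<^esub>) ` K) z)"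

end

theory Submission
  imports Defs "HOL-Computational_Algebra.Fraction_Field"
begin

text \<open>
  The Hamiltonian derivations \<open>\<delta>\<^sub>i = {x\<^sub>i, -}\<close> of \<open>A\<close> are linear, and the Poisson ideals are the
  ideals stable under them. Locally closed implies primitive by the Nullstellensatz, since the core
  of a prime ideal is prime. If \<open>P\<close> is the core of a maximal ideal \<open>M\<close> and \<open>z\<close> is a constant of the
  fraction field of \<open>A/P\<close>, then the denominators of \<open>z\<close> form a stable ideal, so \<open>z\<close> can be evaluated
  at \<open>M\<close>; for a polynomial \<open>p\<close> over \<open>k\<close> with \<open>p(z)\<close> vanishing at \<open>M\<close>, the multiples of \<open>p(z)\<close> in
  \<open>A/P\<close> form a stable ideal inside \<open>M/P\<close>, so \<open>p(z) = 0\<close>.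

  For a rational \<open>P\<close>, let \<open>Y\<close> be a generic matrix on which the \<open>\<delta>\<^sub>i\<close> act by their matrices on the
  span of the \<open>x\<^sub>j\<close>, and let \<open>E x\<^sub>j = \<Sum>\<^sub>l Y\<^sub>j\<^sub>l x\<^sub>l\<close> (\<open>coact\<close> below). For a stable
  prime \<open>Q\<close>, let \<open>r(Q)\<close> (\<open>generic Q\<close> below) be the prime
  of \<open>A[Y]\<close> of all elements whose iterated derivatives in \<open>Y\<close> lie in \<open>Q\<close> at \<open>Y = 1\<close>; it defines the
  closure of the acting group, and \<open>E\<close> is the orbit map of the generic point of \<open>Q\<close>. Algebraic
  dependence over \<open>A\<close> among the \<open>Y\<^sub>j\<^sub>l\<close> modulo \<open>r(Q)\<close> does not depend on \<open>Q\<close>. Complete a maximal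
  independent subset of the \<open>E x\<^sub>j\<close> modulo \<open>r(P)\<close> by some \<open>Y\<^sub>j\<^sub>l\<close> to a transcendence basis \<open>Z\<close>. Take a
  coefficient outside \<open>r(P)\<close> of an equation of each \<open>Y\<^sub>j\<^sub>l\<close> over \<open>Z\<close>. If their product is not in \<open>r(Q)\<close>, then
  \<open>Z\<close> is still independent modulo \<open>r(Q)\<close>; this excludes a proper stable prime \<open>Q \<supset> P\<close>, because a
  Wronskian argument and rationality show that \<open>A/P\<close> is algebraic over the \<open>x\<^sub>j\<close> chosen. So some
  derivative at \<open>Y = 1\<close> of this product lies outside \<open>P\<close> but in every such \<open>Q\<close>.
\<close>

section \<open>Algebraic dependence modulo a prime ideal\<close>

text \<open>The derivations \<open>\<delta>\<close> need not come from an algebraic group, and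
  \<open>k\<close> need not be algebraically closed, so there are no orbits whose dimensions could
  be compared. The prime \<open>r(Q)\<close> replaces the group by its formal germ at
  \<open>Y = 1\<close>; it is prime because in characteristic zero the largest stable part of a
  prime is prime. Dependence among matrix entries is the same at all \<open>Q\<close> because
  iterated derivatives at \<open>Y = 1\<close> of polynomials in \<open>Y\<close> over
  \<open>k\<close> are scalars. The exclusion of \<open>Q\<close> is a count: if the coefficients
  survive, \<open>Z\<close> still spans modulo \<open>r(Q)\<close>, and its size forces it to stay
  independent. Then the chosen \<open>E x\<close> are independent over \<open>A\<close> modulo
  \<open>r(Q)\<close>, so every polynomial over \<open>k\<close> in the chosen variables that lies
  in \<open>Q\<close> lies in \<open>P\<close>. But \<open>A/P\<close> is algebraic over these
  variables, so a proper \<open>Q\<close> contains such a polynomial outside \<open>P\<close>.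
  Dependence is phrased by congruences modulo a prime, with some coefficient outside it, because a
  relation found modulo \<open>r(P)\<close> has to be read again modulo \<open>r(Q)\<close>.\<close>

definition unital_subring :: "'a::comm_ring_1 set \<Rightarrow> bool" where
  "unital_subring B \<longleftrightarrow> 1 \<in> B \<and> (\<forall>a\<in>B. \<forall>b\<in>B. a - b \<in> B \<and> a * b \<in> B)"

lemma unital_subringD:
  assumes "unital_subring B"
  shows "1 \<in> B" "0 \<in> B" "a \<in> B \<Longrightarrow> b \<in> B \<Longrightarrow> a - b \<in> B" "a \<in> B \<Longrightarrow> b \<in> B \<Longrightarrow> a * b \<in> B"
    "a \<in> B \<Longrightarrow> - a \<in> B" "a \<in> B \<Longrightarrow> b \<in> B \<Longrightarrow> a + b \<in> B" "a \<in> B \<Longrightarrow> a ^ n \<in> B"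
proof -
  show 1: "1 \<in> B" and d: "\<And>a b. a \<in> B \<Longrightarrow> b \<in> B \<Longrightarrow> a - b \<in> B"
    and m: "\<And>a b. a \<in> B \<Longrightarrow> b \<in> B \<Longrightarrow> a * b \<in> B"
    using assms by (auto simp: unital_subring_def)
  show 0: "0 \<in> B" using d[OF 1 1] by simp
  show n: "\<And>a. a \<in> B \<Longrightarrow> - a \<in> B" using d[OF 0] by force
  show "a \<in> B \<Longrightarrow> b \<in> B \<Longrightarrow> a + b \<in> B" for a b using d[OF _ n, of a b] by simp
  show "a \<in> B \<Longrightarrow> a ^ n \<in> B" by (induction n) (auto intro: 1 m)
qed

lemma unital_subring_sum:
  "unital_subring B \<Longrightarrow> (\<And>i. i \<in> I \<Longrightarrow> f i \<in> B) \<Longrightarrow> sum f I \<in> B"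
  by (induction I rule: infinite_finite_induct) (auto intro: unital_subringD)

lemma unital_subring_prod:
  "unital_subring B \<Longrightarrow> (\<And>i. i \<in> I \<Longrightarrow> f i \<in> B) \<Longrightarrow> prod f I \<in> B"
  by (induction I rule: infinite_finite_induct) (auto intro: unital_subringD)

lemma unital_subring_UNIV: "unital_subring UNIV"
  by (simp add: unital_subring_def)

section \<open>Generated subrings and polynomial expressions in one element\<close>

inductive_set subring_gen :: "'a::comm_ring_1 set \<Rightarrow> 'a set" for S where
  one: "1 \<in> subring_gen S"
| base: "a \<in> S \<Longrightarrow> a \<in> subring_gen S"
| diff: "a \<in> subring_gen S \<Longrightarrow> b \<in> subring_gen S \<Longrightarrow> a - b \<in> subring_gen S"
| mult: "a \<in> subring_gen S \<Longrightarrow> b \<in> subring_gen S \<Longrightarrow> a * b \<in> subring_gen S"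

lemma unital_subring_gen [simp]: "unital_subring (subring_gen S)"
  by (auto simp: unital_subring_def intro: subring_gen.intros)

lemma subring_gen_least:
  assumes "unital_subring B" "S \<subseteq> B" shows "subring_gen S \<subseteq> B"
proof
  fix x assume "x \<in> subring_gen S"
  then show "x \<in> B" by induction (use assms in \<open>auto intro: unital_subringD\<close>)
qed

lemma subring_gen_superset: "S \<subseteq> subring_gen S"
  by (auto intro: subring_gen.base)

lemma subring_gen_mono: "S \<subseteq> S' \<Longrightarrow> subring_gen S \<subseteq> subring_gen S'"
  by (rule subring_gen_least) (auto intro: subring_gen.base)

lemma subring_gen_self: "unital_subring B \<Longrightarrow> subring_gen B = B"
  by (simp add: subring_gen_least subring_gen_superset subset_antisym)

text \<open>Each element involves finitely many generators; in \<open>alg_trans\<close> this reduces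
  an arbitrary set of algebraic elements to a finite one, on which one can induct.\<close>

lemma subring_gen_finite_support:
  assumes "x \<in> subring_gen (B \<union> S)"
  shows "\<exists>F\<subseteq>S. finite F \<and> x \<in> subring_gen (B \<union> F)"
  using assms
proof induction
  case one
  then show ?case by (intro exI[of _ "{}"]) (auto intro: subring_gen.one)
next
  case (base a)
  then show ?case
    by (intro exI[of _ "S \<inter> {a}"]) (auto intro: subring_gen.base)
next
  case (diff a b)
  then obtain F G where "F \<subseteq> S" "finite F" "a \<in> subring_gen (B \<union> F)"
    and "G \<subseteq> S" "finite G" "b \<in> subring_gen (B \<union> G)" by blast
  then show ?case
    by (intro exI[of _ "F \<union> G"])
      (auto intro!: subring_gen.diff intro: subsetD[OF subring_gen_mono, rotated])
next
  case (mult a b)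
  then obtain F G where "F \<subseteq> S" "finite F" "a \<in> subring_gen (B \<union> F)"
    and "G \<subseteq> S" "finite G" "b \<in> subring_gen (B \<union> G)" by blast
  then show ?case
    by (intro exI[of _ "F \<union> G"])
      (auto intro!: subring_gen.mult intro: subsetD[OF subring_gen_mono, rotated])
qed

text \<open>Polynomials in \<open>x\<close> over \<open>C\<close>, nested as
  \<open>c + x * f\<close>: closure under the ring operations then goes by structural induction,
  with no bookkeeping of degrees.\<close>

inductive_set horner :: "'a::comm_ring_1 set \<Rightarrow> 'a \<Rightarrow> 'a set" for C x where
  const: "c \<in> C \<Longrightarrow> c \<in> horner C x"
| step: "c \<in> C \<Longrightarrow> f \<in> horner C x \<Longrightarrow> c + x * f \<in> horner C x"

lemma horner_diff:
  assumes C: "unital_subring C"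
  shows "f \<in> horner C x \<Longrightarrow> g \<in> horner C x \<Longrightarrow> f - g \<in> horner C x"
proof (induction arbitrary: g rule: horner.induct)
  case (const c)
  from const(2) show ?case
  proof cases
    case const
    then show ?thesis using C \<open>c \<in> C\<close> by (auto intro: horner.const unital_subringD)
  next
    case (step c' f)
    have "- f' \<in> horner C x" if "f' \<in> horner C x" for f'
      using that
    proof induction
      case (step c' f')
      then have "- c' + x * (- f') \<in> horner C x" by (intro horner.step unital_subringD(5)[OF C])
      then show ?case by simp
    qed (auto intro: horner.const unital_subringD[OF C])
    then have "(c - c') + x * (- f) \<in> horner C x"
      using step \<open>c \<in> C\<close> C by (intro horner.step unital_subringD(3-5)[OF C]) auto
    then show ?thesis using step by (simp add: algebra_simps)
  qed
next
  case (step c f)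
  from step(4) show ?case
  proof cases
    case const
    then have "(c - g) + x * f \<in> horner C x" using step C by (intro horner.step unital_subringD(3-5)[OF C]) auto
    then show ?thesis by (simp add: algebra_simps)
  next
    case (step c' f')
    then have "(c - c') + x * (f - f') \<in> horner C x"
      using step.prems step.hyps step.IH C \<open>c \<in> C\<close>
      by (intro horner.step unital_subringD(3-5)[OF C]) auto
    then show ?thesis using step by (simp add: algebra_simps)
  qed
qed

lemma unital_subring_horner:
  assumes C: "unital_subring C"
  shows "unital_subring (horner C x)"
proof -
  have z: "0 \<in> horner C x" by (rule horner.const[OF unital_subringD(2)[OF C]])
  have neg: "g \<in> horner C x \<Longrightarrow> - g \<in> horner C x" for g
    using horner_diff[OF C z] by force
  have add: "f \<in> horner C x \<Longrightarrow> g \<in> horner C x \<Longrightarrow> f + g \<in> horner C x" for f g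
    using horner_diff[OF C _ neg, of f g] by simp
  have c: "c \<in> C \<Longrightarrow> g \<in> horner C x \<Longrightarrow> c * g \<in> horner C x" for c g
  proof (rotate_tac, induction rule: horner.induct)
    case (step c' f)
    then have "c * c' + x * (c * f) \<in> horner C x" using C by (intro horner.step unital_subringD(3-5)[OF C]) auto
    then show ?case by (simp add: algebra_simps)
  qed (auto intro: horner.const unital_subringD[OF C])
  have xx: "g \<in> horner C x \<Longrightarrow> x * g \<in> horner C x" for g
    using horner.step[OF unital_subringD(2)[OF C], of g] by simp
  have "f \<in> horner C x \<Longrightarrow> g \<in> horner C x \<Longrightarrow> f * g \<in> horner C x" for f g
  proof (induction rule: horner.induct)
    case (step c' f)
    then have "c' * g + x * (f * g) \<in> horner C x" by (intro add c[of c'] xx)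
    then show ?case by (simp add: algebra_simps)
  qed (rule c)
  then show ?thesis
    using horner_diff[OF C] horner.const[OF unital_subringD(1)[OF C]]
    by (auto simp: unital_subring_def)
qed

lemma subring_gen_insert_horner:
  assumes C: "unital_subring C"
  shows "subring_gen (C \<union> {x}) \<subseteq> horner C x"
proof (rule subring_gen_least[OF unital_subring_horner[OF C]])
  have "0 + x * 1 \<in> horner C x"
    by (intro horner.intros unital_subringD[OF C])
  then show "C \<union> {x} \<subseteq> horner C x" by (auto intro: horner.const)
qed

lemma horner_sumE:
  assumes "f \<in> horner C x" "0 \<in> C"
  shows "\<exists>d p. (\<forall>i. p i \<in> C) \<and> f = (\<Sum>i\<le>d. p i * x ^ i)"
  using assms
proof induction
  case (const c)
  show ?case using const by (intro exI[of _ 0] exI[of _ "\<lambda>_. c"]) auto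
next
  case (step c f)
  then obtain d p where p: "\<forall>i. p i \<in> C" "f = (\<Sum>i\<le>d. p i * x ^ i)" by blast
  have "c + x * f = (\<Sum>i\<le>Suc d. (case i of 0 \<Rightarrow> c | Suc i \<Rightarrow> p i) * x ^ i)"
    unfolding p(2) by (subst sum.atMost_Suc_shift) (simp add: sum_distrib_left algebra_simps)
  then show ?case using p(1) step(1)
    by (intro exI[of _ "Suc d"] exI[of _ "\<lambda>i. case i of 0 \<Rightarrow> c | Suc i \<Rightarrow> p i"]) (auto split: nat.split)
qed

lemma subring_gen_insert_sum:
  assumes "unital_subring C" "f \<in> subring_gen (C \<union> {x})"
  shows "\<exists>d p. (\<forall>i. p i \<in> C) \<and> f = (\<Sum>i\<le>d. p i * x ^ i)"
  using horner_sumE[of f C x] subring_gen_insert_horner[of C x] assms unital_subringD by blast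

text \<open>The domain \<open>R/P\<close> is not formed at this stage: congruences modulo
  \<open>P\<close> allow the same elements to be compared modulo several primes.\<close>

locale prime_mod =
  fixes R P :: "'a::comm_ring_1 set"
  assumes R: "unital_subring R"
    and P_sub: "P \<subseteq> R"
    and P_add: "a \<in> P \<Longrightarrow> b \<in> P \<Longrightarrow> a + b \<in> P"
    and P_mult: "a \<in> R \<Longrightarrow> b \<in> P \<Longrightarrow> a * b \<in> P"
    and P_one: "1 \<notin> P"
    and P_zero: "0 \<in> P"
    and P_prime: "a \<in> R \<Longrightarrow> b \<in> R \<Longrightarrow> a * b \<in> P \<Longrightarrow> a \<in> P \<or> b \<in> P"
begin

lemma P_neg: "a \<in> P \<Longrightarrow> - a \<in> P"
  using P_mult[of "-1" a] R by (auto intro: unital_subringD)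

lemma P_diff: "a \<in> P \<Longrightarrow> b \<in> P \<Longrightarrow> a - b \<in> P"
  using P_add[of a "-b"] P_neg by auto

lemma P_mult_right: "a \<in> P \<Longrightarrow> b \<in> R \<Longrightarrow> a * b \<in> P"
  using P_mult[of b a] by (simp add: mult.commute)

lemma P_sum: "(\<And>i. i \<in> I \<Longrightarrow> f i \<in> P) \<Longrightarrow> sum f I \<in> P"
  by (induction I rule: infinite_finite_induct) (auto intro: P_zero P_add)

lemma P_add_iff: "a \<in> P \<Longrightarrow> a + b \<in> P \<longleftrightarrow> b \<in> P"
  using P_add P_diff[of "a + b" a] by auto

lemma P_cong: "a - b \<in> P \<Longrightarrow> a \<in> P \<longleftrightarrow> b \<in> P"
  using P_add[of "a - b" b] P_diff[of a "a - b"] by auto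

lemma P_mult_iff: "a \<in> R \<Longrightarrow> b \<in> R \<Longrightarrow> a * b \<in> P \<longleftrightarrow> a \<in> P \<or> b \<in> P"
  using P_prime P_mult P_mult_right by blast

lemma P_power: "a \<in> R \<Longrightarrow> a ^ n \<in> P \<Longrightarrow> a \<in> P"
  by (induction n) (use P_one in \<open>auto simp: P_mult_iff unital_subringD[OF R]\<close>)

lemma P_prod:
  "finite I \<Longrightarrow> (\<And>i. i \<in> I \<Longrightarrow> f i \<in> R) \<Longrightarrow> prod f I \<in> P \<Longrightarrow> \<exists>i\<in>I. f i \<in> P"
proof (induction I rule: finite_induct)
  case (insert x F)
  then have "f x \<in> P \<or> prod f F \<in> P"
    using unital_subring_prod[OF R, of F f] by (intro P_prime) auto
  then show ?case using insert by auto
qed (use P_one in simp)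

text \<open>Gaussian elimination over the domain \<open>B\<close> modulo \<open>P\<close>, with
  cross-multiplication by the pivot \<open>c i0 j0\<close> in place of division.\<close>

lemma linear_system:
  assumes B: "unital_subring B" "B \<subseteq> R" and "finite J" "finite I" "card J < card I"
    and c: "\<And>i j. i \<in> I \<Longrightarrow> j \<in> J \<Longrightarrow> c i j \<in> B"
  shows "\<exists>a. (\<forall>i\<in>I. a i \<in> B) \<and> (\<exists>i\<in>I. a i \<notin> P) \<and> (\<forall>j\<in>J. (\<Sum>i\<in>I. a i * c i j) \<in> P)"
  using assms(3-)
proof (induction J arbitrary: I c rule: finite_induct)
  case empty
  then have "I \<noteq> {}" by auto
  then show ?case using P_one unital_subringD(1)[OF B(1)] by (intro exI[of _ "\<lambda>_. 1"]) auto
next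
  case (insert j0 J)
  note Bs = unital_subringD[OF B(1)]
  show ?case
  proof (cases "\<exists>i0\<in>I. c i0 j0 \<notin> P")
    case False
    have "card J < card I" using insert by auto
    then obtain a where a: "\<forall>i\<in>I. a i \<in> B" "\<exists>i\<in>I. a i \<notin> P"
      "\<forall>j\<in>J. (\<Sum>i\<in>I. a i * c i j) \<in> P" using insert.IH[of I c] insert.prems by blast
    have "(\<Sum>i\<in>I. a i * c i j0) \<in> P" using False a(1) B(2) by (intro P_sum P_mult) auto
    with a show ?thesis by (intro exI[of _ a]) auto
  next
    case True
    then obtain i0 where i0: "i0 \<in> I" "c i0 j0 \<notin> P" by blast
    define I' where "I' = I - {i0}"
    have I: "I = insert i0 I'" "i0 \<notin> I'" "finite I'" using i0 insert.prems by (auto simp: I'_def)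
    define c' where "c' i j = c i0 j0 * c i j - c i j0 * c i0 j" for i j
    have "\<exists>a. (\<forall>i\<in>I'. a i \<in> B) \<and> (\<exists>i\<in>I'. a i \<notin> P) \<and> (\<forall>j\<in>J. (\<Sum>i\<in>I'. a i * c' i j) \<in> P)"
      by (rule insert.IH) (use insert I i0 in \<open>auto simp: c'_def intro!: Bs\<close>)
    then obtain a where a: "\<forall>i\<in>I'. a i \<in> B" "\<exists>i\<in>I'. a i \<notin> P"
      "\<forall>j\<in>J. (\<Sum>i\<in>I'. a i * c' i j) \<in> P" by blast
    \<comment> \<open>The unknown \<open>i0\<close> is solved from equation \<open>j0\<close>.
      Scaling the other unknowns by the pivot clears its denominator, and they stay nonzero since
      \<open>P\<close> is prime.\<close>
    define b where "b i = (if i = i0 then - (\<Sum>i\<in>I'. a i * c i j0) else c i0 j0 * a i)" for i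
    have sum_b: "(\<Sum>i\<in>I. b i * c i j) = (\<Sum>i\<in>I'. a i * c' i j)" for j
    proof -
      have "(\<Sum>i\<in>I. b i * c i j) = b i0 * c i0 j + (\<Sum>i\<in>I'. b i * c i j)"
        using I by simp
      also have "(\<Sum>i\<in>I'. b i * c i j) = (\<Sum>i\<in>I'. c i0 j0 * a i * c i j)"
        by (rule sum.cong) (use I in \<open>auto simp: b_def\<close>)
      finally show ?thesis
        by (simp add: b_def c'_def sum_distrib_right sum_distrib_left sum_subtractf algebra_simps)
    qed
    show ?thesis
    proof (intro exI[of _ b] conjI ballI)
      fix i assume "i \<in> I"
      then show "b i \<in> B" using a(1) insert.prems i0 I
        by (auto simp: b_def intro!: Bs unital_subring_sum[OF B(1)])
    next
      from a(2) obtain i where i: "i \<in> I'" "a i \<notin> P" by blast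
      then have "b i \<notin> P" using i0 I a(1) insert.prems(3) B(2) by (auto simp: b_def dest!: P_prime[rotated 2])
      then show "\<exists>i\<in>I. b i \<notin> P" using i I by blast
    next
      fix j assume "j \<in> insert j0 J"
      then show "(\<Sum>i\<in>I. b i * c i j) \<in> P" unfolding sum_b using a(3)
        by (auto simp: c'_def algebra_simps intro: P_zero)
    qed
  qed
qed

text \<open>Algebraicity over the field of fractions of \<open>B\<close> modulo \<open>P\<close>,
  with denominators cleared. Any one coefficient may be the one outside \<open>P\<close>, so a
  relation can be read modulo a larger prime as soon as that coefficient survives.\<close>

definition alg :: "'a set \<Rightarrow> 'a \<Rightarrow> bool" where
  "alg B x \<longleftrightarrow> (\<exists>d p. (\<forall>i\<le>d. p i \<in> B) \<and> (\<exists>i\<le>d. p i \<notin> P) \<and> (\<Sum>i\<le>d. p i * x ^ i) \<in> P)"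

lemma alg_mono: "alg B x \<Longrightarrow> B \<subseteq> B' \<Longrightarrow> alg B' x"
  unfolding alg_def by blast

lemma alg_self: "unital_subring B \<Longrightarrow> x \<in> B \<Longrightarrow> alg B x"
  unfolding alg_def using P_one P_zero
  by (intro exI[of _ 1] exI[of _ "\<lambda>i. if i = 0 then - x else 1"])
    (auto intro: unital_subringD)

lemma alg_leading:
  assumes "alg B x" "B \<subseteq> R" "x \<in> R"
  obtains d p where "\<forall>i\<le>d. p i \<in> B" "p d \<notin> P" "(\<Sum>i\<le>d. p i * x ^ i) \<in> P" "d > 0"
proof -
  from assms obtain d p where p: "\<forall>i\<le>d. p i \<in> B" "\<exists>i\<le>d. p i \<notin> P" "(\<Sum>i\<le>d. p i * x ^ i) \<in> P"
    unfolding alg_def by blast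
  define e where "e = Max {i. i \<le> d \<and> p i \<notin> P}"
  have fin: "finite {i. i \<le> d \<and> p i \<notin> P}" by simp
  have "e \<in> {i. i \<le> d \<and> p i \<notin> P}" unfolding e_def using p(2) by (intro Max_in) auto
  then have e: "e \<le> d" "p e \<notin> P" by auto
  have gt: "p i \<in> P" if "i \<le> d" "i > e" for i
    using Max_ge[OF fin, of i] that unfolding e_def[symmetric] by auto
  have split: "{..d} = {..e} \<union> {e<..d}" using e by auto
  have "(\<Sum>i\<le>d. p i * x ^ i) = (\<Sum>i\<le>e. p i * x ^ i) + (\<Sum>i\<in>{e<..d}. p i * x ^ i)"
    unfolding split by (rule sum.union_disjoint) auto
  moreover have "(\<Sum>i\<in>{e<..d}. p i * x ^ i) \<in> P"
    using gt assms by (intro P_sum P_mult_right) (auto intro: unital_subringD[OF R])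
  ultimately have "(\<Sum>i\<le>e. p i * x ^ i) \<in> P" using p(3) P_add_iff by (metis add.commute)
  moreover have "e > 0" using calculation e(2) by (cases e) auto
  ultimately show ?thesis using that[of e p] p(1) e by auto
qed

lemma alg_trailing:
  assumes "alg B x" "B \<subseteq> R" "x \<in> R" "x \<notin> P"
  obtains d p where "\<forall>i\<le>d. p i \<in> B" "p 0 \<notin> P" "(\<Sum>i\<le>d. p i * x ^ i) \<in> P"
proof -
  from assms obtain d p where "\<forall>i\<le>d. p i \<in> B" "\<exists>i\<le>d. p i \<notin> P" "(\<Sum>i\<le>d. p i * x ^ i) \<in> P"
    unfolding alg_def by blast
  then have "\<exists>d p. (\<forall>i\<le>d. p i \<in> B) \<and> p 0 \<notin> P \<and> (\<Sum>i\<le>d. p i * x ^ i) \<in> P"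
  proof (induction d arbitrary: p)
    case 0
    then show ?case by (intro exI[of _ 0] exI[of _ p]) auto
  next
    case (Suc d)
    show ?case
    proof (cases "p 0 \<in> P")
      case True
      have eq: "(\<Sum>i\<le>Suc d. p i * x ^ i) = p 0 + x * (\<Sum>i\<le>d. p (Suc i) * x ^ i)"
        by (subst sum.atMost_Suc_shift) (simp add: sum_distrib_left algebra_simps)
      have "(\<Sum>i\<le>d. p (Suc i) * x ^ i) \<in> R"
        using Suc.prems(1) assms
        by (intro unital_subring_sum[OF R]) (auto intro!: unital_subringD[OF R])
      moreover have "x * (\<Sum>i\<le>d. p (Suc i) * x ^ i) \<in> P"
        using Suc.prems(3) True unfolding eq by (simp add: P_add_iff)
      ultimately have "(\<Sum>i\<le>d. p (Suc i) * x ^ i) \<in> P" using P_prime assms by blast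
      moreover have "\<exists>i\<le>d. p (Suc i) \<notin> P" using Suc.prems(2) True
        by (metis Suc_le_mono not0_implies_Suc)
      ultimately show ?thesis using Suc.IH[of "\<lambda>i. p (Suc i)"] Suc.prems(1) by auto
    next
      case False
      then show ?thesis using Suc.prems by (intro exI[of _ "Suc d"] exI[of _ p]) auto
    qed
  qed
  then show ?thesis using that by blast
qed

text \<open>The constant coefficient of a relation is a multiple of \<open>x\<close> modulo
  \<open>P\<close>. This is a division-free inverse: denominators from \<open>C\<close> are
  exchanged for denominators from \<open>B\<close>, and with scalars for \<open>B\<close> it inverts
  elements modulo a maximal ideal.\<close>

lemma alg_constant_multiple:
  assumes "alg B x" "B \<subseteq> C" "unital_subring C" "C \<subseteq> R" "x \<in> C" "x \<notin> P"
  obtains b c where "b \<in> B" "b \<notin> P" "c \<in> C" "c * x - b \<in> P"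
proof -
  obtain d p where p: "\<forall>i\<le>d. p i \<in> B" "p 0 \<notin> P" "(\<Sum>i\<le>d. p i * x ^ i) \<in> P"
    using alg_trailing[OF assms(1)] assms by blast
  show ?thesis
  proof (cases d)
    case 0
    then show ?thesis using p by auto
  next
    case (Suc e)
    let ?s = "\<Sum>i\<le>e. p (Suc i) * x ^ i"
    have "(\<Sum>i\<le>d. p i * x ^ i) = p 0 + x * ?s"
      unfolding Suc by (subst sum.atMost_Suc_shift) (simp add: sum_distrib_left algebra_simps)
    then have "- (\<Sum>i\<le>d. p i * x ^ i) = - ?s * x - p 0" by (simp add: algebra_simps)
    then have "- ?s * x - p 0 \<in> P" using P_neg[OF p(3)] by metis
    moreover have "- ?s \<in> C"
      using p(1) assms Suc
      by (intro unital_subringD[OF assms(3)] unital_subring_sum[OF assms(3)]) auto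
    ultimately show ?thesis using p that by blast
  qed
qed

text \<open>Spans and quasi-finite extensions: up to denominators in \<open>B\<close>, the elements of \<open>C\<close> lie in
  a finitely generated \<open>B\<close>-module modulo \<open>P\<close>.\<close>

inductive_set mod_span :: "'a set \<Rightarrow> 'a set \<Rightarrow> 'a set" for B E where
  zero: "a \<in> P \<Longrightarrow> a \<in> mod_span B E"
| base: "e \<in> E \<Longrightarrow> e \<in> mod_span B E"
| add: "f \<in> mod_span B E \<Longrightarrow> g \<in> mod_span B E \<Longrightarrow> f + g \<in> mod_span B E"
| scale: "b \<in> B \<Longrightarrow> f \<in> mod_span B E \<Longrightarrow> b * f \<in> mod_span B E"

definition quasi_finite :: "'a set \<Rightarrow> 'a set \<Rightarrow> bool" where
  "quasi_finite B C \<longleftrightarrow> (\<exists>E. finite E \<and> E \<subseteq> R \<and> (\<forall>f\<in>C. \<exists>b\<in>B. b \<notin> P \<and> b * f \<in> mod_span B E))"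

lemma mod_span_coeffs:
  assumes "f \<in> mod_span B E" "finite E" "unital_subring B" "B \<subseteq> R"
  shows "\<exists>r. (\<forall>e\<in>E. r e \<in> B) \<and> f - (\<Sum>e\<in>E. r e * e) \<in> P"
  using assms(1)
proof induction
  case (zero a)
  then show ?case using unital_subringD[OF assms(3)] by (intro exI[of _ "\<lambda>_. 0"]) auto
next
  case (base e)
  have "(\<Sum>e'\<in>E. (if e' = e then 1 else 0) * e') = e"
    using base assms by (subst sum.cong[OF refl, of _ _ "\<lambda>e'. if e' = e then e else 0"]) auto
  then show ?case using unital_subringD[OF assms(3)] P_zero
    by (intro exI[of _ "\<lambda>e'. if e' = e then 1 else 0"]) auto
next
  case (add f g)
  then obtain r r' where r: "\<forall>e\<in>E. r e \<in> B" "f - (\<Sum>e\<in>E. r e * e) \<in> P"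
    "\<forall>e\<in>E. r' e \<in> B" "g - (\<Sum>e\<in>E. r' e * e) \<in> P" by blast
  have eq: "(f + g) - (\<Sum>e\<in>E. (r e + r' e) * e) =
      (f - (\<Sum>e\<in>E. r e * e)) + (g - (\<Sum>e\<in>E. r' e * e))"
    by (simp add: sum.distrib algebra_simps)
  have "(f + g) - (\<Sum>e\<in>E. (r e + r' e) * e) \<in> P" unfolding eq by (rule P_add[OF r(2,4)])
  then show ?case using r(1,3) unital_subringD(6)[OF assms(3)]
    by (intro exI[of _ "\<lambda>e. r e + r' e"]) blast
next
  case (scale b f)
  then obtain r where r: "\<forall>e\<in>E. r e \<in> B" "f - (\<Sum>e\<in>E. r e * e) \<in> P" by blast
  have eq: "b * f - (\<Sum>e\<in>E. (b * r e) * e) = b * (f - (\<Sum>e\<in>E. r e * e))"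
    by (simp add: sum_distrib_left algebra_simps)
  have "b * f - (\<Sum>e\<in>E. (b * r e) * e) \<in> P" unfolding eq
    using P_mult[OF _ r(2), of b] scale assms by blast
  then show ?case using r(1) scale(1) unital_subringD(4)[OF assms(3)]
    by (intro exI[of _ "\<lambda>e. b * r e"]) blast
qed

text \<open>With \<open>card E\<close> generators, the \<open>card E + 1\<close> powers of
  \<open>x\<close> up to exponent \<open>card E\<close> are linearly dependent over \<open>B\<close>
  modulo \<open>P\<close>.\<close>

lemma alg_if_quasi_finite:
  assumes "quasi_finite B C" "unital_subring B" "B \<subseteq> R" "\<And>n. x ^ n \<in> C" "x \<in> R"
  shows "alg B x"
proof -
  from assms obtain E where E: "finite E" "E \<subseteq> R" "\<forall>f\<in>C. \<exists>b\<in>B. b \<notin> P \<and> b * f \<in> mod_span B E"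
    unfolding quasi_finite_def by blast
  have "\<exists>b r. b \<in> B \<and> b \<notin> P \<and> (\<forall>e\<in>E. r e \<in> B) \<and> b * x ^ n - (\<Sum>e\<in>E. r e * e) \<in> P" for n
    using E(3) assms(4)[of n] mod_span_coeffs[OF _ E(1) assms(2,3)] by blast
  then obtain b r where br: "\<And>n. b n \<in> B" "\<And>n. b n \<notin> P" "\<And>n e. e \<in> E \<Longrightarrow> r n e \<in> B"
    "\<And>n. b n * x ^ n - (\<Sum>e\<in>E. r n e * e) \<in> P" by metis
  obtain a where a: "\<forall>i\<in>{..card E}. a i \<in> B" "\<exists>i\<in>{..card E}. a i \<notin> P"
    "\<forall>e\<in>E. (\<Sum>i\<in>{..card E}. a i * r i e) \<in> P"
    using linear_system[OF assms(2,3) E(1), of "{..card E}" r] br by auto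
  let ?s = "\<Sum>e\<in>E. (\<Sum>i\<le>card E. a i * r i e) * e"
  have "(\<Sum>i\<le>card E. a i * (b i * x ^ i - (\<Sum>e\<in>E. r i e * e))) \<in> P"
    using a(1) br(4) assms(3) by (intro P_sum P_mult) auto
  moreover have "(\<Sum>i\<le>card E. a i * (b i * x ^ i - (\<Sum>e\<in>E. r i e * e))) =
    (\<Sum>i\<le>card E. a i * b i * x ^ i) - ?s"
    unfolding sum_distrib_right right_diff_distrib sum_subtractf sum_distrib_left
    by (subst sum.swap) (simp add: algebra_simps)
  moreover have "?s \<in> P"
    by (rule P_sum, rule P_mult_right) (use a(3) E(2) in auto)
  ultimately have sP: "(\<Sum>i\<le>card E. a i * b i * x ^ i) \<in> P"
    using P_add[of "(\<Sum>i\<le>card E. a i * b i * x ^ i) - ?s" ?s] by simp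
  obtain i where i: "i \<le> card E" "a i \<notin> P" using a(2) by auto
  have "a i \<in> R" "b i \<in> R" using a(1) i(1) br(1) assms(3) by auto
  then have ni: "a i * b i \<notin> P" using i(2) br(2) P_prime by blast
  have "a i * b i \<in> B" if "i \<le> card E" for i
    using a(1) br(1) that by (intro unital_subringD(4)[OF assms(2)]) auto
  then show ?thesis unfolding alg_def using sP i(1) ni
    by (intro exI[of _ "card E"] exI[of _ "\<lambda>i. a i * b i"]) blast
qed

lemma mod_span_mult_right:
  assumes "f \<in> mod_span B E" "g \<in> R" "\<And>e. e \<in> E \<Longrightarrow> e * g \<in> mod_span B E'"
  shows "f * g \<in> mod_span B E'"
  using assms(1)
  by induction (use assms in \<open>auto simp: distrib_right mult.assoc intro: mod_span.intros P_mult_right\<close>)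

text \<open>The span of \<open>E\<close> over the field of fractions of \<open>B\<close> modulo
  \<open>P\<close>, seen inside \<open>R\<close>.\<close>

definition saturation :: "'a set \<Rightarrow> 'a set \<Rightarrow> 'a set" where
  "saturation B E = {f\<in>R. \<exists>b\<in>B. b \<notin> P \<and> b * f \<in> mod_span B E}"

context
  fixes B E :: "'a set" assumes B: "unital_subring B" "B \<subseteq> R"
begin

lemma saturationI: "f \<in> R \<Longrightarrow> b \<in> B \<Longrightarrow> b \<notin> P \<Longrightarrow> b * f \<in> mod_span B E \<Longrightarrow> f \<in> saturation B E"
  unfolding saturation_def by blast

lemma saturationE:
  assumes "f \<in> saturation B E"
  obtains b where "f \<in> R" "b \<in> B" "b \<notin> P" "b * f \<in> mod_span B E"
  using assms unfolding saturation_def by blast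

lemma saturation_spn: "f \<in> mod_span B E \<Longrightarrow> f \<in> R \<Longrightarrow> f \<in> saturation B E"
  using saturationI[of f 1] P_one unital_subringD(1)[OF B(1)] by simp

lemma saturation_add:
  assumes "f \<in> saturation B E" "g \<in> saturation B E"
  shows "f + g \<in> saturation B E"
proof -
  obtain b where b: "f \<in> R" "b \<in> B" "b \<notin> P" "b * f \<in> mod_span B E"
    using assms(1) by (rule saturationE)
  obtain c where c: "g \<in> R" "c \<in> B" "c \<notin> P" "c * g \<in> mod_span B E"
    using assms(2) by (rule saturationE)
  have "c * (b * f) + b * (c * g) \<in> mod_span B E" using mod_span.add[OF mod_span.scale[OF c(2) b(4)] mod_span.scale[OF b(2) c(4)]] .
  then have "(b * c) * (f + g) \<in> mod_span B E" by (simp add: algebra_simps)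
  moreover have "b * c \<notin> P" using b c B P_prime by blast
  ultimately show ?thesis using b c
    by (intro saturationI[of _ "b * c"] unital_subringD(4)[OF B(1)] unital_subringD(6)[OF R])
qed

lemma saturation_scale:
  assumes c: "c \<in> B" and f: "f \<in> saturation B E"
  shows "c * f \<in> saturation B E"
proof -
  obtain b where b: "f \<in> R" "b \<in> B" "b \<notin> P" "b * f \<in> mod_span B E"
    using f by (rule saturationE)
  have "b * (c * f) \<in> mod_span B E" using mod_span.scale[OF c b(4)] by (simp add: algebra_simps)
  then show ?thesis using b c B by (intro saturationI[of _ b] unital_subringD(4)[OF R]) auto
qed

lemma saturation_cancel:
  assumes c: "c \<in> B" "c \<notin> P" and f: "f \<in> R" "c * f \<in> saturation B E"
  shows "f \<in> saturation B E"
proof -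
  obtain b where b: "b \<in> B" "b \<notin> P" "b * (c * f) \<in> mod_span B E"
    using f(2) by (rule saturationE)
  then have "(b * c) * f \<in> mod_span B E" by (simp add: algebra_simps)
  moreover have "b * c \<notin> P" using b B c P_prime by blast
  ultimately show ?thesis using b c f
    by (intro saturationI[of _ "b * c"] unital_subringD(4)[OF B(1)])
qed

lemma saturation_sum: "finite I \<Longrightarrow> (\<And>i. i \<in> I \<Longrightarrow> f i \<in> saturation B E) \<Longrightarrow> sum f I \<in> saturation B E"
proof (induction I rule: finite_induct)
  case empty
  then show ?case using P_zero unital_subringD(2)[OF R] by (auto intro: saturation_spn mod_span.zero)
next
  case (insert x F)
  then show ?case by (auto intro: saturation_add)
qed

end

text \<open>The powers \<open>x ^ i\<close> with \<open>i < d\<close> suffice, as the leading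
  coefficient \<open>p d\<close> of an equation of degree \<open>d\<close> may serve as a
  denominator.\<close>

lemma quasi_finite_adjoin:
  assumes B: "unital_subring B" "B \<subseteq> R" and "alg B x" "x \<in> R"
  shows "quasi_finite B (subring_gen (B \<union> {x}))"
proof -
  obtain d p where p: "\<forall>i\<le>d. p i \<in> B" "p d \<notin> P" "(\<Sum>i\<le>d. p i * x ^ i) \<in> P" "d > 0"
    by (rule alg_leading[OF assms(3) B(2) assms(4)])
  define E where "E = (\<lambda>i. x ^ i) ` {..<d}"
  have E: "finite E" "E \<subseteq> R" unfolding E_def using assms(4)
    by (auto simp: unital_subringD[OF R])
  have E1: "1 \<in> E" unfolding E_def using p(4) by (intro image_eqI[of _ _ 0]) auto
  have x_base: "x * e \<in> saturation B E" if "e \<in> E" for e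
  proof -
    from that obtain i where i: "i < d" "e = x ^ i" unfolding E_def by blast
    show ?thesis
    proof (cases "Suc i < d")
      case True
      have "x * e \<in> E" unfolding E_def i(2) using True by (intro image_eqI[of _ _ "Suc i"]) auto
      then show ?thesis using E(2) by (intro saturation_spn[OF B] mod_span.base) auto
    next
      case False
      \<comment> \<open>At the top power the product is \<open>x ^ d\<close>, which the equation
        rewrites by lower powers after multiplication by \<open>p d\<close>.\<close>
      with i have xe: "x * e = x ^ d" by (metis Suc_lessI power_Suc)
      have sm: "(\<Sum>i\<in>I. (- p i) * x ^ i) \<in> mod_span B E" if "I \<subseteq> {..<d}" for I
      proof -
        have "finite I" using that finite_subset by blast
        then show ?thesis using that
        proof induction
          case (insert i F)
          have "- p i \<in> B" using insert.prems p(1) unital_subringD(5)[OF B(1)] by auto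
          moreover have "x ^ i \<in> mod_span B E" using insert.prems by (intro mod_span.base) (auto simp: E_def)
          ultimately have "(- p i) * x ^ i + (\<Sum>i\<in>F. (- p i) * x ^ i) \<in> mod_span B E"
            using insert by (intro mod_span.add mod_span.scale) auto
          then show ?case using insert by simp
        qed (use P_zero in \<open>auto intro: mod_span.zero\<close>)
      qed
      have "(\<Sum>i\<le>d. p i * x ^ i) + (\<Sum>i<d. (- p i) * x ^ i) = p d * x ^ d"
        by (simp add: lessThan_Suc_atMost[symmetric] sum_negf)
      then have "p d * x ^ d \<in> mod_span B E" using mod_span.add[OF mod_span.zero[OF p(3)] sm[of "{..<d}"]] by simp
      then show ?thesis unfolding xe using p(1,2) unital_subringD(7)[OF R assms(4)]
        by (intro saturationI[OF B, of _ "p d"]) auto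
    qed
  qed
  have x: "x * f \<in> saturation B E" if f: "f \<in> saturation B E" for f
  proof -
    from f obtain b where b: "b \<in> B" "b \<notin> P" "b * f \<in> mod_span B E" and fR: "f \<in> R"
      by (rule saturationE[OF B])
    have "x * g \<in> saturation B E" if "g \<in> mod_span B E" for g
      using that
    proof induction
      case (zero a)
      then have "x * a \<in> P" using P_mult assms(4) by blast
      then show ?case using P_sub by (intro saturation_spn[OF B] mod_span.zero) auto
    next
      case (scale b f)
      then have "b * (x * f) \<in> saturation B E" using saturation_scale[OF B] by blast
      then show ?case by (simp add: mult.left_commute)
    qed (simp_all add: distrib_left x_base saturation_add[OF B])
    from this[OF b(3)] have "b * (x * f) \<in> saturation B E" by (simp add: algebra_simps)
    then show ?thesis using saturation_cancel[OF B b(1,2) unital_subringD(4)[OF R assms(4) fR]] by blast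
  qed
  have "subring_gen (B \<union> {x}) \<subseteq> horner B x" by (rule subring_gen_insert_horner[OF B(1)])
  moreover have "f \<in> saturation B E" if "f \<in> horner B x" for f
    using that
  proof induction
    have c: "c \<in> saturation B E" if "c \<in> B" for c
      using that B(2) mod_span.scale[OF that mod_span.base[OF E1]] by (intro saturation_spn[OF B]) auto
    case (const c) then show ?case by (rule c)
    case (step c f) then show ?case by (intro saturation_add[OF B] c[of c] x)
  qed
  ultimately show ?thesis unfolding quasi_finite_def using E saturation_def by (intro exI[of _ E]) blast
qed

text \<open>The products of the two generating sets generate. A denominator \<open>c\<close> from
  \<open>C\<close> is not allowed over \<open>B\<close>, but \<open>c\<close> is algebraic over
  \<open>B\<close>, so some multiple of it is, modulo \<open>P\<close>, a nonzero element of
  \<open>B\<close>.\<close>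

lemma quasi_finite_trans:
  assumes B: "unital_subring B" "B \<subseteq> C" and C: "unital_subring C" "C \<subseteq> R" and "D \<subseteq> R"
    and BC: "quasi_finite B C" and CD: "quasi_finite C D"
  shows "quasi_finite B D"
proof -
  have BR: "B \<subseteq> R" using B C by blast
  obtain E1 where E1: "finite E1" "E1 \<subseteq> R" "\<forall>f\<in>C. \<exists>b\<in>B. b \<notin> P \<and> b * f \<in> mod_span B E1"
    using BC unfolding quasi_finite_def by blast
  obtain E2 where E2: "finite E2" "E2 \<subseteq> R" "\<forall>f\<in>D. \<exists>b\<in>C. b \<notin> P \<and> b * f \<in> mod_span C E2"
    using CD unfolding quasi_finite_def by blast
  define E where "E = (\<lambda>(a, b). a * b) ` (E1 \<times> E2)"
  have E: "finite E" "E \<subseteq> R" unfolding E_def using E1 E2 by (auto intro!: unital_subringD(4)[OF R])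
  have "\<exists>b\<in>B. b \<notin> P \<and> b * f \<in> mod_span B E" if f: "f \<in> D" for f
  proof -
    obtain c where c: "c \<in> C" "c \<notin> P" "c * f \<in> mod_span C E2" using E2 f by blast
    have fR: "f \<in> R" using assms f by blast
    have "alg B c"
      by (rule alg_if_quasi_finite[OF BC B(1) BR]) (use c C in \<open>auto intro: unital_subringD(7)\<close>)
    then obtain b c' where b: "b \<in> B" "b \<notin> P" "c' \<in> C" "c' * c - b \<in> P"
      using alg_constant_multiple[of B c C] B C c by blast
    have "c' * (c * f) + (- ((c' * c - b) * f)) \<in> mod_span C E2"
      by (rule mod_span.add[OF mod_span.scale[OF b(3) c(3)] mod_span.zero[OF P_neg[OF P_mult_right[OF b(4) fR]]]])
    then have "b * f \<in> mod_span C E2" by (simp add: algebra_simps)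
    then obtain r where r: "\<forall>e\<in>E2. r e \<in> C" "b * f - (\<Sum>e\<in>E2. r e * e) \<in> P"
      using mod_span_coeffs E2 C by blast
    have re: "r e * e \<in> saturation B E" if e: "e \<in> E2" for e
    proof -
      obtain a where a: "a \<in> B" "a \<notin> P" "a * r e \<in> mod_span B E1" using r e E1 by blast
      have "a * r e * e \<in> mod_span B E" using e E2
        by (intro mod_span_mult_right[OF a(3)]) (auto simp: E_def intro: mod_span.base)
      then show ?thesis using a e E2(2) r(1) C(2)
        by (intro saturationI[OF B(1) BR, of _ a] unital_subringD(4)[OF R]) (auto simp: mult.assoc)
    qed
    have "(b * f - (\<Sum>e\<in>E2. r e * e)) + (\<Sum>e\<in>E2. r e * e) \<in> saturation B E"
      using r(2) P_sub re
      by (intro saturation_add[OF B(1) BR saturation_spn[OF B(1) BR mod_span.zero] saturation_sum[OF B(1) BR E2(1)]]) auto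
    then have "b * f \<in> saturation B E" by simp
    then have "f \<in> saturation B E" using saturation_cancel[OF B(1) BR b(1,2) fR] by blast
    then show ?thesis unfolding saturation_def by blast
  qed
  then show ?thesis unfolding quasi_finite_def using E by blast
qed

lemma quasi_finite_gen:
  assumes B: "unital_subring B" "B \<subseteq> R" and "finite F" "F \<subseteq> R" "\<And>y. y \<in> F \<Longrightarrow> alg B y"
  shows "quasi_finite B (subring_gen (B \<union> F))"
  using assms(3-)
proof (induction F rule: finite_induct)
  case empty
  have "b * 1 \<in> mod_span B {1}" if "b \<in> B" for b using that by (intro mod_span.intros) auto
  then show ?case using B P_one unital_subringD[OF B(1)] unital_subringD[OF R]
    unfolding quasi_finite_def by (auto simp: subring_gen_self intro!: exI[of _ "{1}"] bexI[of _ 1])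
next
  case (insert y F)
  let ?C = "subring_gen (B \<union> F)"
  have CR: "?C \<subseteq> R" using B insert by (intro subring_gen_least[OF R]) auto
  have BC: "B \<subseteq> ?C" using subring_gen_superset[of "B \<union> F"] by blast
  have y: "y \<in> R" "alg ?C y" using insert alg_mono[OF _ BC] by auto
  have "quasi_finite ?C (subring_gen (?C \<union> {y}))"
    using quasi_finite_adjoin[OF _ CR y(2,1)] by simp
  then have "quasi_finite B (subring_gen (?C \<union> {y}))"
    using quasi_finite_trans[OF B(1) BC unital_subring_gen CR _ insert.IH] insert.prems
      subring_gen_least[OF R, of "?C \<union> {y}"] CR by auto
  moreover have "subring_gen (B \<union> insert y F) \<subseteq> subring_gen (?C \<union> {y})"
    by (rule subring_gen_least) (auto intro: subring_gen.base)
  ultimately show ?case unfolding quasi_finite_def by blast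
qed

text \<open>Only finitely many elements of \<open>S\<close> occur in the coefficients of an equation
  of \<open>x\<close>. They and \<open>x\<close> generate a quasi-finite extension of
  \<open>B\<close>, where counting powers makes \<open>x\<close> algebraic.\<close>

lemma alg_trans:
  assumes B: "unital_subring B" "B \<subseteq> R" and S: "S \<subseteq> R" "\<And>y. y \<in> S \<Longrightarrow> alg B y"
    and x: "x \<in> R" "alg (subring_gen (B \<union> S)) x"
  shows "alg B x"
proof -
  obtain d p where p: "\<forall>i\<le>d. p i \<in> subring_gen (B \<union> S)" "\<exists>i\<le>d. p i \<notin> P" "(\<Sum>i\<le>d. p i * x ^ i) \<in> P"
    using x unfolding alg_def by blast
  have "\<forall>i\<in>{..d}. \<exists>F\<subseteq>S. finite F \<and> p i \<in> subring_gen (B \<union> F)"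
    using p(1) subring_gen_finite_support by blast
  then obtain F where F: "\<And>i. i \<le> d \<Longrightarrow> F i \<subseteq> S \<and> finite (F i) \<and> p i \<in> subring_gen (B \<union> F i)"
    by (metis atMost_iff)
  define G where "G = (\<Union>i\<le>d. F i)"
  have G: "G \<subseteq> S" "finite G" using F by (auto simp: G_def)
  have pG: "p i \<in> subring_gen (B \<union> G)" if "i \<le> d" for i
    using F[OF that] subring_gen_mono[of "B \<union> F i" "B \<union> G"] that by (auto simp: G_def)
  let ?C = "subring_gen (B \<union> G)"
  have CR: "?C \<subseteq> R" using B S G by (intro subring_gen_least[OF R]) auto
  have BC: "B \<subseteq> ?C" using subring_gen_superset[of "B \<union> G"] by blast
  have "alg ?C x" unfolding alg_def using p pG by blast
  then have "quasi_finite ?C (subring_gen (?C \<union> {x}))"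
    using quasi_finite_adjoin[OF _ CR] x(1) by simp
  moreover have "quasi_finite B ?C" using quasi_finite_gen[OF B G(2)] G S by blast
  moreover have sub: "subring_gen (?C \<union> {x}) \<subseteq> R" using subring_gen_least[OF R] CR x by auto
  ultimately have "quasi_finite B (subring_gen (?C \<union> {x}))"
    using quasi_finite_trans[OF B(1) BC _ CR sub] by simp
  then show ?thesis
    by (rule alg_if_quasi_finite) (use B x in \<open>auto intro: unital_subringD subring_gen.base\<close>)
qed

lemma alg_in_gen:
  assumes B: "unital_subring B" "B \<subseteq> R" and S: "S \<subseteq> R" "\<And>y. y \<in> S \<Longrightarrow> alg B y"
    and x: "x \<in> subring_gen (B \<union> S)"
  shows "alg B x"
proof (rule alg_trans[OF B S])
  show "x \<in> R" using x subring_gen_least[OF R, of "B \<union> S"] B S by blast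
qed (use x alg_self in auto)

text \<open>Relative algebraic closure of the field generated by \<open>B\<close> and
  \<open>S\<close> modulo \<open>P\<close>. It is the closure operator of a matroid: the exchange
  property below provides transcendence bases and bounds their cardinality.\<close>

definition cl :: "'a set \<Rightarrow> 'a set \<Rightarrow> 'a set" where
  "cl B S = {x\<in>R. alg (subring_gen (B \<union> S)) x}"

lemma cl_subset: "cl B S \<subseteq> R"
  by (auto simp: cl_def)

lemma cl_superset: "S \<subseteq> R \<Longrightarrow> S \<subseteq> cl B S"
  unfolding cl_def by (auto intro!: alg_self subring_gen.base)

lemma cl_gen: "B \<subseteq> R \<Longrightarrow> S \<subseteq> R \<Longrightarrow> subring_gen (B \<union> S) \<subseteq> cl B S"
  unfolding cl_def using subring_gen_least[OF R, of "B \<union> S"] by (auto intro!: alg_self)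

lemma cl_mono: "S \<subseteq> S' \<Longrightarrow> cl B S \<subseteq> cl B S'"
  unfolding cl_def by (auto elim!: alg_mono intro!: subring_gen_mono)

lemma cl_idem:
  assumes "B \<subseteq> R" "S \<subseteq> R"
  shows "cl B (cl B S) \<subseteq> cl B S"
proof
  fix x assume "x \<in> cl B (cl B S)"
  then have x: "x \<in> R" "alg (subring_gen (B \<union> cl B S)) x" by (auto simp: cl_def)
  have "alg (subring_gen (B \<union> S)) x"
  proof (rule alg_trans[OF _ _ cl_subset _ x(1)])
    show "subring_gen (B \<union> S) \<subseteq> R" using assms subring_gen_least[OF R] by auto
    show "alg (subring_gen (subring_gen (B \<union> S) \<union> cl B S)) x"
      by (rule alg_mono[OF x(2)], rule subring_gen_mono) (auto intro: subring_gen.base)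
  qed (auto simp: cl_def)
  then show "x \<in> cl B S" using x by (auto simp: cl_def)
qed

text \<open>An equation of \<open>x\<close> whose coefficients are polynomials in \<open>y\<close>
  is regrouped by powers of \<open>y\<close> and becomes an equation of \<open>y\<close>. It is
  nontrivial, since otherwise each power of \<open>y\<close> would yield an equation of
  \<open>x\<close> without \<open>y\<close>, and these are all trivial.\<close>

lemma cl_exchange:
  assumes B: "B \<subseteq> R" and S: "S \<subseteq> R" and y: "y \<in> R"
    and x: "x \<in> cl B (insert y S)" "x \<notin> cl B S"
  shows "y \<in> cl B (insert x S)"
proof -
  let ?C = "subring_gen (B \<union> S)"
  obtain d p where p: "\<forall>i\<le>d. p i \<in> subring_gen (B \<union> insert y S)" "\<exists>i\<le>d. p i \<notin> P"
    "(\<Sum>i\<le>d. p i * x ^ i) \<in> P" and xR: "x \<in> R"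
    using x unfolding alg_def cl_def by blast
  have CR: "?C \<subseteq> R" using assms subring_gen_least[OF R] by auto
  have "subring_gen (B \<union> insert y S) \<subseteq> subring_gen (?C \<union> {y})"
    by (rule subring_gen_mono) (auto intro: subring_gen.base)
  then have "\<forall>i\<le>d. \<exists>e q. (\<forall>j. q j \<in> ?C) \<and> p i = (\<Sum>j\<le>e. q j * y ^ j)"
    using p(1) subring_gen_insert_sum[of ?C _ y] by auto
  then obtain e q where q: "\<And>i j. i \<le> d \<Longrightarrow> q i j \<in> ?C" "\<And>i. i \<le> d \<Longrightarrow> p i = (\<Sum>j\<le>e i. q i j * y ^ j)"
    by metis
  define M where "M = Max (e ` {..d})"
  have M: "i \<le> d \<Longrightarrow> e i \<le> M" for i unfolding M_def by auto
  \<comment> \<open>Padding by zero gives the coefficients, as polynomials in \<open>y\<close>, the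
    common degree bound \<open>M\<close>, so that the two sums can be interchanged.\<close>
  define q' where "q' i j = (if j \<le> e i then q i j else 0)" for i j
  have q': "i \<le> d \<Longrightarrow> q' i j \<in> ?C" "i \<le> d \<Longrightarrow> p i = (\<Sum>j\<le>M. q' i j * y ^ j)" for i j
  proof -
    show "i \<le> d \<Longrightarrow> q' i j \<in> ?C" using q by (auto simp: q'_def intro: unital_subringD)
    show "p i = (\<Sum>j\<le>M. q' i j * y ^ j)" if i: "i \<le> d"
      unfolding q(2)[OF i] q'_def using M[OF i]
      by (intro sum.mono_neutral_cong_left) auto
  qed
  define w where "w j = (\<Sum>i\<le>d. q' i j * x ^ i)" for j
  have "(\<Sum>i\<le>d. p i * x ^ i) = (\<Sum>i\<le>d. \<Sum>j\<le>M. q' i j * x ^ i * y ^ j)"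
    by (rule sum.cong) (auto simp: q' sum_distrib_left sum_distrib_right mult_ac)
  also have "\<dots> = (\<Sum>j\<le>M. w j * y ^ j)"
    by (subst sum.swap) (simp add: w_def sum_distrib_right)
  finally have wP: "(\<Sum>j\<le>M. w j * y ^ j) \<in> P" using p by simp
  have sub: "?C \<subseteq> subring_gen (B \<union> insert x S)" by (rule subring_gen_mono) auto
  have wC: "w j \<in> subring_gen (B \<union> insert x S)" for j
    unfolding w_def
  proof (intro unital_subring_sum unital_subring_gen unital_subringD(4,7)[OF unital_subring_gen])
    show "x \<in> subring_gen (B \<union> insert x S)" by (rule subring_gen.base) auto
  qed (use q'(1) sub in auto)
  have "\<exists>j\<le>M. w j \<notin> P"
  proof (rule ccontr)
    assume "\<not> (\<exists>j\<le>M. w j \<notin> P)"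
    then have wj: "(\<Sum>i\<le>d. q' i j * x ^ i) \<in> P" if "j \<le> M" for j
      using that unfolding w_def by blast
    have "\<not> alg ?C x" using x(2) xR unfolding cl_def by blast
    then have nalg: "\<And>d p. \<forall>i\<le>d. p i \<in> ?C \<Longrightarrow> (\<Sum>i\<le>d. p i * x ^ i) \<in> P \<Longrightarrow> \<forall>i\<le>d. p i \<in> P"
      unfolding alg_def by blast
    have "q' i j \<in> P" if "i \<le> d" "j \<le> M" for i j
      using nalg[of d "\<lambda>i. q' i j"] q'(1) wj[OF that(2)] that(1) by blast
    then have "p i \<in> P" if "i \<le> d" for i
      unfolding q'(2)[OF that] using that y by (intro P_sum P_mult_right unital_subringD[OF R]) auto
    then show False using p(2) by blast
  qed
  then show ?thesis unfolding cl_def alg_def using y wC wP by blast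
qed

end

section \<open>Independence, and cores of prime ideals\<close>

context prime_mod
begin

definition indep :: "'a set \<Rightarrow> 'a set \<Rightarrow> bool" where
  "indep B S \<longleftrightarrow> S \<subseteq> R \<and> (\<forall>x\<in>S. x \<notin> cl B (S - {x}))"

lemma indep_subset: "indep B S \<Longrightarrow> S' \<subseteq> S \<Longrightarrow> indep B S'"
  unfolding indep_def using cl_mono[of "S' - {_}" "S - {_}" B] by blast

text \<open>If some \<open>y\<close> in \<open>S\<close> became dependent after adding
  \<open>x\<close>, exchanging the two would make \<open>x\<close> dependent on
  \<open>S\<close>.\<close>

lemma indep_insert:
  assumes B: "B \<subseteq> R" and S: "indep B S" and x: "x \<in> R" "x \<notin> cl B S"
  shows "indep B (insert x S)"
  unfolding indep_def
proof (intro conjI ballI)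
  have SR: "S \<subseteq> R" using S by (auto simp: indep_def)
  then show "insert x S \<subseteq> R" using x by auto
  have xS: "x \<notin> S" using x cl_superset[OF SR] by blast
  fix y assume y: "y \<in> insert x S"
  show "y \<notin> cl B (insert x S - {y})"
  proof
    assume yc: "y \<in> cl B (insert x S - {y})"
    show False
    proof (cases "y = x")
      case True
      then show False using yc xS x by simp
    next
      case False
      then have yS: "y \<in> S" using y by auto
      have "insert x S - {y} = insert x (S - {y})" using False by auto
      then have "x \<in> cl B (insert y (S - {y}))"
        using cl_exchange[OF B _ x(1), of "S - {y}" y] yc S SR yS by (auto simp: indep_def)
      then show False using x yS by (simp add: insert_absorb)
    qed
  qed
qed

lemma basis_extension:
  assumes B: "B \<subseteq> R" and V: "finite V" "V \<subseteq> R" and I0: "indep B I0" "I0 \<subseteq> V"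
  shows "\<exists>I. I0 \<subseteq> I \<and> I \<subseteq> V \<and> indep B I \<and> V \<subseteq> cl B I"
proof -
  let ?F = "{I. I0 \<subseteq> I \<and> I \<subseteq> V \<and> indep B I}"
  have fin: "finite ?F" using V(1) by (rule rev_finite_subset[OF finite_Pow_iff[THEN iffD2]]) auto
  obtain I where I: "I \<in> ?F" "\<forall>J\<in>?F. I \<subseteq> J \<longrightarrow> I = J"
    using finite_has_maximal[OF fin] I0 by blast
  have "V \<subseteq> cl B I"
  proof
    fix x assume x: "x \<in> V"
    show "x \<in> cl B I"
    proof (rule ccontr)
      assume nx: "x \<notin> cl B I"
      then have "insert x I \<in> ?F" using indep_insert[OF B _ _ nx] I x V by auto
      then have "x \<in> I" using I by blast
      then show False using nx cl_superset[of I B] I V by auto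
    qed
  qed
  then show ?thesis using I by blast
qed

text \<open>Elements of \<open>U\<close> outside \<open>Z\<close> are replaced one at a time by
  elements of \<open>Z\<close>, preserving independence and cardinality, until \<open>U\<close> lies
  inside \<open>Z\<close>.\<close>

lemma steinitz:
  assumes B: "B \<subseteq> R" and "finite U" "finite Z" "indep B U" "Z \<subseteq> R" "U \<subseteq> cl B Z"
  shows "card U \<le> card Z"
  using assms(2,4,6)
proof (induction "card (U - Z)" arbitrary: U)
  case 0
  then have "U \<subseteq> Z" by auto
  then show ?case using assms by (simp add: card_mono)
next
  case (Suc n)
  then obtain u where u: "u \<in> U" "u \<notin> Z" by (metis Diff_iff all_not_in_conv card.empty nat.distinct(1))
  let ?V = "U - {u}"
  have UR: "U \<subseteq> R" using Suc.prems by (auto simp: indep_def)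
  have nu: "u \<notin> cl B ?V" using Suc.prems u by (auto simp: indep_def)
  \<comment> \<open>Otherwise \<open>u\<close>, which depends on \<open>Z\<close>, would depend on
    the rest of \<open>U\<close>.\<close>
  have "\<not> Z \<subseteq> cl B ?V"
  proof
    assume "Z \<subseteq> cl B ?V"
    then have "cl B Z \<subseteq> cl B (cl B ?V)" by (rule cl_mono)
    also have "\<dots> \<subseteq> cl B ?V" using UR by (intro cl_idem B) auto
    finally show False using nu u Suc.prems by blast
  qed
  then obtain z where z: "z \<in> Z" "z \<notin> cl B ?V" by blast
  have zV: "z \<notin> ?V" using z(2) cl_superset[of ?V B] UR by auto
  let ?W = "insert z ?V"
  have "indep B ?W" using z assms(5) indep_subset[OF Suc.prems(2), of ?V]
    by (intro indep_insert[OF B]) auto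
  moreover have "?W \<subseteq> cl B Z" using Suc.prems z cl_superset[OF assms(5), of B] by auto
  moreover have "?W - Z = (U - Z) - {u}" using z by auto
  then have "n = card (?W - Z)" using Suc.hyps(2) u Suc.prems by simp
  moreover have "finite ?W" using Suc.prems by auto
  ultimately have "card ?W \<le> card Z" using Suc.hyps(1)[of ?W] by blast
  moreover have "card ?W = card U" using zV u Suc.prems(1) by (simp add: card.remove[symmetric] card_gt_0_iff)
      (metis Suc_pred card_gt_0_iff empty_iff)
  ultimately show ?case by simp
qed

end

section \<open>Derivations and the largest stable part of a prime\<close>

definition derivation :: "('a::comm_ring_1 \<Rightarrow> 'a) \<Rightarrow> bool" where
  "derivation D \<longleftrightarrow> (\<forall>a b. D (a + b) = D a + D b) \<and> (\<forall>a b. D (a * b) = a * D b + D a * b)"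

lemma derivationD:
  assumes "derivation D"
  shows "D (a + b) = D a + D b" "D (a * b) = a * D b + D a * b" "D 0 = 0" "D 1 = 0"
    "D (- a) = - D a" "D (a - b) = D a - D b" "D (sum f I) = (\<Sum>i\<in>I. D (f i))"
proof -
  show add: "D (a + b) = D a + D b" and m: "D (a * b) = a * D b + D a * b" for a b
    using assms by (auto simp: derivation_def)
  show z: "D 0 = 0" using add[of 0 0] by simp
  show "D 1 = 0" using m[of 1 1] by simp
  show n: "D (- a) = - D a" for a using add[of a "-a"] z by (simp add: eq_neg_iff_add_eq_0 add.commute)
  show "D (a - b) = D a - D b" using add[of a "-b"] n by simp
  show "D (sum f I) = (\<Sum>i\<in>I. D (f i))"
    by (induction I rule: infinite_finite_induct) (auto simp: add z)
qed

lemma derivation_foldr: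
  assumes "\<And>i. i \<in> set u \<Longrightarrow> derivation (D i)"
  shows "foldr D u (a + b) = foldr D u a + foldr D u b" "foldr D u 0 = 0"
    "foldr D u (a - b) = foldr D u a - foldr D u b" "foldr D u (sum f I) = (\<Sum>i\<in>I. foldr D u (f i))"
  using assms by (induction u) (auto simp: derivationD)

lemma leibniz:
  assumes D: "derivation D"
  shows "(D ^^ n) (a * b) = (\<Sum>i\<le>n. of_nat (n choose i) * ((D ^^ i) a * (D ^^ (n - i)) b))"
proof (induction n)
  case (Suc n)
  let ?t = "\<lambda>i j. (D ^^ i) a * (D ^^ j) b"
  have nat: "D (of_nat m) = 0" for m by (induction m) (simp_all add: derivationD[OF D])
  have D': "(D ^^ Suc n) (a * b) = (\<Sum>i\<le>n. of_nat (n choose i) * (?t (Suc i) (n - i) + ?t i (Suc (n - i))))"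
    by (simp add: Suc.IH derivationD[OF D] nat algebra_simps)
  also have "\<dots> = (\<Sum>i\<le>n. of_nat (n choose i) * ?t (Suc i) (n - i)) +
      (\<Sum>i\<le>n. of_nat (n choose i) * ?t i (Suc n - i))"
    by (simp add: sum.distrib[symmetric] Suc_diff_le algebra_simps)
  \<comment> \<open>The added term \<open>i = Suc n\<close> is zero because
    \<open>n choose Suc n = 0\<close>; it allows the index shift that leads to Pascal's
    rule.\<close>
  also have "(\<Sum>i\<le>n. of_nat (n choose i) * ?t i (Suc n - i)) =
      (\<Sum>i\<le>Suc n. of_nat (n choose i) * ?t i (Suc n - i))"
    by (simp add: binomial_eq_0)
  also have "\<dots> = ?t 0 (Suc n) + (\<Sum>i\<le>n. of_nat (n choose Suc i) * ?t (Suc i) (n - i))"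
    by (subst sum.atMost_Suc_shift) simp
  finally have "(D ^^ Suc n) (a * b) = ?t 0 (Suc n) +
      (\<Sum>i\<le>n. of_nat (Suc n choose Suc i) * ?t (Suc i) (n - i))"
    by (simp add: sum.distrib algebra_simps)
  also have "\<dots> = (\<Sum>i\<le>Suc n. of_nat (Suc n choose i) * ?t i (Suc n - i))"
    by (subst sum.atMost_Suc_shift) simp
  finally show ?case .
qed simp

text \<open>The derivations need not commute, so all words \<open>u\<close> in them are
  tested.\<close>

definition core :: "'i set \<Rightarrow> ('i \<Rightarrow> 'a \<Rightarrow> 'a) \<Rightarrow> 'a set \<Rightarrow> 'a set \<Rightarrow> 'a set" where
  "core I D R P = {f\<in>R. \<forall>u\<in>lists I. foldr D u f \<in> P}"

lemma core_subset: "core I D R P \<subseteq> P"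
  unfolding core_def by (auto dest: bspec[of _ _ "[]"])

lemma core_stable:
  assumes "\<And>i f. i \<in> I \<Longrightarrow> f \<in> R \<Longrightarrow> D i f \<in> R" "f \<in> core I D R P" "i \<in> I"
  shows "D i f \<in> core I D R P"
proof -
  have "foldr D u (D i f) \<in> P" if "u \<in> lists I" for u
  proof -
    have "u @ [i] \<in> lists I" using that assms by auto
    then have "foldr D (u @ [i]) f \<in> P" using assms(2) unfolding core_def by blast
    then show ?thesis by simp
  qed
  then show ?thesis using assms unfolding core_def by auto
qed

lemma core_greatest:
  assumes "J \<subseteq> P" "J \<subseteq> R" "\<And>i f. i \<in> I \<Longrightarrow> f \<in> J \<Longrightarrow> D i f \<in> J"
  shows "J \<subseteq> core I D R P"
proof
  fix f assume f: "f \<in> J"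
  have "foldr D u f \<in> J" if "u \<in> lists I" for u
    using that by (induction u) (use f assms(3) in auto)
  then show "f \<in> core I D R P" using f assms unfolding core_def by auto
qed

text \<open>Let \<open>p\<close> and \<open>q\<close> be the first orders at which the derivatives
  of \<open>a\<close> and \<open>b\<close> leave \<open>P\<close>. In the Leibniz formula of order
  \<open>p + q\<close> for \<open>a * b\<close>, only the term \<open>i = p\<close> survives modulo
  \<open>P\<close>, and \<open>char\<close> keeps its binomial coefficient outside
  \<open>P\<close>.\<close>

lemma core_single_prime:
  assumes "prime_mod R P" and D: "derivation D" "\<And>f. f \<in> R \<Longrightarrow> D f \<in> R"
    and char: "\<And>n. n > 0 \<Longrightarrow> of_nat n \<notin> P"
  shows "prime_mod R {f\<in>R. \<forall>n. (D ^^ n) f \<in> P}"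
proof -
  interpret prime_mod R P by fact
  have DR: "f \<in> R \<Longrightarrow> (D ^^ n) f \<in> R" for n f by (induction n) (auto intro: D)
  have nat: "of_nat n \<in> R" for n
    by (induction n) (auto intro: unital_subringD[OF R])
  have Dadd: "(D ^^ n) (a + b) = (D ^^ n) a + (D ^^ n) b" for n a b
    by (induction n) (auto simp: derivationD[OF D(1)])
  have D0: "(D ^^ n) 0 = 0" for n by (induction n) (auto simp: derivationD[OF D(1)])
  show ?thesis
  proof
    fix a b assume a: "a \<in> R" and b: "b \<in> {f \<in> R. \<forall>n. (D ^^ n) f \<in> P}"
    have "(D ^^ n) (a * b) \<in> P" for n
      unfolding leibniz[OF D(1)] using b by (intro P_sum P_mult[OF nat] P_mult[OF DR[OF a]]) blast
    then show "a * b \<in> {f \<in> R. \<forall>n. (D ^^ n) f \<in> P}" using a b unital_subringD(4)[OF R] by auto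
  next
    fix a b assume a: "a \<in> R" and b: "b \<in> R" and ab: "a * b \<in> {f \<in> R. \<forall>n. (D ^^ n) f \<in> P}"
    show "a \<in> {f \<in> R. \<forall>n. (D ^^ n) f \<in> P} \<or> b \<in> {f \<in> R. \<forall>n. (D ^^ n) f \<in> P}"
    proof (rule ccontr)
      assume n: "\<not> ?thesis"
      define p where "p = (LEAST n. (D ^^ n) a \<notin> P)"
      define q where "q = (LEAST n. (D ^^ n) b \<notin> P)"
      have pa: "(D ^^ p) a \<notin> P" unfolding p_def by (rule LeastI_ex) (use n a in blast)
      have qb: "(D ^^ q) b \<notin> P" unfolding q_def by (rule LeastI_ex) (use n b in blast)
      have lp: "(D ^^ i) a \<in> P" if "i < p" for i using not_less_Least[of i] that unfolding p_def by blast
      have lq: "(D ^^ i) b \<in> P" if "i < q" for i using not_less_Least[of i] that unfolding q_def by blast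
      define t where "t i = of_nat (p + q choose i) * ((D ^^ i) a * (D ^^ (p + q - i)) b)" for i
      have small: "t i \<in> P" if "i \<in> {..p+q} - {p}" for i
      proof (cases "i < p")
        case True
        then have "(D ^^ i) a * (D ^^ (p + q - i)) b \<in> P" using P_mult_right[OF lp DR[OF b]] by blast
        then show ?thesis unfolding t_def using P_mult nat by blast
      next
        case False
        then have "p + q - i < q" using that by auto
        then have "(D ^^ i) a * (D ^^ (p + q - i)) b \<in> P" using P_mult[OF DR[OF a] lq] by blast
        then show ?thesis unfolding t_def using P_mult nat by blast
      qed
      have "sum t {..p+q} = t p + sum t ({..p+q} - {p})"
        by (rule sum.remove) auto
      moreover have "sum t {..p+q} = (D ^^ (p + q)) (a * b)"
        unfolding leibniz[OF D(1)] t_def ..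
      moreover have "(D ^^ (p + q)) (a * b) \<in> P" using ab by blast
      moreover have "sum t ({..p+q} - {p}) \<in> P" by (rule P_sum) (rule small)
      ultimately have "t p \<in> P" using P_diff[of "sum t {..p+q}" "sum t ({..p+q} - {p})"] by simp
      then have "of_nat (p + q choose p) * ((D ^^ p) a * (D ^^ q) b) \<in> P" by (simp add: t_def)
      moreover have "(of_nat (p + q choose p) :: 'a) \<notin> P" by (rule char) simp
      ultimately have "(D ^^ p) a * (D ^^ q) b \<in> P"
        using P_prime[OF nat unital_subringD(4)[OF R DR[OF a] DR[OF b]]] by blast
      then show False using pa qb P_prime[OF DR[OF a] DR[OF b]] by blast
    qed
  next
    show "1 \<notin> {f \<in> R. \<forall>n. (D ^^ n) f \<in> P}"
    proof
      assume "1 \<in> {f \<in> R. \<forall>n. (D ^^ n) f \<in> P}"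
      then have "(D ^^ 0) 1 \<in> P" by blast
      then show False using P_one by simp
    qed
    show "0 \<in> {f \<in> R. \<forall>n. (D ^^ n) f \<in> P}" using P_zero by (simp add: D0 unital_subringD(2)[OF R])
    fix a b assume "a \<in> {f \<in> R. \<forall>n. (D ^^ n) f \<in> P}" "b \<in> {f \<in> R. \<forall>n. (D ^^ n) f \<in> P}"
    then show "a + b \<in> {f \<in> R. \<forall>n. (D ^^ n) f \<in> P}"
      by (auto simp: Dadd intro: unital_subringD(6)[OF R] P_add)
  qed (use R in auto)
qed

text \<open>The core for one derivation need not be stable under the others. Cycling through the
  derivations forever gives a decreasing chain of primes, whose intersection is prime, stable and
  equal to the core.\<close>

lemma core_prime:
  fixes D :: "nat \<Rightarrow> 'a::comm_ring_1 \<Rightarrow> 'a"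
  assumes P: "prime_mod R P" and D: "\<And>i. i < n \<Longrightarrow> derivation (D i)"
    and DR: "\<And>i f. i < n \<Longrightarrow> f \<in> R \<Longrightarrow> D i f \<in> R"
    and char: "\<And>n. n > 0 \<Longrightarrow> of_nat n \<notin> P"
  shows "prime_mod R (core {..<n} D R P)"
proof (cases "n = 0")
  case True
  then have "core {..<n} D R P = P" using prime_mod.P_sub[OF P] by (auto simp: core_def)
  then show ?thesis using P by simp
next
  case False
  define Q where "Q = rec_nat P (\<lambda>k Q. {f\<in>R. \<forall>m. (D (k mod n) ^^ m) f \<in> Q})"
  have Q0: "Q 0 = P" and QS: "\<And>k. Q (Suc k) = {f\<in>R. \<forall>m. (D (k mod n) ^^ m) f \<in> Q k}"
    by (simp_all add: Q_def)
  have step: "Q (Suc k) \<subseteq> Q k" for k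
  proof
    fix f assume "f \<in> Q (Suc k)"
    then have "(D (k mod n) ^^ 0) f \<in> Q k" unfolding QS by blast
    then show "f \<in> Q k" by simp
  qed
  have dec: "Q (k + l) \<subseteq> Q k" for k l by (induction l) (use step in auto)
  have QP: "Q k \<subseteq> P" for k using dec[of 0 k] Q0 by simp
  have prime: "prime_mod R (Q k)" for k
  proof (induction k)
    case (Suc k)
    show ?case unfolding QS
    proof (rule core_single_prime[OF Suc])
      show "of_nat m \<notin> Q k" if "m > 0" for m using char[OF that] QP by blast
    qed (use False D DR in auto)
  qed (simp add: Q0 P)
  have stable: "D i f \<in> (\<Inter>k. Q k)" if "f \<in> (\<Inter>k. Q k)" "i < n" for i f
  proof
    fix k
    \<comment> \<open>The step from stage \<open>k * n + i\<close> uses the derivation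
      \<open>D i\<close>, and this stage comes no earlier than stage \<open>k\<close> because
      \<open>n > 0\<close>.\<close>
    have "f \<in> Q (Suc (k * n + i))" using that by auto
    then have "\<forall>m. (D i ^^ m) f \<in> Q (k * n + i)" using that unfolding QS by auto
    then have "(D i ^^ 1) f \<in> Q (k * n + i)" by blast
    then have "D i f \<in> Q (k * n + i)" by simp
    moreover have "k \<le> k * n" using False by simp
    then have "k * n + i = k + (k * n - k + i)" by linarith
    ultimately have "D i f \<in> Q (k + (k * n - k + i))" by metis
    then show "D i f \<in> Q k" using dec by blast
  qed
  have "core {..<n} D R P = (\<Inter>k. Q k)"
  proof
    have "core {..<n} D R P \<subseteq> Q k" for k
    proof (induction k)
      case 0
      show ?case using core_subset[of "{..<n}" D R P] Q0 by simp
    next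
      case (Suc k)
      let ?C = "core {..<n} D R P" and ?d = "D (k mod n)"
      have d: "?d f \<in> ?C" if "f \<in> ?C" for f
        by (rule core_stable[OF _ that]) (use DR False in simp_all)
      show ?case
      proof
        fix f assume f: "f \<in> ?C"
        have "(?d ^^ m) f \<in> ?C" for m by (induction m) (simp_all add: f d)
        then have "\<forall>m. (?d ^^ m) f \<in> Q k" using Suc by (intro allI subsetD[OF Suc])
        moreover have "f \<in> R" using f by (simp add: core_def)
        ultimately show "f \<in> Q (Suc k)" unfolding QS by simp
      qed
    qed
    then show "core {..<n} D R P \<subseteq> (\<Inter>k. Q k)" by blast
    show "(\<Inter>k. Q k) \<subseteq> core {..<n} D R P"
    proof (rule core_greatest)
      show "(\<Inter>k. Q k) \<subseteq> P" using INF_lower[of 0 UNIV Q] Q0 by simp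
      then show "(\<Inter>k. Q k) \<subseteq> R" using prime_mod.P_sub[OF P] by (rule order_trans)
      show "D i f \<in> (\<Inter>k. Q k)" if "i \<in> {..<n}" "f \<in> (\<Inter>k. Q k)" for i f
        using stable[OF that(2)] that(1) by blast
    qed
  qed
  moreover have "prime_mod R (\<Inter>k. Q k)"
  proof
    fix a b assume ab: "a \<in> R" "b \<in> R" "a * b \<in> (\<Inter>k. Q k)"
    show "a \<in> (\<Inter>k. Q k) \<or> b \<in> (\<Inter>k. Q k)"
    proof (rule ccontr)
      assume "\<not> ?thesis"
      then obtain i j where "a \<notin> Q i" "b \<notin> Q j" by blast
      then have "a \<notin> Q (i + j)" "b \<notin> Q (i + j)" using dec[of i j] dec[of j i] by (auto simp: add.commute)
      then show False using prime_mod.P_prime[OF prime ab(1,2)] ab(3) by blast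
    qed
  next
    show "unital_subring R" by (rule prime_mod.R[OF P])
    show "(\<Inter>k. Q k) \<subseteq> R" using prime_mod.P_sub[OF prime[of 0]] by blast
    show "1 \<notin> (\<Inter>k. Q k)" using prime_mod.P_one[OF prime[of 0]] by blast
    show "0 \<in> (\<Inter>k. Q k)" using prime_mod.P_zero[OF prime] by blast
    show "a + b \<in> (\<Inter>k. Q k)" if "a \<in> (\<Inter>k. Q k)" "b \<in> (\<Inter>k. Q k)" for a b
      using that prime_mod.P_add[OF prime, of a _ b] by blast
    show "a * b \<in> (\<Inter>k. Q k)" if "a \<in> R" "b \<in> (\<Inter>k. Q k)" for a b
      using that prime_mod.P_mult[OF prime, of a b] by blast
  qed
  ultimately show ?thesis by simp
qed

section \<open>Polynomials\<close>

lemma poly_mapping_single_induct: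
  assumes "P 0" "\<And>m c. P (Poly_Mapping.single m c)" "\<And>a b. P a \<Longrightarrow> P b \<Longrightarrow> P (a + b)"
  shows "P (p :: 'm \<Rightarrow>\<^sub>0 'c::comm_monoid_add)"
proof (induction p rule: update_induct)
  case (update f a b)
  have "Poly_Mapping.update a b f = f + Poly_Mapping.single a b"
    using update(1) by (intro poly_mapping_eqI)
      (auto simp: lookup_update lookup_add lookup_single not_in_keys_iff_lookup_eq_zero when_def)
  then show ?case using assms(2,3) update by metis
qed (rule assms)

text \<open>Terms may cancel in \<open>p + q\<close>, so all three sums are taken over the union of
  the supports, where the extra terms vanish by \<open>F m 0 = 0\<close>.\<close>

lemma sum_keys_add:
  fixes p q :: "'m \<Rightarrow>\<^sub>0 'c::comm_monoid_add" and F :: "'m \<Rightarrow> 'c \<Rightarrow> 'd::comm_monoid_add"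
  assumes "\<And>m. F m 0 = 0" "\<And>m c d. F m (c + d) = F m c + F m d"
  shows "(\<Sum>m\<in>Poly_Mapping.keys (p + q). F m (Poly_Mapping.lookup (p + q) m)) =
    (\<Sum>m\<in>Poly_Mapping.keys p. F m (Poly_Mapping.lookup p m)) +
    (\<Sum>m\<in>Poly_Mapping.keys q. F m (Poly_Mapping.lookup q m))"
proof -
  let ?S = "Poly_Mapping.keys p \<union> Poly_Mapping.keys q"
  have ext: "(\<Sum>m\<in>Poly_Mapping.keys r. F m (Poly_Mapping.lookup r m)) =
      (\<Sum>m\<in>?S. F m (Poly_Mapping.lookup r m))" if "Poly_Mapping.keys r \<subseteq> ?S" for r
    using that assms(1) by (intro sum.mono_neutral_left) (auto simp: in_keys_iff)
  show ?thesis
    using ext[of "p + q"] ext[of p] ext[of q] Poly_Mapping.keys_add[of p q]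
    by (simp add: lookup_add assms(2) sum.distrib)
qed

section \<open>Substitution homomorphisms\<close>

definition monomial_eval :: "(nat \<Rightarrow> 'a::comm_ring_1) \<Rightarrow> (nat \<Rightarrow>\<^sub>0 nat) \<Rightarrow> 'a" where
  "monomial_eval v m = (\<Prod>i\<in>Poly_Mapping.keys m. v i ^ Poly_Mapping.lookup m i)"

lemma monomial_eval_add: "monomial_eval v (m + m') = monomial_eval v m * monomial_eval v m'"
proof -
  let ?S = "Poly_Mapping.keys m \<union> Poly_Mapping.keys m'"
  have ext: "monomial_eval v r = (\<Prod>i\<in>?S. v i ^ Poly_Mapping.lookup r i)"
    if "Poly_Mapping.keys r \<subseteq> ?S" for r
    unfolding monomial_eval_def
    using that by (intro prod.mono_neutral_left) (auto simp: in_keys_iff)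
  show ?thesis
    using ext[of "m + m'"] ext[of m] ext[of m'] Poly_Mapping.keys_add[of m m']
    by (simp add: lookup_add power_add prod.distrib)
qed

definition mpoly_subst :: "(nat \<Rightarrow> 'k mpoly) \<Rightarrow> 'k::comm_ring_1 mpoly \<Rightarrow> 'k mpoly" where
  "mpoly_subst v p = (\<Sum>m\<in>Poly_Mapping.keys p. mpoly_const (Poly_Mapping.lookup p m) * monomial_eval v m)"

lemma mpoly_const_simps [simp]:
  "mpoly_const 0 = 0" "mpoly_const 1 = 1"
  by (simp_all add: mpoly_const_def)

lemma mpoly_const_hom:
  "mpoly_const (c + d) = mpoly_const c + mpoly_const d"
  "mpoly_const (c * d) = mpoly_const c * mpoly_const (d::'k::comm_ring_1)"
  "mpoly_const (- a) = - mpoly_const (a :: 'k)"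
  "mpoly_const (a - b) = mpoly_const a - mpoly_const (b :: 'k)"
  by (simp_all add: mpoly_const_def single_add mult_single single_uminus single_diff)

lemma mpoly_const_of_nat: "mpoly_const (of_nat n) = (of_nat n :: 'k::comm_ring_1 mpoly)"
  by (induction n) (simp_all add: mpoly_const_hom)

lemma mpoly_const_eq_iff [simp]: "mpoly_const c = mpoly_const d \<longleftrightarrow> c = d"
  unfolding mpoly_const_def by (metis lookup_single_eq)

lemma mpoly_const_sum: "mpoly_const (sum f I) = (\<Sum>i\<in>I. mpoly_const (f i :: 'k::comm_ring_1))"
  by (induction I rule: infinite_finite_induct) (simp_all add: mpoly_const_hom)

lemma mpoly_subst_add: "mpoly_subst v (p + q) = mpoly_subst v p + mpoly_subst v q"
  unfolding mpoly_subst_def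
  by (rule sum_keys_add[of "\<lambda>m c. mpoly_const c * monomial_eval v m"])
    (simp_all add: mpoly_const_hom algebra_simps)

lemma mpoly_subst_single: "mpoly_subst v (Poly_Mapping.single m c) = mpoly_const c * monomial_eval v m"
  by (simp add: mpoly_subst_def)

lemma mpoly_subst_zero [simp]: "mpoly_subst v 0 = 0"
  by (simp add: mpoly_subst_def)

lemma mpoly_subst_mult: "mpoly_subst v (p * q) = mpoly_subst v p * mpoly_subst v q"
proof (induction p rule: poly_mapping_single_induct)
  case (2 m c)
  show ?case
    by (induction q rule: poly_mapping_single_induct)
      (simp_all add: mult_single mpoly_subst_single mpoly_const_hom monomial_eval_add mpoly_subst_add distrib_left)
qed (simp_all add: mpoly_subst_add distrib_right)

lemma mpoly_subst_const [simp]: "mpoly_subst v (mpoly_const c) = mpoly_const c"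
  using mpoly_subst_single[of v 0 c] by (simp add: mpoly_const_def monomial_eval_def)

lemma mpoly_subst_one [simp]: "mpoly_subst v 1 = 1"
  using mpoly_subst_const[of v 1] by simp

lemma mpoly_subst_var [simp]: "mpoly_subst v (mpoly_var i) = v i"
  by (simp add: mpoly_var_def mpoly_subst_single monomial_eval_def)

lemma mpoly_subst_minus: "mpoly_subst v (- p) = - mpoly_subst v p"
  using mpoly_subst_add[of v p "-p"] by (simp add: eq_neg_iff_add_eq_0 add.commute)

lemma mpoly_subst_diff: "mpoly_subst v (p - q) = mpoly_subst v p - mpoly_subst v q"
  using mpoly_subst_add[of v p "-q"] by (simp add: mpoly_subst_minus)

lemma mpoly_subst_sum: "mpoly_subst v (sum f I) = (\<Sum>i\<in>I. mpoly_subst v (f i))"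
  by (induction I rule: infinite_finite_induct) (simp_all add: mpoly_subst_add)

lemma mpoly_subst_power: "mpoly_subst v (p ^ n) = mpoly_subst v p ^ n"
  by (induction n) (simp_all add: mpoly_subst_mult)

section \<open>Partial derivatives\<close>

lemma mpoly_deriv_add: "mpoly_deriv i (p + q) = mpoly_deriv i p + mpoly_deriv i q"
  unfolding mpoly_deriv_def
  by (rule sum_keys_add[of "\<lambda>m c. Poly_Mapping.single (m - Poly_Mapping.single i 1)
       (of_nat (Poly_Mapping.lookup m i) * c)"]) (simp_all add: single_add algebra_simps)

lemma mpoly_deriv_single: "mpoly_deriv i (Poly_Mapping.single m c) =
    Poly_Mapping.single (m - Poly_Mapping.single i 1) (of_nat (Poly_Mapping.lookup m i) * c)"
  by (simp add: mpoly_deriv_def)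

lemma monomial_shift:
  assumes "Poly_Mapping.lookup m i > 0"
  shows "m' + (m - Poly_Mapping.single i 1) = m' + m - Poly_Mapping.single i (1::nat)"
  by (rule poly_mapping_eqI) (use assms in \<open>auto simp: lookup_add lookup_minus lookup_single when_def\<close>)

lemma mpoly_deriv_single_mult:
  "mpoly_deriv i (Poly_Mapping.single m c * Poly_Mapping.single m' d) =
    Poly_Mapping.single m c * mpoly_deriv i (Poly_Mapping.single m' d) +
    mpoly_deriv i (Poly_Mapping.single m c) * Poly_Mapping.single m' d"
proof -
  \<comment> \<open>When \<open>i\<close> does not occur in \<open>m'\<close>, both sides vanish
    through their coefficient, so the truncated exponents do no harm.\<close>
  have 1: "Poly_Mapping.single m c * mpoly_deriv i (Poly_Mapping.single m' d) =
      Poly_Mapping.single (m + m' - Poly_Mapping.single i 1) (of_nat (Poly_Mapping.lookup m' i) * (c * d))"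
    for m m' c d
    using monomial_shift[of m' i m]
    by (cases "Poly_Mapping.lookup m' i = 0") (auto simp: mpoly_deriv_single mult_single mult_ac)
  show ?thesis
    unfolding 1 mult.commute[of "mpoly_deriv i _"]
    by (simp add: mult_single mpoly_deriv_single single_add[symmetric] lookup_add add.commute algebra_simps)
qed

lemma derivation_mpoly_deriv: "derivation (mpoly_deriv i)"
proof -
  have z: "mpoly_deriv i 0 = 0" by (simp add: mpoly_deriv_def)
  have "mpoly_deriv i (p * q) = p * mpoly_deriv i q + mpoly_deriv i p * q" for p q :: "'a mpoly"
  proof (induction p rule: poly_mapping_single_induct)
    case (2 m c)
    show ?case
      by (induction q rule: poly_mapping_single_induct)
        (simp_all add: z mpoly_deriv_single_mult mpoly_deriv_add algebra_simps)
  qed (simp_all add: z mpoly_deriv_add algebra_simps)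
  then show ?thesis by (simp add: derivation_def mpoly_deriv_add)
qed

lemma mpoly_deriv_const [simp]: "mpoly_deriv i (mpoly_const c) = 0"
  by (simp add: mpoly_const_def mpoly_deriv_single)

lemma mpoly_deriv_var: "mpoly_deriv i (mpoly_var j) = (if i = j then 1 else 0)"
  by (simp add: mpoly_var_def mpoly_deriv_single lookup_single when_def)

section \<open>The polynomial ring in finitely many variables as a subring of the type\<close>

abbreviation mpolys :: "nat \<Rightarrow> ('k::comm_ring_1) mpoly set" where
  "mpolys n \<equiv> carrier (mpoly_ring n)"

lemma mem_mpolys_iff: "p \<in> mpolys n \<longleftrightarrow> (\<forall>m\<in>Poly_Mapping.keys p. Poly_Mapping.keys m \<subseteq> {..<n})"
  by (simp add: mpoly_ring_def)

lemma unital_subring_mpolys: "unital_subring (mpolys n)"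
proof -
  have "p * q \<in> mpolys n" if "p \<in> mpolys n" "q \<in> mpolys n" for p q :: "'a mpoly"
    unfolding mem_mpolys_iff
  proof
    fix m assume "m \<in> Poly_Mapping.keys (p * q)"
    then obtain a b where "m = a + b" "a \<in> Poly_Mapping.keys p" "b \<in> Poly_Mapping.keys q"
      using Poly_Mapping.keys_mult[of p q] by blast
    moreover from this have "Poly_Mapping.keys a \<subseteq> {..<n}" "Poly_Mapping.keys b \<subseteq> {..<n}"
      using that unfolding mem_mpolys_iff by auto
    ultimately show "Poly_Mapping.keys m \<subseteq> {..<n}"
      using Poly_Mapping.keys_add[of a b] by auto
  qed
  moreover have "p - q \<in> mpolys n" if "p \<in> mpolys n" "q \<in> mpolys n" for p q :: "'a mpoly"
    using that Poly_Mapping.keys_diff[of p q] unfolding mem_mpolys_iff by (meson Un_iff subsetD)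
  moreover have "1 \<in> mpolys n" by (simp add: mem_mpolys_iff)
  ultimately show ?thesis unfolding unital_subring_def by blast
qed

lemma mpoly_const_in_mpolys [simp]: "mpoly_const c \<in> mpolys n"
  by (simp add: mem_mpolys_iff mpoly_const_def)

lemma mpoly_var_in_mpolys [simp]: "mpoly_var i \<in> mpolys n \<longleftrightarrow> i < n"
  by (simp add: mem_mpolys_iff mpoly_var_def)

lemma mpolys_mono: "m \<le> n \<Longrightarrow> mpolys m \<subseteq> mpolys n"
  by (auto simp: mem_mpolys_iff) (meson lessThan_iff order_less_le_trans subset_iff)

text \<open>Identities between homomorphisms and derivations are thereby checked on constants and
  variables only.\<close>

lemma mpolys_induct [consumes 1, case_names const var add mult]:
  fixes p :: "'k::comm_ring_1 mpoly"
  assumes "p \<in> mpolys n" "\<And>c. P (mpoly_const c)" "\<And>i. i < n \<Longrightarrow> P (mpoly_var i)"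
    and add: "\<And>a b. a \<in> mpolys n \<Longrightarrow> b \<in> mpolys n \<Longrightarrow> P a \<Longrightarrow> P b \<Longrightarrow> P (a + b)"
    and mult: "\<And>a b. a \<in> mpolys n \<Longrightarrow> b \<in> mpolys n \<Longrightarrow> P a \<Longrightarrow> P b \<Longrightarrow> P (a * b)"
  shows "P p"
proof -
  note closed = unital_subringD[OF unital_subring_mpolys]
  have single: "P (Poly_Mapping.single m c) \<and> Poly_Mapping.single m c \<in> mpolys n"
    if "Poly_Mapping.keys m \<subseteq> {..<n}" for m c
    using that
  proof (induction m rule: update_induct)
    case const
    then show ?case using assms(2)[of c] mpoly_const_in_mpolys[of c n] by (simp add: mpoly_const_def)
  next
    case (update f i e)
    have upd: "Poly_Mapping.update i e f = f + Poly_Mapping.single i e"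
      using update(1) by (intro poly_mapping_eqI)
        (auto simp: lookup_update lookup_add lookup_single not_in_keys_iff_lookup_eq_zero when_def)
    have i: "i < n" "Poly_Mapping.keys f \<subseteq> {..<n}" using update
      by (auto simp: keys_update split: if_splits)
    have pw: "P (mpoly_var i ^ e) \<and> (mpoly_var i :: 'k mpoly) ^ e \<in> mpolys n" for e
    proof (induction e)
      case 0
      then show ?case using assms(2)[of 1] closed(1) by simp
    next
      case (Suc e)
      then show ?case using mult[OF _ _ assms(3)[OF i(1)], of "mpoly_var i ^ e"] i(1) by (auto intro: closed(4))
    qed
    have sp: "Poly_Mapping.single (Poly_Mapping.single i e) 1 = (mpoly_var i :: 'k mpoly) ^ e"
    proof (induction e)
      case (Suc e)
      have "Poly_Mapping.single i (Suc e) = Poly_Mapping.single i 1 + Poly_Mapping.single i e"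
        by (simp add: single_add[symmetric])
      then show ?case unfolding power_Suc Suc[symmetric] by (simp add: mpoly_var_def mult_single)
    qed simp
    have "Poly_Mapping.single (f + Poly_Mapping.single i e) c = Poly_Mapping.single f c * mpoly_var i ^ e"
      unfolding sp[symmetric] by (simp add: mult_single)
    then show ?case unfolding upd using mult pw update(3)[OF i(2)] by (auto intro: closed(4))
  qed
  have "finite I \<Longrightarrow> I \<subseteq> Poly_Mapping.keys p \<Longrightarrow>
    P (\<Sum>m\<in>I. Poly_Mapping.single m (Poly_Mapping.lookup p m)) \<and>
    (\<Sum>m\<in>I. Poly_Mapping.single m (Poly_Mapping.lookup p m)) \<in> mpolys n" for I
  proof (induction I rule: finite_induct)
    case empty
    then show ?case using assms(2)[of 0] closed(2) by simp
  next
    case (insert m I)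
    then have "Poly_Mapping.keys m \<subseteq> {..<n}" using assms(1) by (auto simp: mem_mpolys_iff)
    then show ?case using insert single[of m "Poly_Mapping.lookup p m"] by (auto intro: add closed)
  qed
  from this[of "Poly_Mapping.keys p"]
  have "P (\<Sum>m\<in>Poly_Mapping.keys p. Poly_Mapping.single m (Poly_Mapping.lookup p m))" by simp
  moreover have "(\<Sum>m\<in>Poly_Mapping.keys p. Poly_Mapping.single m (Poly_Mapping.lookup p m)) = p"
    by (intro poly_mapping_eqI) (auto simp: lookup_sum lookup_single when_def in_keys_iff sum.delta)
  ultimately show ?thesis by simp
qed

lemma mpolys_total: "\<exists>n. p \<in> mpolys n"
proof -
  have "finite (\<Union>m\<in>Poly_Mapping.keys p. Poly_Mapping.keys m)" by simp
  then obtain n where "(\<Union>m\<in>Poly_Mapping.keys p. Poly_Mapping.keys m) \<subseteq> {..<n}"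
    using finite_nat_bounded by blast
  then show ?thesis unfolding mem_mpolys_iff by blast
qed

lemma mpoly_subst_closed:
  assumes "p \<in> mpolys n" "\<And>i. i < n \<Longrightarrow> v i \<in> C" "unital_subring C" "range mpoly_const \<subseteq> C"
  shows "mpoly_subst v p \<in> C"
  using assms(1)
  by (induction rule: mpolys_induct)
    (use assms in \<open>auto simp: mpoly_subst_add mpoly_subst_mult intro: unital_subringD(4,6)[OF assms(3)]\<close>)

lemma mpoly_subst_id:
  assumes "p \<in> mpolys n" "\<And>i. i < n \<Longrightarrow> v i = mpoly_var i"
  shows "mpoly_subst v p = p"
  using assms(1) by (induction rule: mpolys_induct) (auto simp: mpoly_subst_add mpoly_subst_mult assms(2))

lemma mpoly_deriv_closed:
  assumes "p \<in> mpolys n" shows "mpoly_deriv i p \<in> mpolys n"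
  using assms
proof (induction rule: mpolys_induct)
  case (var j)
  then show ?case using unital_subringD[OF unital_subring_mpolys] by (auto simp: mpoly_deriv_var)
qed (auto simp: derivationD[OF derivation_mpoly_deriv] intro: unital_subringD(2,4,6)[OF unital_subring_mpolys])

lemma mpolys_eq_gen: "mpolys n = subring_gen (range mpoly_const \<union> mpoly_var ` {..<n})"
proof
  show "mpolys n \<subseteq> subring_gen (range mpoly_const \<union> mpoly_var ` {..<n})"
  proof
    show "p \<in> subring_gen (range mpoly_const \<union> mpoly_var ` {..<n})" if "p \<in> mpolys n" for p
      using that
      by (induction rule: mpolys_induct)
        (auto intro: subring_gen.base unital_subringD(6)[OF unital_subring_gen] subring_gen.mult)
  qed
  show "subring_gen (range mpoly_const \<union> mpoly_var ` {..<n}) \<subseteq> mpolys n"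
    by (rule subring_gen_least[OF unital_subring_mpolys]) auto
qed

section \<open>Relations with constant coefficients\<close>

text \<open>For two subrings this is the ring generated by both; with an ideal as first argument it
  is the extension of that ideal, which is how the Nullstellensatz uses it.\<close>

inductive_set prodspan :: "'a::comm_ring_1 set \<Rightarrow> 'a set \<Rightarrow> 'a set" for A K where
  prod: "a \<in> A \<Longrightarrow> b \<in> K \<Longrightarrow> a * b \<in> prodspan A K"
| add: "x \<in> prodspan A K \<Longrightarrow> y \<in> prodspan A K \<Longrightarrow> x + y \<in> prodspan A K"

lemma unital_subring_prodspan:
  assumes A: "unital_subring A" and K: "unital_subring K"
  shows "unital_subring (prodspan A K)"
proof -
  have neg: "- x \<in> prodspan A K" if "x \<in> prodspan A K" for x
    using that
  proof induction
    case (prod a b)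
    then show ?case using prodspan.prod[of "- a" A b K] unital_subringD(5)[OF A] by simp
  next
    case (add x y)
    then show ?case using prodspan.add[of "- x" A K "- y"] by (simp add: add.commute)
  qed
  have pm: "a * b * y \<in> prodspan A K" if y: "y \<in> prodspan A K" and ab: "a \<in> A" "b \<in> K" for a b y
    using y
  proof induction
    case (prod a' b')
    then have "(a * a') * (b * b') \<in> prodspan A K"
      using ab by (intro prodspan.prod unital_subringD(4)[OF A] unital_subringD(4)[OF K])
    then show ?case by (simp add: mult_ac)
  qed (simp add: distrib_left prodspan.add)
  have "x * y \<in> prodspan A K" if x: "x \<in> prodspan A K" and y: "y \<in> prodspan A K" for x y
    using x by induction (simp_all add: distrib_right prodspan.add pm y)
  moreover have "x - y \<in> prodspan A K" if "x \<in> prodspan A K" "y \<in> prodspan A K" for x y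
    using prodspan.add[OF that(1) neg[OF that(2)]] by simp
  moreover have "1 \<in> prodspan A K"
    using prodspan.prod[OF unital_subringD(1)[OF A] unital_subringD(1)[OF K]] by simp
  ultimately show ?thesis by (simp add: unital_subring_def)
qed

lemma prodspan_sumE:
  assumes "x \<in> prodspan A K"
  shows "\<exists>(n::nat) a b. (\<forall>i<n. a i \<in> A \<and> b i \<in> K) \<and> x = (\<Sum>i<n. a i * b i)"
  using assms
proof induction
  case (prod a b)
  then show ?case by (intro exI[of _ 1] exI[of _ "\<lambda>_. a"] exI[of _ "\<lambda>_. b"]) simp
next
  case (add x y)
  then obtain n a b m a' b' where x: "\<forall>i<(n::nat). a i \<in> A \<and> b i \<in> K" "x = (\<Sum>i<n. a i * b i)"
    and y: "\<forall>i<(m::nat). a' i \<in> A \<and> b' i \<in> K" "y = (\<Sum>i<m. a' i * b' i)" by blast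
  let ?a = "\<lambda>i. if i < n then a i else a' (i - n)" and ?b = "\<lambda>i. if i < n then b i else b' (i - n)"
  have "(\<Sum>i<n + m. ?a i * ?b i) = (\<Sum>i<n. ?a i * ?b i) + (\<Sum>i<m. ?a (n + i) * ?b (n + i))"
    by (induction m) (simp_all add: add.assoc)
  then have "x + y = (\<Sum>i<n + m. ?a i * ?b i)" unfolding x y by simp
  then show ?case using x(1) y(1)
    by (intro exI[of _ "n + m"] exI[of _ ?a] exI[of _ ?b]) auto
qed

text \<open>Separates coefficients in \<open>A\<close> from polynomial expressions in
  \<open>F\<close> over the integers, so that a linear functional can act on the former and
  derivations on the latter.\<close>

lemma subring_gen_sumE:
  assumes A: "unital_subring A" and x: "x \<in> subring_gen (A \<union> F)"
  shows "\<exists>(n::nat) a b. (\<forall>i<n. a i \<in> A \<and> b i \<in> subring_gen F) \<and> x = (\<Sum>i<n. a i * b i)"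
proof -
  have "subring_gen (A \<union> F) \<subseteq> prodspan A (subring_gen F)"
  proof (rule subring_gen_least)
    show "unital_subring (prodspan A (subring_gen F))"
      by (rule unital_subring_prodspan[OF A unital_subring_gen])
    have "a * 1 \<in> prodspan A (subring_gen F)" if "a \<in> A" for a
      using that by (intro prodspan.prod subring_gen.one)
    moreover have "1 * b \<in> prodspan A (subring_gen F)" if "b \<in> F" for b
      using that by (intro prodspan.prod subring_gen.base unital_subringD(1)[OF A])
    ultimately show "A \<union> F \<subseteq> prodspan A (subring_gen F)" by auto
  qed
  then have "x \<in> prodspan A (subring_gen F)" using x by blast
  from prodspan_sumE[OF this] show ?thesis .
qed

lemma subring_gen_image:
  assumes "h 1 = 1" "\<And>a b. h (a - b) = h a - h b" "\<And>a b. h (a * b) = h a * h b"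
  shows "subring_gen (h ` F) = h ` subring_gen F"
proof
  have "unital_subring (h ` subring_gen F)"
    unfolding unital_subring_def
  proof (intro conjI ballI)
    show "1 \<in> h ` subring_gen F" using assms(1) subring_gen.one[of F] by (metis imageI)
    fix x y assume "x \<in> h ` subring_gen F" "y \<in> h ` subring_gen F"
    then obtain a b where ab: "x = h a" "y = h b" "a \<in> subring_gen F" "b \<in> subring_gen F" by blast
    show "x - y \<in> h ` subring_gen F"
      unfolding ab assms(2)[symmetric] by (intro imageI subring_gen.diff ab)
    show "x * y \<in> h ` subring_gen F"
      unfolding ab assms(3)[symmetric] by (intro imageI subring_gen.mult ab)
  qed
  then show "subring_gen (h ` F) \<subseteq> h ` subring_gen F"
    by (rule subring_gen_least) (auto intro: subring_gen.base)
  have "h x \<in> subring_gen (h ` F)" if "x \<in> subring_gen F" for x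
    using that by induction (auto simp: assms intro: subring_gen.intros)
  then show "h ` subring_gen F \<subseteq> subring_gen (h ` F)" by blast
qed

context prime_mod
begin

text \<open>The Wronskian argument: for a nontrivial relation of minimal support, normalizing one
  coefficient to be constant and differentiating gives a relation of smaller support.\<close>

lemma minimal_relation:
  fixes D :: "'i \<Rightarrow> 'a \<Rightarrow> 'a" and a0 :: "'j \<Rightarrow> 'a"
  assumes J: "finite J"
    and D: "\<And>i f. i \<in> I \<Longrightarrow> f \<in> R \<Longrightarrow> D i f \<in> R" "\<And>i f. i \<in> I \<Longrightarrow> f \<in> P \<Longrightarrow> D i f \<in> P"
    and RelR: "\<And>a j. Rel a \<Longrightarrow> j \<in> J \<Longrightarrow> a j \<in> R"
    and Rel_diff: "\<And>a b. Rel a \<Longrightarrow> Rel b \<Longrightarrow> Rel (\<lambda>j. a j - b j)"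
    and Rel_scale: "\<And>a r. Rel a \<Longrightarrow> r \<in> R \<Longrightarrow> Rel (\<lambda>j. r * a j)"
    and Rel_D: "\<And>a i. Rel a \<Longrightarrow> i \<in> I \<Longrightarrow> Rel (\<lambda>j. D i (a j))"
    and Tr_cancel: "\<And>a b r t. Rel a \<Longrightarrow> Tr b \<Longrightarrow> r \<in> R \<Longrightarrow> r \<notin> P \<Longrightarrow> t \<in> R \<Longrightarrow>
       Tr (\<lambda>j. r * a j - t * b j) \<Longrightarrow> Tr a"
    and Tr_P: "\<And>a. \<forall>j\<in>J. a j \<in> P \<Longrightarrow> Tr a"
    and a0: "Rel a0" "\<not> Tr a0"
  shows "\<exists>a j0. Rel a \<and> \<not> Tr a \<and> j0 \<in> J \<and> a j0 \<notin> P \<and>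
    (\<forall>i\<in>I. \<forall>j\<in>J. a j0 * D i (a j) - a j * D i (a j0) \<in> P)"
proof -
  define supp where "supp a = {j\<in>J. a j \<notin> P}" for a :: "'j \<Rightarrow> 'a"
  have fin: "finite (supp a)" for a using J by (simp add: supp_def)
  obtain a where a: "Rel a" "\<not> Tr a" and
    min: "\<And>b. Rel b \<Longrightarrow> \<not> Tr b \<Longrightarrow> card (supp a) \<le> card (supp b)"
    using ex_has_least_nat[of "\<lambda>a. Rel a \<and> \<not> Tr a" a0 "\<lambda>a. card (supp a)"] a0 by blast
  obtain j0 where j0: "j0 \<in> J" "a j0 \<notin> P" using Tr_P a(2) by blast
  have less: "Tr b" if b: "Rel b" "supp b \<subseteq> supp a" "j \<in> supp a" "j \<notin> supp b" for b j
  proof (rule ccontr)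
    assume "\<not> Tr b"
    then have "card (supp a) \<le> card (supp b)" using min b by blast
    moreover have "card (supp b) < card (supp a)" using b by (intro psubset_card_mono fin) blast
    ultimately show False by simp
  qed
  have "a j0 * D i (a j) - a j * D i (a j0) \<in> P" if i: "i \<in> I" and j: "j \<in> J" for i j
  proof (rule ccontr)
    assume n: "\<not> ?thesis"
    \<comment> \<open>Up to the square of \<open>a j0\<close> this is the derivative of the relation
      normalized to have coefficient 1 at \<open>j0\<close>; so \<open>j0\<close> leaves the
      support.\<close>
    define b where "b j = a j0 * D i (a j) - D i (a j0) * a j" for j
    have aR: "j \<in> J \<Longrightarrow> a j \<in> R" for j using RelR a by blast
    have b: "Rel b" unfolding b_def using a i aR[OF j0(1)] D(1)[OF i]
      by (intro Rel_diff Rel_scale Rel_D) auto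
    have sb: "supp b \<subseteq> supp a"
    proof
      fix j assume j: "j \<in> supp b"
      have "b j \<in> P" if "a j \<in> P"
        unfolding b_def using that D(2)[OF i that] D(1)[OF i aR[OF j0(1)]] aR[OF j0(1)]
        by (intro P_diff P_mult) auto
      then show "j \<in> supp a" using j by (auto simp: supp_def)
    qed
    have bj: "b j \<notin> P" using n by (simp add: b_def mult.commute)
    have "b j0 = 0" by (simp add: b_def mult.commute)
    then have "Tr b" using less[OF b sb, of j0] j0 P_zero by (auto simp: supp_def)
    \<comment> \<open>That \<open>b\<close> is trivial does not yet touch \<open>a\<close>. The
      entry of \<open>b\<close> at \<open>j\<close> is outside \<open>P\<close>, so this combination
      removes \<open>j\<close> from the support and is trivial too; \<open>Tr_cancel\<close> then
      passes from it and \<open>b\<close> to \<open>a\<close>.\<close>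
    define b' where "b' k = b j * a k - a j * b k" for k
    have bR: "j \<in> J \<Longrightarrow> b j \<in> R" for j using RelR b by blast
    have b': "Rel b'" unfolding b'_def using a b aR[OF j] bR[OF j] by (intro Rel_diff Rel_scale) auto
    have "supp b' \<subseteq> supp a"
    proof
      fix k assume k: "k \<in> supp b'"
      have "b' k \<in> P" if "a k \<in> P" "b k \<in> P"
        unfolding b'_def using that aR[OF j] bR[OF j] by (intro P_diff P_mult) auto
      then show "k \<in> supp a" using k sb by (auto simp: supp_def)
    qed
    moreover have "b' j = 0" by (simp add: b'_def mult.commute)
    then have "j \<notin> supp b'" using P_zero by (simp add: supp_def)
    moreover have "j \<in> supp a" using sb bj j by (auto simp: supp_def)
    ultimately have "Tr b'" using less[OF b'] by blast
    then have "Tr a" unfolding b'_def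
      using Tr_cancel[OF a(1) \<open>Tr b\<close> bR[OF j] bj aR[OF j]] by blast
    then show False using a by blast
  qed
  then show ?thesis using a j0 by blast
qed

text \<open>By \<open>const\<close> the ratios \<open>a j / e\<close> are constants modulo
  \<open>P\<close>, so differentiating the relation divided by \<open>e\<close> differentiates only
  the \<open>f j\<close>.\<close>

lemma constant_ratio_relation:
  assumes D: "\<And>i. i \<in> I \<Longrightarrow> derivation (D i)" "\<And>i f. i \<in> I \<Longrightarrow> f \<in> R \<Longrightarrow> D i f \<in> R"
      "\<And>i f. i \<in> I \<Longrightarrow> f \<in> P \<Longrightarrow> D i f \<in> P"
    and a: "\<And>j. j \<in> J \<Longrightarrow> a j \<in> R" "e \<in> R" "e \<notin> P"
    and const: "\<And>i j. i \<in> I \<Longrightarrow> j \<in> J \<Longrightarrow> e * D i (a j) - a j * D i e \<in> P"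
    and f: "\<And>j. j \<in> J \<Longrightarrow> f j \<in> R"
    and rel: "(\<Sum>j\<in>J. a j * f j) \<in> P" and u: "u \<in> lists I"
  shows "(\<Sum>j\<in>J. a j * foldr D u (f j)) \<in> P \<and> (\<forall>j\<in>J. foldr D u (f j) \<in> R)"
  using u
proof induction
  case Nil
  show ?case using rel f by simp
next
  case (Cons i u)
  let ?g = "\<lambda>j. foldr D u (f j)"
  have g: "\<forall>j\<in>J. ?g j \<in> R" and s: "(\<Sum>j\<in>J. a j * ?g j) \<in> P" using Cons.IH by auto
  have "(\<Sum>j\<in>J. (e * D i (a j) - a j * D i e) * ?g j) \<in> P"
    using const[OF Cons(1)] g by (intro P_sum P_mult_right) auto
  moreover have "e * D i (\<Sum>j\<in>J. a j * ?g j) \<in> P" using D Cons(1) s a by (intro P_mult) auto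
  moreover have "D i e * (\<Sum>j\<in>J. a j * ?g j) \<in> P" using D Cons(1) s a by (intro P_mult) auto
  \<comment> \<open>The first two terms are the quotient rule for the relation divided by
    \<open>e\<close>. The last sum removes the derivatives of the ratios, which leaves
    \<open>e\<close> times the differentiated relation.\<close>
  ultimately have "e * D i (\<Sum>j\<in>J. a j * ?g j) - D i e * (\<Sum>j\<in>J. a j * ?g j) -
      (\<Sum>j\<in>J. (e * D i (a j) - a j * D i e) * ?g j) \<in> P" by (intro P_diff)
  also have "e * D i (\<Sum>j\<in>J. a j * ?g j) - D i e * (\<Sum>j\<in>J. a j * ?g j) -
      (\<Sum>j\<in>J. (e * D i (a j) - a j * D i e) * ?g j) = e * (\<Sum>j\<in>J. a j * D i (?g j))"
    by (simp add: derivationD[OF D(1)[OF Cons(1)]] sum_distrib_left sum_subtractf[symmetric] sum.distrib[symmetric] algebra_simps)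
  finally have "e * (\<Sum>j\<in>J. a j * D i (?g j)) \<in> P" .
  moreover have "(\<Sum>j\<in>J. a j * D i (?g j)) \<in> R"
    using a g D(2)[OF Cons(1)] by (intro unital_subring_sum[OF R] unital_subringD(4)[OF R]) auto
  ultimately have "(\<Sum>j\<in>J. a j * D i (?g j)) \<in> P" using P_prime a by blast
  then show ?case using g D(2)[OF Cons(1)] by auto
qed

end

text \<open>For \<open>S = R\<close> the local ring of \<open>R\<close> at \<open>P\<close>, for
  \<open>S = P\<close> its maximal ideal; the residue field is the fraction field of
  \<open>R/P\<close>.\<close>

definition localized :: "'a::idom set \<Rightarrow> 'a set \<Rightarrow> 'a set \<Rightarrow> 'a fract set" where
  "localized R P S = {Fract a b |a b. a \<in> S \<and> b \<in> R \<and> b \<notin> P}"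

context
  fixes R P :: "'a::idom set"
  assumes RP: "prime_mod R P"
begin

interpretation prime_mod R P by (rule RP)

lemma localized_den_nonzero: "b \<in> R \<Longrightarrow> b \<notin> P \<Longrightarrow> b \<noteq> 0"
  using P_zero by auto

lemma Fract_in_localized_P_iff:
  assumes "a \<in> R" "b \<in> R" "b \<notin> P"
  shows "Fract a b \<in> localized R P P \<longleftrightarrow> a \<in> P"
proof
  assume "Fract a b \<in> localized R P P"
  then obtain c d where cd: "Fract a b = Fract c d" "c \<in> P" "d \<in> R" "d \<notin> P"
    unfolding localized_def by blast
  then have "a * d = c * b" using assms localized_den_nonzero by (simp add: eq_fract)
  then have "a * d \<in> P" using P_mult_right[OF cd(2) assms(2)] by simp
  then show "a \<in> P" using P_prime assms cd by blast
qed (use assms localized_def in blast)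

lemma prime_mod_localized: "prime_mod (localized R P R) (localized R P P)"
proof
  have den: "b * d \<in> R \<and> b * d \<notin> P \<and> b * d \<noteq> 0" if "b \<in> R" "b \<notin> P" "d \<in> R" "d \<notin> P" for b d
    using that P_prime unital_subringD(4)[OF R] localized_den_nonzero by (metis no_zero_divisors)
  note Rc = unital_subringD[OF R]
  have one: "1 \<in> R" "1 \<notin> P" using Rc P_one by auto
  have I: "Fract a b \<in> localized R P S" if "a \<in> S" "b \<in> R" "b \<notin> P" for a b S
    using that unfolding localized_def by blast
  have E: "\<exists>a b. x = Fract a b \<and> a \<in> S \<and> b \<in> R \<and> b \<notin> P \<and> b \<noteq> 0" if "x \<in> localized R P S" for x S
    using that P_zero unfolding localized_def by blast
  show "unital_subring (localized R P R)"
    unfolding unital_subring_def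
  proof (intro conjI ballI)
    show "1 \<in> localized R P R" using I[of 1 R 1] one by (simp add: One_fract_def)
  next
    fix x y assume "x \<in> localized R P R" "y \<in> localized R P R"
    then obtain a b c d where "x = Fract a b" "y = Fract c d" "a \<in> R" "b \<in> R" "b \<notin> P" "b \<noteq> 0"
      "c \<in> R" "d \<in> R" "d \<notin> P" "d \<noteq> 0" using E[of x R] E[of y R] by blast
    then show "x - y \<in> localized R P R" "x * y \<in> localized R P R" using den[of b d]
      by (auto simp: diff_fract intro!: I Rc)
  qed
  show "localized R P P \<subseteq> localized R P R" using P_sub unfolding localized_def by blast
  show "1 \<notin> localized R P P" using Fract_in_localized_P_iff[of 1 1] one by (simp add: One_fract_def)
  show "0 \<in> localized R P P" using I[of 0 P 1] one P_zero by (simp add: Zero_fract_def)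
  fix x y :: "'a fract"
  show "x + y \<in> localized R P P" if xy: "x \<in> localized R P P" "y \<in> localized R P P"
  proof -
    obtain a b c d where *: "x = Fract a b" "y = Fract c d" "a \<in> P" "b \<in> R" "b \<notin> P" "b \<noteq> 0"
      "c \<in> P" "d \<in> R" "d \<notin> P" "d \<noteq> 0" using E[OF xy(1)] E[OF xy(2)] by blast
    then have "x + y = Fract (a * d + c * b) (b * d)" by simp
    moreover have "a * d + c * b \<in> P" using * by (intro P_add P_mult_right)
    ultimately show ?thesis using I den[of b d] * by simp
  qed
  show "x * y \<in> localized R P P" if xy: "x \<in> localized R P R" "y \<in> localized R P P"
  proof -
    obtain a b c d where *: "x = Fract a b" "y = Fract c d" "a \<in> R" "b \<in> R" "b \<notin> P" "b \<noteq> 0"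
      "c \<in> P" "d \<in> R" "d \<notin> P" "d \<noteq> 0" using E[OF xy(1)] E[OF xy(2)] by blast
    then have "x * y = Fract (a * c) (b * d)" by simp
    moreover have "a * c \<in> P" using * by (intro P_mult)
    ultimately show ?thesis using I den[of b d] * by simp
  qed
  show "x \<in> localized R P P \<or> y \<in> localized R P P"
    if xy: "x \<in> localized R P R" "y \<in> localized R P R" "x * y \<in> localized R P P"
  proof -
    obtain a b c d where *: "x = Fract a b" "y = Fract c d" "a \<in> R" "b \<in> R" "b \<notin> P" "b \<noteq> 0"
      "c \<in> R" "d \<in> R" "d \<notin> P" "d \<noteq> 0" using E[OF xy(1)] E[OF xy(2)] by blast
    then have "a * c \<in> P" using xy(3) den[of b d] Fract_in_localized_P_iff[of "a * c" "b * d"] Rc(4)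
      by simp
    then have "a \<in> P \<or> c \<in> P" using P_prime * by blast
    then show ?thesis using * by (auto intro: I)
  qed
qed

end

lemma Fract_power: "Fract a b ^ n = Fract (a ^ n) (b ^ n :: 'a::idom)"
  by (induction n) (simp_all add: One_fract_def)

lemma sum_Fract_same_den:
  "b \<noteq> 0 \<Longrightarrow> (\<Sum>i\<in>I. Fract (f i) (b::'a::idom)) = Fract (sum f I) b"
proof (induction I rule: infinite_finite_induct)
  case (insert x F)
  have "Fract (f x) b + Fract (sum f F) b = Fract (b * (f x + sum f F)) (b * b)"
    using insert.prems by (simp add: algebra_simps)
  then show ?case using insert mult_fract_cancel[OF insert.prems] by simp
qed (simp_all add: Zero_fract_def eq_fract)

section \<open>Linear derivations and generic orbits\<close>

lemma derivation_sum:
  "(\<And>j. j \<in> J \<Longrightarrow> derivation (D j)) \<Longrightarrow> derivation (\<lambda>f. \<Sum>j\<in>J. c j * D j f)"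
  unfolding derivation_def
  by (auto simp: sum.distrib sum_distrib_left sum_distrib_right distrib_left algebra_simps intro!: sum.cong)

lemma mpoly_deriv_outside:
  assumes "p \<in> mpolys n" "n \<le> i" shows "mpoly_deriv i p = 0"
  using assms(1)
  by (induction rule: mpolys_induct)
    (use assms(2) in \<open>auto simp: derivationD[OF derivation_mpoly_deriv] mpoly_deriv_var\<close>)

text \<open>A basis of the subspace \<open>Q\<close> stays independent when \<open>t\<close> is
  added; the functional is zero on the basis and one at \<open>t\<close>.\<close>

lemma linear_functional_separating:
  fixes Q :: "'k::field mpoly set"
  assumes Q0: "0 \<in> Q" and Qadd: "\<And>a b. a \<in> Q \<Longrightarrow> b \<in> Q \<Longrightarrow> a + b \<in> Q"
    and Qscale: "\<And>c a. a \<in> Q \<Longrightarrow> mpoly_const c * a \<in> Q" and t: "t \<notin> Q"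
  obtains \<phi> :: "'k mpoly \<Rightarrow> 'k" where "\<And>a b. \<phi> (a + b) = \<phi> a + \<phi> b"
    "\<And>c a. \<phi> (mpoly_const c * a) = c * \<phi> a" "\<And>a. a \<in> Q \<Longrightarrow> \<phi> a = 0" "\<phi> t \<noteq> 0"
proof -
  interpret V: vector_space "\<lambda>(c::'k) (f::'k mpoly). mpoly_const c * f"
    by unfold_locales (simp_all add: mpoly_const_hom algebra_simps)
  interpret W: vector_space "(*) :: 'k \<Rightarrow> 'k \<Rightarrow> 'k"
    by unfold_locales (simp_all add: algebra_simps)
  interpret VW: vector_space_pair "\<lambda>(c::'k) (f::'k mpoly). mpoly_const c * f" "(*) :: 'k \<Rightarrow> 'k \<Rightarrow> 'k" ..
  have sub: "V.subspace Q" unfolding V.subspace_def using Q0 Qadd Qscale by blast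
  obtain B where B: "B \<subseteq> Q" "\<not> V.dependent B" "Q \<subseteq> V.span B"
    using V.basis_exists[of Q] by metis
  have "V.span B \<subseteq> Q" using V.span_minimal[OF B(1) sub] .
  then have "t \<notin> V.span B" using t by blast
  then have ind: "\<not> V.dependent (insert t B)" using B(2) V.independent_insertI by blast
  obtain g where g: "Vector_Spaces.linear (\<lambda>(c::'k) (f::'k mpoly). mpoly_const c * f) (*) g"
    "\<forall>x\<in>insert t B. g x = (if x = t then 1 else 0)"
    using VW.linear_independent_extend[OF ind, of "\<lambda>x. if x = t then 1 else 0"] by blast
  interpret G: Vector_Spaces.linear "\<lambda>(c::'k) (f::'k mpoly). mpoly_const c * f" "(*)" g by (rule g(1))
  have gB: "g x = 0" if "x \<in> B" for x using g(2) that \<open>t \<notin> V.span B\<close> V.span_base[OF that] by auto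
  have "g x = 0" if "x \<in> V.span B" for x
    using that by (induction rule: V.span_induct_alt) (simp_all add: G.zero G.add G.scale gB)
  then show ?thesis using that[of g] G.add G.scale g(2) B(3) by (metis insertI1 subsetD zero_neq_one)
qed

lemma const_notin_prime:
  assumes "prime_mod (mpolys n) (M :: 'k::field mpoly set)" "k \<noteq> 0" shows "mpoly_const k \<notin> M"
proof
  assume "mpoly_const k \<in> M"
  then have "mpoly_const (inverse k) * mpoly_const k \<in> M"
    by (intro prime_mod.P_mult[OF assms(1)]) auto
  then show False using assms(2) prime_mod.P_one[OF assms(1)]
    by (simp add: mpoly_const_hom(2)[symmetric])
qed

lemma unital_subring_range_const: "unital_subring (range (mpoly_const :: 'k::comm_ring_1 \<Rightarrow> _))"
  unfolding unital_subring_def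
  by (auto simp: mpoly_const_hom(2)[symmetric] mpoly_const_hom(4)[symmetric] intro: image_eqI[of _ _ 1])

text \<open>In the application \<open>c i j l\<close> is the coefficient of the \<open>l\<close>-th
  basis vector in the Lie bracket of the \<open>i\<close>-th and the \<open>j\<close>-th, which
  makes \<open>delta i\<close> the Hamiltonian derivation of the \<open>i\<close>-th
  variable.\<close>

locale linear_action =
  fixes s :: nat and c :: "nat \<Rightarrow> nat \<Rightarrow> nat \<Rightarrow> 'k::field_char_0"
begin

abbreviation A :: "'k mpoly set" where "A \<equiv> mpolys s"

definition delta :: "nat \<Rightarrow> 'k mpoly \<Rightarrow> 'k mpoly" where
  "delta i f = (\<Sum>j<s. (\<Sum>l<s. mpoly_const (c i j l) * mpoly_var l) * mpoly_deriv j f)"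

text \<open>The entries \<open>Y j l\<close> of the generic matrix are variables of the same polynomial type as \<open>A\<close>,
  numbered after the variables of \<open>A\<close>.\<close>

definition yv :: "nat \<Rightarrow> nat \<Rightarrow> nat" where
  "yv j l = s + j * s + l"

abbreviation Y :: "nat \<Rightarrow> nat \<Rightarrow> 'k mpoly" where
  "Y j l \<equiv> mpoly_var (yv j l)"

text \<open>The vector field \<open>Y -> C Y\<close> with \<open>C\<close> the matrix of
  \<open>delta i\<close>, that is, infinitesimal left multiplication on matrices. The variables of
  \<open>A\<close> are constants for it.\<close>

definition ydelta :: "nat \<Rightarrow> 'k mpoly \<Rightarrow> 'k mpoly" where
  "ydelta i f = (\<Sum>j<s. \<Sum>l<s. (\<Sum>m<s. mpoly_const (c i j m) * Y m l) * mpoly_deriv (yv j l) f)"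

definition coact :: "'k mpoly \<Rightarrow> 'k mpoly" where
  "coact = mpoly_subst (\<lambda>j. if j < s then \<Sum>l<s. Y j l * mpoly_var l else 0)"

text \<open>Every remaining variable of the type goes to 0, so that all values lie in
  \<open>A\<close>, whatever the argument.\<close>

definition eval_one :: "'k mpoly \<Rightarrow> 'k mpoly" where
  "eval_one = mpoly_subst (\<lambda>j. if j < s then mpoly_var j else if \<exists>a<s. j = yv a a then 1 else 0)"

definition Ys :: "'k mpoly set" where
  "Ys = (\<lambda>(j, l). Y j l) ` ({..<s} \<times> {..<s})"

definition const_polys :: "'k mpoly set" where
  "const_polys = range mpoly_const"

definition Y_polys :: "'k mpoly set" where
  "Y_polys = subring_gen (const_polys \<union> Ys)"

lemma yv_eq_iff: "l < s \<Longrightarrow> l' < s \<Longrightarrow> yv j l = yv j' l' \<longleftrightarrow> j = j' \<and> l = l'"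
proof
  assume l: "l < s" "l' < s" and eq: "yv j l = yv j' l'"
  then have eq': "j * s + l = j' * s + l'" by (simp add: yv_def)
  have "(j * s + l) div s = j" "(j' * s + l') div s = j'" using l by auto
  then have "j = j'" using eq' by metis
  then show "j = j' \<and> l = l'" using eq' by simp
qed simp

lemma yv_ge: "s \<le> yv j l"
  by (simp add: yv_def)

lemma derivation_delta: "derivation (delta i)"
  unfolding delta_def by (rule derivation_sum) (rule derivation_mpoly_deriv)

lemma derivation_ydelta: "derivation (ydelta i)"
proof -
  have "derivation (\<lambda>f. \<Sum>j<s. 1 * (\<Sum>l<s. (\<Sum>m<s. mpoly_const (c i j m) * Y m l) * mpoly_deriv (yv j l) f))"
    by (intro derivation_sum derivation_mpoly_deriv)
  then show ?thesis by (simp add: ydelta_def[abs_def])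
qed

lemmas deltaD = derivationD[OF derivation_delta]
lemmas ydeltaD = derivationD[OF derivation_ydelta]
lemmas A_ring = unital_subring_mpolys[of s, where 'a='k]

lemma const_polys_ring: "unital_subring const_polys"
  unfolding const_polys_def by (rule unital_subring_range_const)

lemma const_polys_sub_A: "const_polys \<subseteq> A"
  by (auto simp: const_polys_def)

lemma delta_closed: "f \<in> A \<Longrightarrow> delta i f \<in> A"
  unfolding delta_def
  by (intro unital_subring_sum[OF A_ring] unital_subringD(4)[OF A_ring] mpoly_deriv_closed) auto

lemma delta_const [simp]: "delta i (mpoly_const k) = 0"
  by (simp add: delta_def)

lemma ydelta_const [simp]: "ydelta i (mpoly_const k) = 0"
  by (simp add: ydelta_def)

lemma ydelta_A: "f \<in> A \<Longrightarrow> ydelta i f = 0"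
  by (simp add: ydelta_def mpoly_deriv_outside[OF _ yv_ge])

lemma delta_var: "j < s \<Longrightarrow> delta i (mpoly_var j) = (\<Sum>l<s. mpoly_const (c i j l) * mpoly_var l)"
  unfolding delta_def mpoly_deriv_var by (simp add: if_distrib cong: if_cong)

lemma ydelta_Y:
  assumes "a < s" "b < s"
  shows "ydelta i (Y a b) = (\<Sum>m<s. mpoly_const (c i a m) * Y m b)"
proof -
  have "ydelta i (Y a b) = (\<Sum>j<s. \<Sum>l<s. if l = b then (if j = a then \<Sum>m<s. mpoly_const (c i j m) * Y m l else 0) else 0)"
    unfolding ydelta_def mpoly_deriv_var using assms by (intro sum.cong) (auto simp: yv_eq_iff)
  also have "\<dots> = (\<Sum>j<s. if j = a then \<Sum>m<s. mpoly_const (c i j m) * Y m b else 0)"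
    using assms by (simp add: sum.delta)
  also have "\<dots> = (\<Sum>m<s. mpoly_const (c i a m) * Y m b)" using assms by (simp add: sum.delta)
  finally show ?thesis .
qed

lemmas coact_hom = mpoly_subst_add mpoly_subst_mult mpoly_subst_diff mpoly_subst_minus mpoly_subst_sum mpoly_subst_power

lemma coact_simps [simp]: "coact 0 = 0" "coact 1 = 1" "coact (mpoly_const k) = mpoly_const k"
  "coact (a + b) = coact a + coact b" "coact (a * b) = coact a * coact b" "coact (a - b) = coact a - coact b"
  "coact (a ^ n) = coact a ^ n" "coact (sum f I) = (\<Sum>i\<in>I. coact (f i))"
  by (simp_all add: coact_def coact_hom)

lemma eval_one_simps [simp]: "eval_one 0 = 0" "eval_one 1 = 1" "eval_one (mpoly_const k) = mpoly_const k"
  "eval_one (a + b) = eval_one a + eval_one b" "eval_one (a * b) = eval_one a * eval_one b"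
  "eval_one (a - b) = eval_one a - eval_one b"
  "eval_one (a ^ n) = eval_one a ^ n" "eval_one (sum f I) = (\<Sum>i\<in>I. eval_one (f i))"
  by (simp_all add: eval_one_def coact_hom)

lemma coact_var: "j < s \<Longrightarrow> coact (mpoly_var j) = (\<Sum>l<s. Y j l * mpoly_var l)"
  by (simp add: coact_def)

lemma eval_one_A: "f \<in> A \<Longrightarrow> eval_one f = f"
  unfolding eval_one_def by (rule mpoly_subst_id) auto

lemma eval_one_Y: "a < s \<Longrightarrow> b < s \<Longrightarrow> eval_one (Y a b) = (if a = b then 1 else 0)"
  using yv_ge[of a b] by (auto simp: eval_one_def yv_eq_iff)

lemma eval_one_in_A: "eval_one f \<in> A"
proof -
  obtain n where "f \<in> mpolys n" using mpolys_total by blast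
  then show ?thesis unfolding eval_one_def
    by (rule mpoly_subst_closed[OF _ _ A_ring]) (auto intro: unital_subringD(1,2)[OF A_ring])
qed

lemma eval_one_coact:
  assumes "f \<in> A" shows "eval_one (coact f) = f"
  using assms
proof (induction rule: mpolys_induct)
  case (var j)
  have "eval_one (coact (mpoly_var j)) = (\<Sum>l<s. if j = l then mpoly_var l else 0)"
    unfolding coact_var[OF var] eval_one_simps
    by (rule sum.cong) (use var in \<open>auto simp: eval_one_Y eval_one_A\<close>)
  then show ?case using var by (simp add: sum.delta')
qed auto

text \<open>Both sides are derivations along the homomorphism \<open>coact\<close>, so it suffices
  to compare them on variables, where both are entries of the vector \<open>C Y x\<close>.\<close>

lemma coact_delta:
  assumes "f \<in> A" shows "coact (delta i f) = ydelta i (coact f)"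
  using assms
proof (induction rule: mpolys_induct)
  case (var j)
  have "ydelta i (coact (mpoly_var j)) = (\<Sum>l<s. (\<Sum>m<s. mpoly_const (c i j m) * Y m l) * mpoly_var l)"
    unfolding coact_var[OF var] using var by (simp add: ydeltaD ydelta_Y ydelta_A)
  also have "\<dots> = (\<Sum>m<s. mpoly_const (c i j m) * (\<Sum>l<s. Y m l * mpoly_var l))"
    unfolding sum_distrib_right sum_distrib_left by (subst sum.swap) (simp add: mult.assoc)
  also have "\<dots> = coact (delta i (mpoly_var j))"
    unfolding delta_var[OF var] by (simp add: coact_var)
  finally show ?case ..
qed (simp_all add: deltaD ydeltaD)

lemma foldr_delta_closed: "f \<in> A \<Longrightarrow> foldr delta u f \<in> A"
  by (induction u) (auto intro: delta_closed)

lemma foldr_coact: "f \<in> A \<Longrightarrow> foldr ydelta u (coact f) = coact (foldr delta u f)"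
  by (induction u) (auto simp: coact_delta foldr_delta_closed)

lemma foldr_ydelta_A_mult: "a \<in> A \<Longrightarrow> foldr ydelta u (a * f) = a * foldr ydelta u f"
  by (induction u) (auto simp: ydeltaD ydelta_A)

lemmas foldr_ydelta = derivation_foldr[of _ ydelta, OF derivation_ydelta]

lemma Y_polys_ydelta: "f \<in> Y_polys \<Longrightarrow> ydelta i f \<in> Y_polys"
  unfolding Y_polys_def
proof (induction rule: subring_gen.induct)
  case (base a)
  have c: "mpoly_const k \<in> subring_gen (const_polys \<union> Ys)" for k
    by (rule subring_gen.base) (simp add: const_polys_def)
  show ?case
  proof (cases "a \<in> const_polys")
    case True
    then show ?thesis using c[of 0] by (auto simp: const_polys_def)
  next
    case False
    then obtain j l where jl: "j < s" "l < s" "a = Y j l" using base by (auto simp: Ys_def)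
    have "Y m l \<in> subring_gen (const_polys \<union> Ys)" if "m < s" for m
      by (rule subring_gen.base) (use that jl in \<open>auto simp: Ys_def\<close>)
    then show ?thesis unfolding jl(3) ydelta_Y[OF jl(1,2)]
      by (intro unital_subring_sum[OF unital_subring_gen] subring_gen.mult c) auto
  qed
next
  case one
  then show ?case by (simp add: ydeltaD unital_subringD(2)[OF unital_subring_gen])
next
  case (mult a b)
  then show ?case
    by (simp add: ydeltaD unital_subringD(6)[OF unital_subring_gen] subring_gen.mult)
qed (simp add: ydeltaD subring_gen.diff)

lemma Y_polys_foldr: "f \<in> Y_polys \<Longrightarrow> foldr ydelta u f \<in> Y_polys"
  by (induction u) (auto intro: Y_polys_ydelta)

lemma Y_polys_eval_one: "f \<in> Y_polys \<Longrightarrow> eval_one f \<in> const_polys"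
  unfolding Y_polys_def
proof (induction rule: subring_gen.induct)
  case (base a)
  then show ?case
    using unital_subringD(1,2)[OF const_polys_ring]
    by (auto simp: const_polys_def Ys_def eval_one_Y)
qed (auto intro: unital_subringD(1,3,4)[OF const_polys_ring])

lemma coact_in_gen: "f \<in> A \<Longrightarrow> coact f \<in> subring_gen (A \<union> Ys)"
  unfolding coact_def
proof (rule mpoly_subst_closed)
  fix j assume j: "j < s"
  have "Y j l \<in> subring_gen (A \<union> Ys)" "mpoly_var l \<in> subring_gen (A \<union> Ys)" if "l < s" for l
    using that j by (auto simp: Ys_def intro!: subring_gen.base)
  then show "(if j < s then \<Sum>l<s. Y j l * mpoly_var l else 0) \<in> subring_gen (A \<union> Ys)"
    using j by (auto intro!: unital_subring_sum[OF unital_subring_gen] subring_gen.mult)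
qed (auto intro: subring_gen.base)

definition stable_prime :: "'k mpoly set \<Rightarrow> bool" where
  "stable_prime Q \<longleftrightarrow> prime_mod A Q \<and> (\<forall>i<s. \<forall>f\<in>Q. delta i f \<in> Q)"

text \<open>Taken in the whole polynomial type instead of \<open>A[Y]\<close>: for a prime
  \<open>Q\<close>, any further variable lies in \<open>generic Q\<close>, as
  \<open>eval_one\<close> and every \<open>ydelta i\<close> kill it.\<close>

definition generic :: "'k mpoly set \<Rightarrow> 'k mpoly set" where
  "generic Q = core {..<s} ydelta UNIV (eval_one -` Q)"

lemma mem_generic: "f \<in> generic Q \<longleftrightarrow> (\<forall>u\<in>lists {..<s}. eval_one (foldr ydelta u f) \<in> Q)"
  by (simp add: generic_def core_def)

lemma prime_generic:
  assumes Q: "prime_mod A Q" shows "prime_mod UNIV (generic Q)"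
  unfolding generic_def
proof (rule core_prime)
  interpret prime_mod A Q by fact
  show "prime_mod UNIV (eval_one -` Q)"
  proof
    fix a b :: "'k mpoly" assume "a * b \<in> eval_one -` Q"
    then show "a \<in> eval_one -` Q \<or> b \<in> eval_one -` Q"
      using P_prime[OF eval_one_in_A eval_one_in_A, of a b] by auto
  qed (use P_one P_zero in \<open>auto intro: P_add P_mult eval_one_in_A unital_subring_UNIV\<close>)
  show "of_nat n \<notin> eval_one -` Q" if "n > 0" for n
    using const_notin_prime[OF Q, of "of_nat n"] that
    by (simp add: mpoly_const_of_nat[symmetric])
qed (auto simp: derivation_ydelta)

text \<open>The iterated derivatives at \<open>Y = 1\<close> of the orbit function
  \<open>coact f\<close> are the iterated derivatives of \<open>f\<close> itself.\<close>

lemma generic_coact_iff: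
  assumes f: "f \<in> A"
  shows "coact f \<in> generic Q \<longleftrightarrow> (\<forall>u\<in>lists {..<s}. foldr delta u f \<in> Q)"
  unfolding mem_generic by (simp add: foldr_coact[OF f] eval_one_coact foldr_delta_closed[OF f])

lemma generic_coact_stable_prime:
  assumes Q: "stable_prime Q" and f: "f \<in> Q"
  shows "coact f \<in> generic Q"
proof -
  have "f \<in> A" using Q f prime_mod.P_sub unfolding stable_prime_def by blast
  moreover have "foldr delta u f \<in> Q" if "u \<in> lists {..<s}" for u
    using that by (induction u) (use Q f in \<open>auto simp: stable_prime_def\<close>)
  ultimately show ?thesis by (simp add: generic_coact_iff)
qed

lemma generic_mono: "P \<subseteq> Q \<Longrightarrow> generic P \<subseteq> generic Q"
  unfolding mem_generic subset_iff by blast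

abbreviation generic_cl :: "'k mpoly set \<Rightarrow> 'k mpoly set \<Rightarrow> 'k mpoly set" where
  "generic_cl Q S \<equiv> prime_mod.cl UNIV (generic Q) A S"

end

section \<open>Dependence among the matrix entries at different primes\<close>

context linear_action
begin

text \<open>Iterated \<open>ydelta\<close> is linear over \<open>A\<close>, and the derivatives of
  the \<open>b i\<close> at \<open>Y = 1\<close> are scalars. So each derivative of the sum at
  \<open>Y = 1\<close> is a combination of the \<open>a i\<close> over \<open>k\<close>, with which
  the linear \<open>\<phi>\<close> commutes.\<close>

lemma functional_transfer:
  fixes \<phi> :: "'k mpoly \<Rightarrow> 'k"
  assumes \<phi>: "\<And>a b. \<phi> (a + b) = \<phi> a + \<phi> b" "\<And>k a. \<phi> (mpoly_const k * a) = k * \<phi> a"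
    and ab: "\<And>i. i \<in> I \<Longrightarrow> a i \<in> A" "\<And>i. i \<in> I \<Longrightarrow> b i \<in> Y_polys"
  shows "mpoly_const (\<phi> (eval_one (foldr ydelta w (\<Sum>i\<in>I. a i * b i)))) =
    eval_one (foldr ydelta w (\<Sum>i\<in>I. mpoly_const (\<phi> (a i)) * b i))"
proof -
  have \<phi>0: "\<phi> 0 = 0" using \<phi>(1)[of 0 0] by simp
  have \<phi>_sum: "\<phi> (\<Sum>i\<in>I. f i) = (\<Sum>i\<in>I. \<phi> (f i))" for f
    by (induction I rule: infinite_finite_induct) (simp_all add: \<phi> \<phi>0)
  have "\<forall>i\<in>I. \<exists>k. eval_one (foldr ydelta w (b i)) = mpoly_const k"
    using Y_polys_eval_one[OF Y_polys_foldr[OF ab(2)]] by (auto simp: const_polys_def)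
  then obtain k where k: "\<And>i. i \<in> I \<Longrightarrow> eval_one (foldr ydelta w (b i)) = mpoly_const (k i)"
    by metis
  have E1: "eval_one (foldr ydelta w (\<Sum>i\<in>I. a i * b i)) = (\<Sum>i\<in>I. mpoly_const (k i) * a i)"
    unfolding foldr_ydelta(4) eval_one_simps
    by (rule sum.cong) (simp_all add: foldr_ydelta_A_mult ab k eval_one_A)
  have E2: "eval_one (foldr ydelta w (\<Sum>i\<in>I. mpoly_const (\<phi> (a i)) * b i)) =
      (\<Sum>i\<in>I. mpoly_const (\<phi> (a i) * k i))"
    unfolding foldr_ydelta(4) eval_one_simps
    by (rule sum.cong) (simp_all add: foldr_ydelta_A_mult k mpoly_const_hom)
  show ?thesis unfolding E1 E2 \<phi>_sum \<phi> mpoly_const_sum by (simp add: mult.commute)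
qed

text \<open>A linear functional on \<open>A\<close> that vanishes on \<open>Q\<close>, applied to the coefficients, turns a relation
  modulo \<open>generic Q\<close> into one over \<open>k\<close>, which then holds modulo every \<open>generic P\<close>.\<close>

lemma generic_cl_specialize:
  assumes Q: "prime_mod A Q" and P: "prime_mod A P" and U: "U \<subseteq> Ys" and y: "y \<in> Ys"
    and yU: "y \<in> generic_cl Q U"
  shows "y \<in> generic_cl P U"
proof -
  interpret Q: prime_mod A Q by fact
  interpret GQ: prime_mod UNIV "generic Q" by (rule prime_generic[OF Q])
  interpret GP: prime_mod UNIV "generic P" by (rule prime_generic[OF P])
  obtain d g where g: "\<forall>n\<le>d. g n \<in> subring_gen (A \<union> U)" "\<exists>n\<le>d. g n \<notin> generic Q"
    and gy: "(\<Sum>n\<le>d. g n * y ^ n) \<in> generic Q"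
    using yU unfolding GQ.cl_def GQ.alg_def by blast
  \<comment> \<open>A triple \<open>t\<close> packs the length of a decomposition of
    \<open>g n\<close> with its coefficients in \<open>A\<close> and its factors in
    \<open>subring_gen U\<close>, so that one choice serves for all three.\<close>
  define ok where "ok n t \<longleftrightarrow> (\<forall>i<fst t. fst (snd t) i \<in> A \<and> snd (snd t) i \<in> subring_gen U) \<and>
      g n = (\<Sum>i<fst t. fst (snd t) i * snd (snd t) i)" for n and t :: "nat \<times> (nat \<Rightarrow> 'k mpoly) \<times> (nat \<Rightarrow> 'k mpoly)"
  have "\<exists>t. ok n t" if n: "n \<le> d" for n
  proof -
    have "g n \<in> subring_gen (A \<union> U)" using g(1) n by blast
    from subring_gen_sumE[OF A_ring this] obtain N :: nat and a b where
      "\<forall>i<N. a i \<in> A \<and> b i \<in> subring_gen U" "g n = (\<Sum>i<N. a i * b i)" by blast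
    then have "ok n (N, a, b)" by (simp add: ok_def)
    then show ?thesis by blast
  qed
  then obtain t where t: "\<And>n. n \<le> d \<Longrightarrow> ok n (t n)" by metis
  define N a b where "N n = fst (t n)" and "a n = fst (snd (t n))" and "b n = snd (snd (t n))" for n
  have ab: "\<And>n i. n \<le> d \<Longrightarrow> i < N n \<Longrightarrow> a n i \<in> A \<and> b n i \<in> subring_gen U"
    and g_eq: "\<And>n. n \<le> d \<Longrightarrow> g n = (\<Sum>i<N n. a n i * b n i)"
    using t by (auto simp: ok_def N_def a_def b_def)
  have UKY: "subring_gen U \<subseteq> Y_polys" unfolding Y_polys_def using U by (intro subring_gen_mono) auto
  have yKY: "y \<in> Y_polys" unfolding Y_polys_def using y by (intro subring_gen.base) auto
  have Y_polysr: "unital_subring Y_polys" by (simp add: Y_polys_def)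
  obtain n0 where n0: "n0 \<le> d" "g n0 \<notin> generic Q" using g by blast
  obtain u where u: "u \<in> lists {..<s}" "eval_one (foldr ydelta u (g n0)) \<notin> Q"
    using n0 unfolding mem_generic by blast
  \<comment> \<open>Being nonzero on one derivative of the coefficient \<open>g n0\<close> keeps the
    new coefficient \<open>G n0\<close> nontrivial: that derivative becomes a nonzero scalar, which
    lies in no prime.\<close>
  obtain \<phi> :: "'k mpoly \<Rightarrow> 'k" where \<phi>: "\<And>a b. \<phi> (a + b) = \<phi> a + \<phi> b"
    "\<And>c a. \<phi> (mpoly_const c * a) = c * \<phi> a" "\<And>a. a \<in> Q \<Longrightarrow> \<phi> a = 0"
    "\<phi> (eval_one (foldr ydelta u (g n0))) \<noteq> 0"
    by (rule linear_functional_separating[OF Q.P_zero Q.P_add Q.P_mult u(2)]) auto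
  define G where "G n = (\<Sum>i<N n. mpoly_const (\<phi> (a n i)) * b n i)" for n
  have transfer: "mpoly_const (\<phi> (eval_one (foldr ydelta w (g n * y ^ m)))) =
      eval_one (foldr ydelta w (G n * y ^ m))" if n: "n \<le> d" for n m w
  proof -
    have "mpoly_const (\<phi> (eval_one (foldr ydelta w (\<Sum>i<N n. a n i * (b n i * y ^ m))))) =
      eval_one (foldr ydelta w (\<Sum>i<N n. mpoly_const (\<phi> (a n i)) * (b n i * y ^ m)))"
    proof (rule functional_transfer[OF \<phi>(1,2)])
      fix i assume "i \<in> {..<N n}"
      then have i: "a n i \<in> A" "b n i \<in> Y_polys" using ab[OF n, of i] UKY by auto
      show "a n i \<in> A" by (rule i)
      show "b n i * y ^ m \<in> Y_polys" using i(2) yKY by (intro unital_subringD(4,7)[OF Y_polysr])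
    qed
    then show ?thesis by (simp add: g_eq[OF n] G_def sum_distrib_right mult.assoc)
  qed
  have \<phi>0: "\<phi> 0 = 0" using \<phi>(1)[of 0 0] by simp
  have \<phi>_sum: "\<phi> (\<Sum>i\<le>e. f i) = (\<Sum>i\<le>e. \<phi> (f i))" for f and e :: nat
    by (induction e) (simp_all add: \<phi>)
  have "(\<Sum>n\<le>d. G n * y ^ n) \<in> generic P"
    unfolding mem_generic
  proof
    fix w assume w: "w \<in> lists {..<s}"
    have "eval_one (foldr ydelta w (\<Sum>n\<le>d. G n * y ^ n)) =
        (\<Sum>n\<le>d. mpoly_const (\<phi> (eval_one (foldr ydelta w (g n * y ^ n)))))"
      unfolding foldr_ydelta(4) eval_one_simps by (rule sum.cong) (simp_all add: transfer)
    also have "\<dots> = mpoly_const (\<phi> (eval_one (foldr ydelta w (\<Sum>n\<le>d. g n * y ^ n))))"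
      unfolding foldr_ydelta(4) eval_one_simps by (simp add: \<phi>_sum mpoly_const_sum)
    also have "\<phi> (eval_one (foldr ydelta w (\<Sum>n\<le>d. g n * y ^ n))) = 0"
      using gy w unfolding mem_generic by (intro \<phi>(3)) blast
    finally show "eval_one (foldr ydelta w (\<Sum>n\<le>d. G n * y ^ n)) \<in> P" by (simp add: prime_mod.P_zero[OF P])
  qed
  moreover have "G n0 \<notin> generic P"
  proof -
    have "eval_one (foldr ydelta u (G n0)) = mpoly_const (\<phi> (eval_one (foldr ydelta u (g n0))))"
      using transfer[OF n0(1), of u 0] by simp
    then have "eval_one (foldr ydelta u (G n0)) \<notin> P" using const_notin_prime[OF P] \<phi>(4) by simp
    then show ?thesis using u(1) unfolding mem_generic by blast
  qed
  moreover have "G n \<in> subring_gen (A \<union> U)" if "n \<le> d" for n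
  proof -
    have "subring_gen U \<subseteq> subring_gen (A \<union> U)" by (rule subring_gen_mono) auto
    then have "b n i \<in> subring_gen (A \<union> U)" if "i < N n" for i using ab[OF \<open>n \<le> d\<close> that] by blast
    moreover have "mpoly_const k \<in> subring_gen (A \<union> U)" for k by (rule subring_gen.base) simp
    ultimately show ?thesis unfolding G_def
      by (auto intro!: unital_subring_sum[OF unital_subring_gen] subring_gen.mult)
  qed
  ultimately show ?thesis unfolding GP.cl_def GP.alg_def using n0(1) by blast
qed

text \<open>Rationality without fraction fields: the premise says that \<open>a / b\<close> is a
  constant, the conclusion is an equation of \<open>a / b\<close> over \<open>k\<close>, multiplied
  by \<open>b ^ d\<close>.\<close>

definition algebraic_constants :: "'k mpoly set \<Rightarrow> bool" where
  "algebraic_constants P \<longleftrightarrow> (\<forall>a\<in>A. \<forall>b\<in>A. b \<notin> P \<longrightarrow> (\<forall>i<s. b * delta i a - a * delta i b \<in> P) \<longrightarrow>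
    (\<exists>d \<kappa>. (\<exists>t\<le>d. \<kappa> t \<noteq> 0) \<and> (\<Sum>t\<le>d. mpoly_const (\<kappa> t) * a ^ t * b ^ (d - t)) \<in> P))"

text \<open>The quotients \<open>a j / e\<close> only exist after localizing at \<open>P\<close>; this is where the field of
  fractions of the polynomial type is needed.\<close>

lemma algebraic_over_constant_ratios:
  assumes P: "prime_mod A P" and F: "F \<subseteq> A" and e: "e \<in> A" "e \<notin> P" and J: "finite J"
    and a: "\<And>j. j \<in> J \<Longrightarrow> a j \<in> A"
    and alg: "\<And>j. j \<in> J \<Longrightarrow> \<exists>d \<kappa>. (\<exists>t\<le>d. \<kappa> t \<noteq> 0) \<and>
      (\<Sum>t\<le>d. mpoly_const (\<kappa> t) * a j ^ t * e ^ (d - t)) \<in> P"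
    and x: "x \<in> A" and h: "\<And>j. j \<in> J \<Longrightarrow> b j \<in> subring_gen F"
    and rel: "(\<Sum>n\<le>d. (\<Sum>j\<in>{j\<in>J. dg j = n}. a j * b j) * x ^ n) \<in> P"
    and nontriv: "\<exists>n\<le>d. (\<Sum>j\<in>{j\<in>J. dg j = n}. a j * b j) \<notin> P"
  shows "prime_mod.alg P (subring_gen (const_polys \<union> F)) x"
proof -
  interpret prime_mod A P by fact
  let ?R = "localized A P A" and ?P = "localized A P P"
  interpret L: prime_mod ?R ?P by (rule prime_mod_localized[OF P])
  define emb :: "'k mpoly \<Rightarrow> 'k mpoly fract" where "emb f = Fract f 1" for f
  have emb: "emb (f + g) = emb f + emb g" "emb (f * g) = emb f * emb g" "emb (f - g) = emb f - emb g"
    "emb 1 = 1" "emb 0 = 0" "emb (f ^ n) = emb f ^ n" for f g n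
    by (simp_all add: emb_def diff_fract One_fract_def Zero_fract_def Fract_power)
  have one: "1 \<in> A" "1 \<notin> P" using unital_subringD(1)[OF A_ring] P_one by auto
  have embR: "emb f \<in> ?R" if "f \<in> A" for f
    unfolding emb_def localized_def using that one by blast
  have embP: "emb f \<in> ?P \<longleftrightarrow> f \<in> P" if "f \<in> A" for f
    unfolding emb_def by (rule Fract_in_localized_P_iff[OF P that one])
  have e0: "e \<noteq> 0" using e P_zero by blast
  let ?B = "emb ` subring_gen (const_polys \<union> F)"
  have KF: "subring_gen (const_polys \<union> F) \<subseteq> A" using F const_polys_sub_A by (intro subring_gen_least[OF A_ring]) auto
  have B_eq: "?B = subring_gen (emb ` (const_polys \<union> F))"
    by (rule subring_gen_image[symmetric]) (simp_all add: emb)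
  have B: "unital_subring ?B" "?B \<subseteq> ?R"
  proof -
    show "unital_subring ?B" by (simp only: B_eq unital_subring_gen)
    show "?B \<subseteq> ?R" using KF embR by blast
  qed
  have powA: "f ^ n \<in> A" if "f \<in> A" for f n using unital_subringD(7)[OF A_ring that] .
  \<comment> \<open>These constants are algebraic over \<open>k\<close> by \<open>alg\<close>.
    Adjoined to the base, they contain the coefficients of the relation divided by \<open>e\<close>;
    transitivity of algebraicity removes them again.\<close>
  define C where "C = (\<lambda>j. Fract (a j) e) ` J"
  have CR: "C \<subseteq> ?R" using a e unfolding C_def localized_def by blast
  have C_alg: "L.alg ?B y" if "y \<in> C" for y
  proof -
    from that obtain j where j: "j \<in> J" "y = Fract (a j) e" unfolding C_def by blast
    obtain m \<kappa> where \<kappa>: "\<exists>t\<le>m. \<kappa> t \<noteq> 0"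
      "(\<Sum>t\<le>m. mpoly_const (\<kappa> t) * a j ^ t * e ^ (m - t)) \<in> P" using alg[OF j(1)] by blast
    have "(\<Sum>t\<le>m. emb (mpoly_const (\<kappa> t)) * y ^ t) =
        (\<Sum>t\<le>m. Fract (mpoly_const (\<kappa> t) * a j ^ t * e ^ (m - t)) (e ^ m))"
    proof (rule sum.cong[OF refl])
      fix t assume "t \<in> {..m}"
      then have em: "e ^ m = e ^ t * e ^ (m - t)" by (simp flip: power_add)
      show "emb (mpoly_const (\<kappa> t)) * y ^ t = Fract (mpoly_const (\<kappa> t) * a j ^ t * e ^ (m - t)) (e ^ m)"
        unfolding em using e0 by (simp add: j(2) emb_def Fract_power eq_fract algebra_simps)
    qed
    also have "\<dots> = Fract (\<Sum>t\<le>m. mpoly_const (\<kappa> t) * a j ^ t * e ^ (m - t)) (e ^ m)"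
      using e0 by (intro sum_Fract_same_den) simp
    also have "\<dots> \<in> ?P"
      using \<kappa>(2) powA[OF e(1)] P_power[OF e(1)] e(2) P_sub
      by (subst Fract_in_localized_P_iff[OF P]) auto
    finally have "(\<Sum>t\<le>m. emb (mpoly_const (\<kappa> t)) * y ^ t) \<in> ?P" .
    moreover have "emb (mpoly_const k) \<in> ?B" for k
      by (intro imageI subring_gen.base) (simp add: const_polys_def)
    moreover obtain t where "t \<le> m" "\<kappa> t \<noteq> 0" using \<kappa>(1) by blast
    moreover from this have "emb (mpoly_const (\<kappa> t)) \<notin> ?P"
      using embP[of "mpoly_const (\<kappa> t)"] const_notin_prime[OF P] by simp
    ultimately show ?thesis unfolding L.alg_def
      by (intro exI[of _ m] exI[of _ "\<lambda>t. emb (mpoly_const (\<kappa> t))"]) blast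
  qed
  define G where "G n = (\<Sum>j\<in>{j\<in>J. dg j = n}. a j * b j)" for n
  have bA: "b j \<in> A" if "j \<in> J" for j
    using h[OF that] F subring_gen_least[OF A_ring, of F] by blast
  have GA: "G n \<in> A" for n
    unfolding G_def by (intro unital_subring_sum[OF A_ring] unital_subringD(4)[OF A_ring]) (auto simp: a bA)
  have G: "Fract (G n) e \<in> subring_gen (?B \<union> C)" for n
  proof -
    have "Fract (G n) e = (\<Sum>j\<in>{j\<in>J. dg j = n}. Fract (a j * b j) e)"
      unfolding G_def using e0 by (simp add: sum_Fract_same_den)
    also have "\<dots> = (\<Sum>j\<in>{j\<in>J. dg j = n}. emb (b j) * Fract (a j) e)"
      by (simp add: emb_def mult.commute)
    also have "\<dots> \<in> subring_gen (?B \<union> C)"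
    proof (intro unital_subring_sum[OF unital_subring_gen] subring_gen.mult)
      fix j assume j: "j \<in> {j \<in> J. dg j = n}"
      have "b j \<in> subring_gen (const_polys \<union> F)" using h j subring_gen_mono[of F "const_polys \<union> F"] by blast
      then show "emb (b j) \<in> subring_gen (?B \<union> C)" by (intro subring_gen.base) blast
      show "Fract (a j) e \<in> subring_gen (?B \<union> C)" using j by (intro subring_gen.base) (auto simp: C_def)
    qed
    finally show ?thesis .
  qed
  have "(\<Sum>n\<le>d. Fract (G n) e * emb x ^ n) = Fract (\<Sum>n\<le>d. G n * x ^ n) e"
    using e0 by (simp add: emb_def Fract_power sum_Fract_same_den)
  moreover have "(\<Sum>n\<le>d. G n * x ^ n) \<in> P" using rel by (simp add: G_def)
  then have "Fract (\<Sum>n\<le>d. G n * x ^ n) e \<in> ?P" unfolding localized_def using e by blast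
  moreover obtain n where "n \<le> d" "G n \<notin> P" using nontriv unfolding G_def by blast
  moreover from this have "Fract (G n) e \<notin> ?P" using Fract_in_localized_P_iff[OF P GA e] by blast
  ultimately have "L.alg (subring_gen (?B \<union> C)) (emb x)" unfolding L.alg_def using G
    by (intro exI[of _ d] exI[of _ "\<lambda>n. Fract (G n) e"]) auto
  then have "L.alg ?B (emb x)" using L.alg_trans[OF B CR C_alg embR[OF x]] by blast
  then obtain m p where p: "\<forall>i\<le>m. p i \<in> ?B" "\<exists>i\<le>m. p i \<notin> ?P" "(\<Sum>i\<le>m. p i * emb x ^ i) \<in> ?P"
    unfolding L.alg_def by blast
  have "\<forall>i\<in>{..m}. \<exists>q. q \<in> subring_gen (const_polys \<union> F) \<and> p i = emb q" using p(1) by blast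
  then obtain q where q: "\<And>i. i \<le> m \<Longrightarrow> q i \<in> subring_gen (const_polys \<union> F)" "\<And>i. i \<le> m \<Longrightarrow> p i = emb (q i)"
    by (metis atMost_iff)
  have emb_sum: "emb (\<Sum>i\<le>(k::nat). f i) = (\<Sum>i\<le>k. emb (f i))" for f k
    by (induction k) (simp_all add: emb)
  have eq: "(\<Sum>i\<le>m. p i * emb x ^ i) = emb (\<Sum>i\<le>m. q i * x ^ i)"
    unfolding emb_sum by (rule sum.cong) (simp_all add: emb q(2))
  have qA: "q i \<in> A" if "i \<le> m" for i using q(1)[OF that] KF by blast
  have "(\<Sum>i\<le>m. q i * x ^ i) \<in> A" using qA x
    by (intro unital_subring_sum[OF A_ring] unital_subringD(4)[OF A_ring] powA) auto
  then have "(\<Sum>i\<le>m. q i * x ^ i) \<in> P" using p(3) embP unfolding eq by simp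
  moreover obtain i where i: "i \<le> m" "p i \<notin> ?P" using p(2) by blast
  then have "q i \<notin> P" using q(2)[OF i(1)] embP[OF qA[OF i(1)]] by simp
  ultimately show ?thesis unfolding alg_def using q(1) i(1)
    by (intro exI[of _ m] exI[of _ q]) blast
qed

end

section \<open>From rationality to local closedness\<close>

context linear_action
begin

lemma eval_one_foldr_coact_sum:
  assumes "\<And>j. j \<in> J \<Longrightarrow> a j \<in> A" "\<And>j. j \<in> J \<Longrightarrow> f j \<in> A"
  shows "eval_one (foldr ydelta u (\<Sum>j\<in>J. a j * coact (f j))) = (\<Sum>j\<in>J. a j * foldr delta u (f j))"
  unfolding foldr_ydelta(4) eval_one_simps
  by (rule sum.cong)
    (simp_all add: assms foldr_ydelta_A_mult foldr_coact eval_one_A eval_one_coact foldr_delta_closed)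

text \<open>A relation over \<open>A\<close> along the generic orbit is a relation that holds
  between the products \<open>b j * x ^ n\<close> and simultaneously between all their iterated
  derivatives. Made minimal, it has constant coefficient ratios. Rationality makes these algebraic
  over \<open>k\<close>, and the undifferentiated relation then makes \<open>x\<close> algebraic
  over \<open>k\<close> and \<open>F\<close>.\<close>

lemma alg_descent:
  assumes P: "stable_prime P" and rat: "algebraic_constants P" and F: "F \<subseteq> A" and x: "x \<in> A"
    and xc: "coact x \<in> generic_cl P (coact ` F)"
  shows "prime_mod.alg P (subring_gen (const_polys \<union> F)) x"
proof -
  have P': "prime_mod A P" and stable: "\<And>i f. i \<in> {..<s} \<Longrightarrow> f \<in> P \<Longrightarrow> delta i f \<in> P"
    using P by (auto simp: stable_prime_def)
  interpret prime_mod A P by (rule P')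
  interpret GP: prime_mod UNIV "generic P" by (rule prime_generic[OF P'])
  obtain d g where g: "\<forall>n\<le>d. g n \<in> subring_gen (A \<union> coact ` F)" "\<exists>n\<le>d. g n \<notin> generic P"
    and gx: "(\<Sum>n\<le>d. g n * coact x ^ n) \<in> generic P"
    using xc unfolding GP.cl_def GP.alg_def by blast
  define ok where "ok n t \<longleftrightarrow> (\<forall>i<fst t. fst (snd t) i \<in> A \<and> snd (snd t) i \<in> subring_gen F) \<and>
      g n = (\<Sum>i<fst t. fst (snd t) i * coact (snd (snd t) i))"
    for n and t :: "nat \<times> (nat \<Rightarrow> 'k mpoly) \<times> (nat \<Rightarrow> 'k mpoly)"
  have "\<exists>t. ok n t" if n: "n \<le> d" for n
  proof -
    have "g n \<in> subring_gen (A \<union> coact ` F)" using g(1) n by blast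
    from subring_gen_sumE[OF A_ring this] obtain N :: nat and a b where
      ab: "\<forall>i<N. a i \<in> A \<and> b i \<in> subring_gen (coact ` F)" "g n = (\<Sum>i<N. a i * b i)" by blast
    have "\<forall>i\<in>{..<N}. \<exists>b'. b' \<in> subring_gen F \<and> b i = coact b'"
      using ab(1) subring_gen_image[of coact F] by auto
    then obtain b' where b': "\<And>i. i < N \<Longrightarrow> b' i \<in> subring_gen F" "\<And>i. i < N \<Longrightarrow> b i = coact (b' i)"
      by (metis lessThan_iff)
    then have "ok n (N, a, b')" using ab by (simp add: ok_def)
    then show ?thesis by blast
  qed
  then obtain t where t: "\<And>n. n \<le> d \<Longrightarrow> ok n (t n)" by metis
  define a0 where "a0 j = fst (snd (t (fst j))) (snd j)" for j :: "nat \<times> nat"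
  define b where "b j = snd (snd (t (fst j))) (snd j)" for j :: "nat \<times> nat"
  \<comment> \<open>A pair \<open>(n, i)\<close> stands for the \<open>i\<close>-th summand of the
    coefficient of \<open>coact x ^ n\<close>.\<close>
  define J where "J = (SIGMA n:{..d}. {..<fst (t n)})"
  have J: "finite J" by (simp add: J_def)
  have fstJ: "j \<in> J \<Longrightarrow> fst j \<le> d" for j by (auto simp: J_def)
  have FA: "subring_gen F \<subseteq> A" by (rule subring_gen_least[OF A_ring F])
  have a0A: "a0 j \<in> A" and bF: "b j \<in> subring_gen F" if "j \<in> J" for j
    using that t[of "fst j"] by (auto simp: J_def a0_def b_def ok_def)
  have bA: "b j \<in> A" if "j \<in> J" for j using bF[OF that] FA by blast
  have g_eq: "g n = (\<Sum>j\<in>{j\<in>J. fst j = n}. a0 j * coact (b j))" if n: "n \<le> d" for n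
  proof -
    have "{j\<in>J. fst j = n} = (\<lambda>i. (n, i)) ` {..<fst (t n)}" using n by (auto simp: J_def)
    moreover have "inj_on (\<lambda>i. (n, i)) {..<fst (t n)}" by (auto simp: inj_on_def)
    ultimately have "(\<Sum>j\<in>{j\<in>J. fst j = n}. a0 j * coact (b j)) =
        (\<Sum>i<fst (t n). a0 (n, i) * coact (b (n, i)))" by (simp add: sum.reindex)
    then show ?thesis using t[OF n] by (simp add: ok_def a0_def b_def)
  qed
  have group: "(\<Sum>n\<le>d. \<Sum>j\<in>{j\<in>J. fst j = n}. h j) = (\<Sum>j\<in>J. h j)" for h :: "nat \<times> nat \<Rightarrow> 'k mpoly"
    using J fstJ by (intro sum.group) auto
  define f where "f j = b j * x ^ fst j" for j
  have xn: "x ^ n \<in> A" for n using unital_subringD(7)[OF A_ring x] .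
  have fA: "f j \<in> A" if "j \<in> J" for j
    unfolding f_def by (rule unital_subringD(4)[OF A_ring bA[OF that] xn])
  \<comment> \<open>\<open>Rel\<close> says that the \<open>f j\<close>, weighted by
    \<open>v\<close>, cancel along the whole orbit. \<open>Tr\<close> says that the coefficient of
    each single power of \<open>x\<close> vanishes along the orbit, so that nothing is learned about
    \<open>x\<close>.\<close>
  define Rel where "Rel v \<longleftrightarrow> (\<forall>j\<in>J. v j \<in> A) \<and>
      (\<forall>u\<in>lists {..<s}. (\<Sum>j\<in>J. v j * foldr delta u (f j)) \<in> P)" for v
  define Tr where "Tr v \<longleftrightarrow> (\<forall>n\<le>d. \<forall>u\<in>lists {..<s}.
      (\<Sum>j\<in>{j\<in>J. fst j = n}. v j * foldr delta u (b j)) \<in> P)" for v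
  have Rel_a0: "Rel a0"
  proof -
    have "(\<Sum>n\<le>d. g n * coact x ^ n) = (\<Sum>n\<le>d. \<Sum>j\<in>{j\<in>J. fst j = n}. a0 j * coact (f j))"
      by (rule sum.cong[OF refl]) (simp add: g_eq f_def sum_distrib_right mult.assoc)
    also have "\<dots> = (\<Sum>j\<in>J. a0 j * coact (f j))" by (rule group)
    finally have "(\<Sum>j\<in>J. a0 j * coact (f j)) \<in> generic P" using gx by simp
    then show ?thesis unfolding Rel_def mem_generic
      using a0A by (simp add: eval_one_foldr_coact_sum[OF a0A fA])
  qed
  have nTr: "\<not> Tr a0"
  proof
    assume tr: "Tr a0"
    obtain n where n: "n \<le> d" "g n \<notin> generic P" using g by blast
    have "eval_one (foldr ydelta u (g n)) \<in> P" if "u \<in> lists {..<s}" for u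
    proof -
      have "eval_one (foldr ydelta u (g n)) = (\<Sum>j\<in>{j\<in>J. fst j = n}. a0 j * foldr delta u (b j))"
        unfolding g_eq[OF n(1)] by (rule eval_one_foldr_coact_sum) (auto simp: a0A bA)
      then show ?thesis using tr n(1) that unfolding Tr_def by simp
    qed
    then show False using n(2) unfolding mem_generic by blast
  qed
  have M_diff: "Rel (\<lambda>j. v j - w j)" if "Rel v" "Rel w" for v w
    using that unfolding Rel_def
    by (auto simp: left_diff_distrib sum_subtractf intro: P_diff unital_subringD(3)[OF A_ring])
  have M_scale: "Rel (\<lambda>j. r * v j)" if "Rel v" "r \<in> A" for v r
    using that unfolding Rel_def
    by (auto simp: mult.assoc sum_distrib_left[symmetric] intro: P_mult unital_subringD(4)[OF A_ring])
  have M_D: "Rel (\<lambda>j. delta i (v j))" if v: "Rel v" and i: "i \<in> {..<s}" for v i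
    unfolding Rel_def
  proof (intro conjI ballI)
    show "delta i (v j) \<in> A" if "j \<in> J" for j using v that by (auto simp: Rel_def delta_closed)
    fix u assume u: "u \<in> lists {..<s}"
    have "delta i (\<Sum>j\<in>J. v j * foldr delta u (f j)) - (\<Sum>j\<in>J. v j * foldr delta (i # u) (f j)) \<in> P"
      using v u i by (intro P_diff stable) (auto simp: Rel_def simp del: foldr_Cons)
    also have "delta i (\<Sum>j\<in>J. v j * foldr delta u (f j)) - (\<Sum>j\<in>J. v j * foldr delta (i # u) (f j)) =
        (\<Sum>j\<in>J. delta i (v j) * foldr delta u (f j))"
      by (simp add: deltaD sum.distrib)
    finally show "(\<Sum>j\<in>J. delta i (v j) * foldr delta u (f j)) \<in> P" .
  qed
  have M_cancel: "Tr v" if v: "Rel v" and w: "Tr w" and r: "r \<in> A" "r \<notin> P" "r' \<in> A"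
    and tr: "Tr (\<lambda>j. r * v j - r' * w j)" for v w r and r' :: "'k mpoly"
    unfolding Tr_def
  proof (intro allI impI ballI)
    fix n u assume n: "n \<le> d" and u: "u \<in> lists {..<s}"
    let ?S = "\<lambda>v. \<Sum>j\<in>{j\<in>J. fst j = n}. v j * foldr delta u (b j)"
    have "?S (\<lambda>j. r * v j - r' * w j) = r * ?S v - r' * ?S w"
      by (simp add: left_diff_distrib sum_subtractf sum_distrib_left mult.assoc)
    moreover have "?S (\<lambda>j. r * v j - r' * w j) \<in> P" using tr n u unfolding Tr_def by blast
    moreover have "r' * ?S w \<in> P" using w n u r unfolding Tr_def by (intro P_mult) auto
    ultimately have "r * ?S v \<in> P" using P_add[of "r * ?S v - r' * ?S w" "r' * ?S w"] by simp
    moreover have "?S v \<in> A" using v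
      by (intro unital_subring_sum[OF A_ring] unital_subringD(4)[OF A_ring] foldr_delta_closed)
        (auto simp: Rel_def bA)
    ultimately show "?S v \<in> P" using P_prime r by blast
  qed
  have M_P: "Tr v" if "\<forall>j\<in>J. v j \<in> P" for v
    unfolding Tr_def using that bA by (auto intro!: P_sum P_mult_right foldr_delta_closed)
  have M_A: "v j \<in> A" if "Rel v" "j \<in> J" for v j using that by (simp add: Rel_def)
  have M_closed: "delta i f \<in> A" if "i \<in> {..<s}" "f \<in> A" for i f using that(2) by (rule delta_closed)
  have "\<exists>v j0. Rel v \<and> \<not> Tr v \<and> j0 \<in> J \<and> v j0 \<notin> P \<and>
      (\<forall>i\<in>{..<s}. \<forall>j\<in>J. v j0 * delta i (v j) - v j * delta i (v j0) \<in> P)"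
    by (rule minimal_relation[of J "{..<s}" delta Rel Tr a0])
      (fact J M_closed stable M_A M_diff M_scale M_D M_cancel M_P Rel_a0 nTr)+
  then obtain v j0 where v: "Rel v" "\<not> Tr v" and j0: "j0 \<in> J" "v j0 \<notin> P"
    and ratio: "\<And>i j. i \<in> {..<s} \<Longrightarrow> j \<in> J \<Longrightarrow> v j0 * delta i (v j) - v j * delta i (v j0) \<in> P"
    by blast
  have vA: "v j \<in> A" if "j \<in> J" for j using v(1) that by (simp add: Rel_def)
  have "(\<Sum>j\<in>J. v j * foldr delta [] (f j)) \<in> P" using v(1) unfolding Rel_def by blast
  then have "(\<Sum>n\<le>d. \<Sum>j\<in>{j\<in>J. fst j = n}. v j * f j) \<in> P" by (simp add: group)
  also have "(\<Sum>n\<le>d. \<Sum>j\<in>{j\<in>J. fst j = n}. v j * f j) =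
      (\<Sum>n\<le>d. (\<Sum>j\<in>{j\<in>J. fst j = n}. v j * b j) * x ^ n)"
    by (rule sum.cong[OF refl]) (simp add: f_def sum_distrib_right mult.assoc)
  finally have rel: "(\<Sum>n\<le>d. (\<Sum>j\<in>{j\<in>J. fst j = n}. v j * b j) * x ^ n) \<in> P" .
  obtain n u where n: "n \<le> d" and u: "u \<in> lists {..<s}"
    and nP: "(\<Sum>j\<in>{j\<in>J. fst j = n}. v j * foldr delta u (b j)) \<notin> P"
    using v(2) unfolding Tr_def by blast
  \<comment> \<open>Nontriviality is known only after differentiating by some \<open>u\<close>. As
    the ratios are constants, a coefficient in \<open>P\<close> would keep all its derivatives of
    this form in \<open>P\<close>, so it is nontrivial already undifferentiated.\<close>
  have "(\<Sum>j\<in>{j\<in>J. fst j = n}. v j * b j) \<notin> P"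
  proof
    assume "(\<Sum>j\<in>{j\<in>J. fst j = n}. v j * b j) \<in> P"
    then have "(\<Sum>j\<in>{j\<in>J. fst j = n}. v j * foldr delta u (b j)) \<in> P \<and>
        (\<forall>j\<in>{j\<in>J. fst j = n}. foldr delta u (b j) \<in> A)"
      by (intro constant_ratio_relation[where I = "{..<s}" and e = "v j0"] derivation_delta)
        (use u ratio j0 vA bA stable delta_closed in auto)
    then show False using nP by blast
  qed
  then have "\<exists>n\<le>d. (\<Sum>j\<in>{j\<in>J. fst j = n}. v j * b j) \<notin> P" using n by blast
  moreover have "\<exists>d \<kappa>. (\<exists>t\<le>d. \<kappa> t \<noteq> 0) \<and> (\<Sum>t\<le>d. mpoly_const (\<kappa> t) * v j ^ t * v j0 ^ (d - t)) \<in> P"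
    if "j \<in> J" for j
    using rat vA[OF that] vA[OF j0(1)] j0(2) ratio[OF _ that] unfolding algebraic_constants_def by auto
  ultimately show ?thesis
    using algebraic_over_constant_ratios[OF P' F vA[OF j0(1)] j0(2) J vA _ x bF rel] by blast
qed

text \<open>\<open>Z\<close> is adapted to the orbit map, \<open>U\<close> to the matrix entries.
  Independence of \<open>U\<close> moves from \<open>P\<close> to \<open>Q\<close>, spanning by
  \<open>Z\<close> survives where the chosen coefficients do, and \<open>card Z \<le> card U\<close>
  turns spanning into independence.\<close>

theorem rational_imp_locally_closed:
  assumes P: "stable_prime P" and rat: "algebraic_constants P"
  shows "\<exists>h\<in>A. h \<notin> P \<and> (\<forall>Q. stable_prime Q \<longrightarrow> P \<subset> Q \<longrightarrow> h \<in> Q)"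
proof -
  have P': "prime_mod A P" using P by (simp add: stable_prime_def)
  interpret prime_mod A P by (rule P')
  interpret GP: prime_mod UNIV "generic P" by (rule prime_generic[OF P'])
  let ?V = "mpoly_var ` {..<s} :: 'k mpoly set"
  have fin: "finite Ys" by (simp add: Ys_def)
  have e: "GP.indep A {}" by (simp add: GP.indep_def)
  have "\<exists>I. {} \<subseteq> I \<and> I \<subseteq> coact ` ?V \<and> GP.indep A I \<and> coact ` ?V \<subseteq> generic_cl P I"
    by (rule GP.basis_extension) (simp_all add: e)
  then obtain Z0 where Z0: "Z0 \<subseteq> coact ` ?V" "GP.indep A Z0" "coact ` ?V \<subseteq> generic_cl P Z0" by blast
  have finZ0: "finite Z0" using Z0(1) by (rule finite_subset) simp
  have "\<exists>I. Z0 \<subseteq> I \<and> I \<subseteq> Z0 \<union> Ys \<and> GP.indep A I \<and> Z0 \<union> Ys \<subseteq> generic_cl P I"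
    by (rule GP.basis_extension) (simp_all add: Z0(2) fin finZ0)
  then obtain Z where Z: "Z0 \<subseteq> Z" "Z \<subseteq> Z0 \<union> Ys" "GP.indep A Z" "Z0 \<union> Ys \<subseteq> generic_cl P Z" by blast
  have finZ: "finite Z" using Z(2) by (rule finite_subset) (simp add: fin finZ0)
  \<comment> \<open>This second basis consists of matrix entries only, because these are what
    \<open>generic_cl_specialize\<close> can compare at different primes.\<close>
  have "\<exists>I. {} \<subseteq> I \<and> I \<subseteq> Ys \<and> GP.indep A I \<and> Ys \<subseteq> generic_cl P I"
    by (rule GP.basis_extension) (simp_all add: e fin)
  then obtain U where U: "U \<subseteq> Ys" "GP.indep A U" "Ys \<subseteq> generic_cl P U" by blast
  have finU: "finite U" using U(1) fin by (rule finite_subset)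
  \<comment> \<open>Since \<open>coact\<close> maps \<open>A\<close> into \<open>A[Y]\<close>, all
    of \<open>Z\<close> depends on \<open>Ys\<close> and hence on \<open>U\<close>.\<close>
  have "card Z \<le> card U"
  proof (rule GP.steinitz[OF _ finZ finU Z(3)])
    have "generic_cl P Ys \<subseteq> generic_cl P (generic_cl P U)" by (rule GP.cl_mono[OF U(3)])
    also have "\<dots> \<subseteq> generic_cl P U" by (rule GP.cl_idem) simp_all
    finally have YU: "generic_cl P Ys \<subseteq> generic_cl P U" .
    have "coact ` ?V \<subseteq> subring_gen (A \<union> Ys)" by (auto intro!: coact_in_gen)
    also have "\<dots> \<subseteq> generic_cl P Ys" by (rule GP.cl_gen) simp_all
    finally have "coact ` ?V \<subseteq> generic_cl P U" using YU by (rule subset_trans)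
    then have "Z0 \<subseteq> generic_cl P U" using Z0(1) by (rule subset_trans[rotated])
    then have "Z0 \<union> Ys \<subseteq> generic_cl P U" using U(3) by simp
    then show "Z \<subseteq> generic_cl P U" using Z(2) by (rule subset_trans[rotated])
  qed simp_all
  let ?G = "subring_gen (A \<union> Z)"
  \<comment> \<open>Here \<open>l\<close> is one coefficient of an equation of \<open>y\<close> over
    \<open>Z\<close>; its survival modulo \<open>generic Q\<close> is what keeps that equation
    nontrivial.\<close>
  define rel where "rel y l \<longleftrightarrow> (\<exists>d p. (\<forall>i\<le>d. p i \<in> ?G) \<and> (\<exists>i\<le>d. p i = l) \<and>
      (\<Sum>i\<le>d. p i * y ^ i) \<in> generic P)" for y l
  have "\<exists>l. l \<notin> generic P \<and> rel y l" if y: "y \<in> Ys" for y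
  proof -
    have "GP.alg ?G y" using y Z(4) unfolding GP.cl_def by blast
    then obtain d p i where "\<forall>i\<le>d. p i \<in> ?G" "i \<le> d" "p i \<notin> generic P"
      "(\<Sum>i\<le>d. p i * y ^ i) \<in> generic P" unfolding GP.alg_def by blast
    then have "rel y (p i)" unfolding rel_def by (intro exI[of _ d], intro exI[of _ p]) auto
    then show ?thesis using \<open>p i \<notin> generic P\<close> by blast
  qed
  then obtain l where l: "\<And>y. y \<in> Ys \<Longrightarrow> l y \<notin> generic P" and lrel: "\<And>y. y \<in> Ys \<Longrightarrow> rel y (l y)"
    by metis
  have "prod l Ys \<notin> generic P" using GP.P_prod[OF fin, of l] l by blast
  \<comment> \<open>To be outside \<open>generic P\<close> means that some iterated derivative at
    \<open>Y = 1\<close> is outside \<open>P\<close>; this element of \<open>A\<close> is the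
    required \<open>h\<close>.\<close>
  then obtain u where u: "u \<in> lists {..<s}" "eval_one (foldr ydelta u (prod l Ys)) \<notin> P"
    unfolding mem_generic by blast
  define h where "h = eval_one (foldr ydelta u (prod l Ys))"
  have "h \<in> Q" if gQ: "stable_prime Q" and PQ: "P \<subset> Q" for Q
  proof (rule ccontr)
    assume hQ: "h \<notin> Q"
    have Q': "prime_mod A Q" using gQ by (simp add: stable_prime_def)
    interpret Q: prime_mod A Q by (rule Q')
    interpret GQ: prime_mod UNIV "generic Q" by (rule prime_generic[OF Q'])
    have "prod l Ys \<notin> generic Q" using hQ u(1) unfolding mem_generic h_def by blast
    then have lQ: "l y \<notin> generic Q" if "y \<in> Ys" for y
      using GQ.P_mult_right[of "l y" "prod l (Ys - {y})"] prod.remove[OF fin that, of l] by auto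
    have YZ: "Ys \<subseteq> generic_cl Q Z"
    proof
      fix y assume y: "y \<in> Ys"
      obtain d p where "\<forall>i\<le>d. p i \<in> ?G" "\<exists>i\<le>d. p i = l y" "(\<Sum>i\<le>d. p i * y ^ i) \<in> generic P"
        using lrel[OF y] unfolding rel_def by blast
      moreover have "generic P \<subseteq> generic Q" using PQ by (intro generic_mono) blast
      ultimately have "GQ.alg ?G y" unfolding GQ.alg_def using lQ[OF y]
        by (intro exI[of _ d], intro exI[of _ p]) auto
      then show "y \<in> generic_cl Q Z" by (simp add: GQ.cl_def)
    qed
    have indU: "GQ.indep A U"
      unfolding GQ.indep_def
    proof (intro conjI ballI)
      fix y assume y: "y \<in> U"
      show "y \<notin> generic_cl Q (U - {y})"
        using generic_cl_specialize[OF Q' P', of "U - {y}" y] U y unfolding GP.indep_def by blast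
    qed simp
    \<comment> \<open>If \<open>z\<close> were redundant, \<open>Z - {z}\<close> would span
      \<open>Ys\<close>, hence the independent set \<open>U\<close>, although it has fewer elements
      than \<open>U\<close>.\<close>
    have indZ: "z \<notin> generic_cl Q (Z - {z})" if z: "z \<in> Z" for z
    proof
      assume zc: "z \<in> generic_cl Q (Z - {z})"
      have "Z \<subseteq> generic_cl Q (Z - {z})" using zc GQ.cl_superset[of "Z - {z}" A] by auto
      then have "generic_cl Q Z \<subseteq> generic_cl Q (generic_cl Q (Z - {z}))" by (rule GQ.cl_mono)
      also have "\<dots> \<subseteq> generic_cl Q (Z - {z})" by (rule GQ.cl_idem) auto
      finally have "U \<subseteq> generic_cl Q (Z - {z})" using YZ U(1) by blast
      then have "card U \<le> card (Z - {z})" using finU finZ indU by (intro GQ.steinitz[of A]) auto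
      also have "\<dots> < card Z" using finZ z by (rule card_Diff1_less)
      finally show False using \<open>card Z \<le> card U\<close> by simp
    qed
    obtain F where F: "F \<subseteq> ?V" "inj_on coact F" "Z0 = coact ` F"
      using Z0(1) unfolding subset_image_inj by blast
    have FA: "F \<subseteq> A" using F(1) by auto
    have finF: "finite F" using F(1) by (rule finite_subset) simp
    let ?B = "subring_gen (const_polys \<union> F)"
    have BA: "?B \<subseteq> A" using FA const_polys_sub_A by (intro subring_gen_least[OF A_ring]) auto
    have var_alg: "alg ?B y" if "y \<in> ?V" for y
      using that Z0(3) unfolding F(3) by (intro alg_descent[OF P rat FA]) auto
    have A_alg: "alg ?B a" if a: "a \<in> A" for a
    proof (rule alg_in_gen[OF unital_subring_gen BA _ var_alg])
      have "A \<subseteq> subring_gen (?B \<union> ?V)"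
        unfolding mpolys_eq_gen const_polys_def by (intro subring_gen_mono) (auto intro: subring_gen.base)
      then show "a \<in> subring_gen (?B \<union> ?V)" using a by blast
    qed auto
    obtain a where a: "a \<in> Q" "a \<notin> P" using PQ by blast
    have aA: "a \<in> A" using a Q.P_sub by blast
    \<comment> \<open>The nonzero element \<open>a\<close> of \<open>Q/P\<close> is algebraic over
      \<open>k[F]\<close>, so it has an equation with constant coefficient outside \<open>P\<close>.
      That coefficient is in \<open>Q\<close>, because all other terms are.\<close>
    obtain q where q: "q \<in> ?B" "q \<notin> P" "q \<in> Q"
    proof -
      obtain d p where p: "\<forall>i\<le>d. p i \<in> ?B" "p 0 \<notin> P" "(\<Sum>i\<le>d. p i * a ^ i) \<in> P"
        by (rule alg_trailing[OF A_alg[OF aA] BA aA a(2)])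
      have "(\<Sum>i\<in>{..d} - {0}. p i * a ^ i) \<in> Q"
      proof (rule Q.P_sum)
        fix i assume i: "i \<in> {..d} - {0}"
        have "a ^ i = a ^ (i - 1) * a" using i by (cases i) auto
        then have "a ^ i \<in> Q" using Q.P_mult[OF unital_subringD(7)[OF A_ring aA] a(1)] by simp
        then show "p i * a ^ i \<in> Q" using p(1) i BA by (intro Q.P_mult) auto
      qed
      moreover have "(\<Sum>i\<le>d. p i * a ^ i) = p 0 + (\<Sum>i\<in>{..d} - {0}. p i * a ^ i)"
        by (subst sum.remove[of _ 0]) auto
      ultimately have "p 0 \<in> Q" using p(3) PQ Q.P_diff[of "\<Sum>i\<le>d. p i * a ^ i" "\<Sum>i\<in>{..d} - {0}. p i * a ^ i"]
        by auto
      then show ?thesis using that p by blast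
    qed
    \<comment> \<open>On the other hand, the images of \<open>F\<close> under \<open>coact\<close>
      are independent modulo \<open>generic Q\<close>, so a polynomial over \<open>k\<close> in
      \<open>F\<close> that lies in \<open>Q\<close> has its coefficients in \<open>Q\<close>, one
      variable after another.\<close>
    have "\<forall>q\<in>subring_gen (const_polys \<union> F'). q \<in> Q \<longrightarrow> q \<in> P" if "finite F'" "F' \<subseteq> F" for F'
      using that
    proof (induction F' rule: finite_induct)
      case empty
      show ?case
      proof (intro ballI impI)
        fix q assume "q \<in> subring_gen (const_polys \<union> {})" "q \<in> Q"
        then obtain k where k: "q = mpoly_const k" "mpoly_const k \<in> Q"
          using subring_gen_self[OF const_polys_ring] by (auto simp: const_polys_def)
        then have "k = 0" using const_notin_prime[OF Q'] by blast
        then show "q \<in> P" using k P_zero by simp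
      qed
    next
      case (insert y F')
      let ?C = "subring_gen (const_polys \<union> F')"
      have CA: "?C \<subseteq> A" using FA const_polys_sub_A insert.prems by (intro subring_gen_least[OF A_ring]) auto
      have yA: "y \<in> A" using insert.prems FA by blast
      show ?case
      proof (intro ballI impI)
        fix q assume q: "q \<in> subring_gen (const_polys \<union> insert y F')" "q \<in> Q"
        have "subring_gen (const_polys \<union> insert y F') \<subseteq> subring_gen (?C \<union> {y})"
          by (rule subring_gen_mono) (auto intro: subring_gen.base)
        then have "q \<in> subring_gen (?C \<union> {y})" using q by blast
        from subring_gen_insert_sum[OF unital_subring_gen this]
        obtain d p where p: "\<forall>i. p i \<in> ?C" "q = (\<Sum>i\<le>d. p i * y ^ i)" by blast
        have "p i \<in> Q" if i: "i \<le> d" for i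
        proof (rule ccontr)
          assume ni: "p i \<notin> Q"
          have pA: "p i \<in> A" for i using p(1) CA by blast
          \<comment> \<open>The empty word suffices: already at \<open>Y = 1\<close> the coefficient
            is nonzero modulo \<open>Q\<close>.\<close>
          have "eval_one (foldr ydelta [] (coact (p i))) \<notin> Q" using ni by (simp add: eval_one_coact[OF pA])
          then have "coact (p i) \<notin> generic Q" unfolding mem_generic by blast
          moreover have "(\<Sum>i\<le>d. coact (p i) * coact y ^ i) \<in> generic Q"
            using generic_coact_stable_prime[OF gQ q(2)] unfolding p(2) by simp
          moreover have "coact (p i) \<in> subring_gen (A \<union> coact ` F')" for i
          proof -
            have "coact (p i) \<in> coact ` subring_gen (const_polys \<union> F')" using p(1) by blast
            also have "\<dots> = subring_gen (coact ` (const_polys \<union> F'))"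
              by (rule subring_gen_image[symmetric]) simp_all
            also have "\<dots> \<subseteq> subring_gen (A \<union> coact ` F')"
              by (rule subring_gen_mono) (auto simp: const_polys_def)
            finally show ?thesis .
          qed
          ultimately have "GQ.alg (subring_gen (A \<union> coact ` F')) (coact y)"
            unfolding GQ.alg_def using i by (intro exI[of _ d], intro exI[of _ "\<lambda>i. coact (p i)"]) auto
          then have "coact y \<in> generic_cl Q (coact ` F')" by (simp add: GQ.cl_def)
          moreover have "coact ` F' \<subseteq> Z - {coact y}"
          proof
            fix z assume "z \<in> coact ` F'"
            then obtain y' where y': "y' \<in> F'" "z = coact y'" by blast
            then have "y' \<in> F" "y' \<noteq> y" using insert by auto
            then have "z \<noteq> coact y" using y' F(2) insert.prems by (auto dest: inj_onD)
            moreover have "z \<in> Z" using \<open>y' \<in> F\<close> y' F(3) Z(1) by auto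
            ultimately show "z \<in> Z - {coact y}" by blast
          qed
          ultimately have "coact y \<in> generic_cl Q (Z - {coact y})" using GQ.cl_mono by blast
          moreover have "coact y \<in> Z" using insert.prems F(3) Z(1) by auto
          ultimately show False using indZ by blast
        qed
        then have "p i \<in> P" if "i \<le> d" for i using insert p(1) that by blast
        then show "q \<in> P" unfolding p(2)
          using yA by (intro P_sum P_mult_right unital_subringD(7)[OF A_ring]) auto
      qed
    qed
    then show False using finF q by blast
  qed
  moreover have "h \<in> A" unfolding h_def by (rule eval_one_in_A)
  moreover have "h \<notin> P" using u(2) by (simp add: h_def)
  ultimately show ?thesis by blast
qed

end

section \<open>The Nullstellensatz\<close>

text \<open>By Zorn: an ideal that is maximal among those containing \<open>J0\<close> and missing
  the multiplicative set \<open>T\<close> is prime.\<close>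

lemma prime_avoiding:
  fixes R J0 T :: "'a::comm_ring_1 set"
  assumes R: "unital_subring R"
    and J0: "J0 \<subseteq> R" "0 \<in> J0" "\<And>a b. a \<in> J0 \<Longrightarrow> b \<in> J0 \<Longrightarrow> a + b \<in> J0"
      "\<And>a b. a \<in> R \<Longrightarrow> b \<in> J0 \<Longrightarrow> a * b \<in> J0"
    and T: "1 \<in> T" "\<And>a b. a \<in> T \<Longrightarrow> b \<in> T \<Longrightarrow> a * b \<in> T" "J0 \<inter> T = {}"
  shows "\<exists>M. prime_mod R M \<and> J0 \<subseteq> M \<and> M \<inter> T = {}"
proof -
  define idl where "idl J \<longleftrightarrow> J \<subseteq> R \<and> 0 \<in> J \<and> (\<forall>a\<in>J. \<forall>b\<in>J. a + b \<in> J) \<and> (\<forall>a\<in>R. \<forall>b\<in>J. a * b \<in> J)" for J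
  define S where "S = {J. idl J \<and> J0 \<subseteq> J \<and> J \<inter> T = {}}"
  have J0S: "J0 \<in> S" using J0 T(3) unfolding S_def idl_def by blast
  have "\<exists>M\<in>S. \<forall>N\<in>S. M \<subseteq> N \<longrightarrow> N = M"
  proof (rule subset_Zorn_nonempty)
    show "S \<noteq> {}" using J0S by blast
    fix C assume C: "C \<noteq> {}" "subset.chain S C"
    have CS: "J \<in> S" if "J \<in> C" for J using C(2) that unfolding subset.chain_def by blast
    have dir: "J \<subseteq> K \<or> K \<subseteq> J" if "J \<in> C" "K \<in> C" for J K
      using C(2) that unfolding subset.chain_def by blast
    have "idl (\<Union>C)" unfolding idl_def
    proof (intro conjI ballI)
      show "\<Union>C \<subseteq> R" using CS unfolding S_def idl_def by blast
      show "0 \<in> \<Union>C" using CS C(1) by (auto simp: S_def idl_def)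
    next
      fix a b assume "a \<in> \<Union>C" "b \<in> \<Union>C"
      then obtain J K where JK: "a \<in> J" "J \<in> C" "b \<in> K" "K \<in> C" by blast
      then consider "a \<in> K" | "b \<in> J" using dir[OF JK(2,4)] by blast
      then show "a + b \<in> \<Union>C"
      proof cases
        case 1
        then have "a + b \<in> K" using JK CS[of K] unfolding S_def idl_def by simp
        then show ?thesis using JK by blast
      next
        case 2
        then have "a + b \<in> J" using JK CS[of J] unfolding S_def idl_def by simp
        then show ?thesis using JK by blast
      qed
    next
      fix a b assume "a \<in> R" "b \<in> \<Union>C"
      then obtain J where J: "b \<in> J" "J \<in> C" by blast
      then have "a * b \<in> J" using CS[of J] \<open>a \<in> R\<close> unfolding S_def idl_def by simp
      then show "a * b \<in> \<Union>C" using J by blast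
    qed
    moreover have "J0 \<subseteq> \<Union>C" using C(1) CS by (auto simp: S_def)
    moreover have "\<Union>C \<inter> T = {}" using CS by (auto simp: S_def)
    ultimately show "\<Union>C \<in> S" by (simp add: S_def)
  qed
  then obtain M where M: "M \<in> S" and max: "\<And>N. N \<in> S \<Longrightarrow> M \<subseteq> N \<Longrightarrow> N = M" by blast
  have Mi: "M \<subseteq> R" "0 \<in> M" "\<And>a b. a \<in> M \<Longrightarrow> b \<in> M \<Longrightarrow> a + b \<in> M"
    "\<And>a b. a \<in> R \<Longrightarrow> b \<in> M \<Longrightarrow> a * b \<in> M" "J0 \<subseteq> M" "M \<inter> T = {}"
    using M by (auto simp: S_def idl_def)
  have ex: "\<exists>m c. m \<in> M \<and> c \<in> R \<and> m + c * a \<in> T" if a: "a \<in> R" "a \<notin> M" for a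
  proof (rule ccontr)
    assume n: "\<not> ?thesis"
    let ?N = "{m + c * a |m c. m \<in> M \<and> c \<in> R}"
    have MN: "M \<subseteq> ?N"
    proof
      fix m assume "m \<in> M"
      then show "m \<in> ?N" using unital_subringD(2)[OF R] by (intro CollectI exI[of _ m] exI[of _ 0]) simp
    qed
    have "idl ?N" unfolding idl_def
    proof (intro conjI ballI)
      show "?N \<subseteq> R" using Mi(1) a(1) by (auto intro!: unital_subringD(4,6)[OF R])
      show "0 \<in> ?N" using MN Mi(2) by blast
    next
      fix y z assume "y \<in> ?N" "z \<in> ?N"
      then obtain m c m' c' where *: "y = m + c * a" "z = m' + c' * a" "m \<in> M" "m' \<in> M" "c \<in> R" "c' \<in> R" by blast
      have "y + z = (m + m') + (c + c') * a" using * by (simp add: algebra_simps)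
      then show "y + z \<in> ?N" using * Mi(3) unital_subringD(6)[OF R] by blast
    next
      fix r y assume "r \<in> R" "y \<in> ?N"
      then obtain m c where *: "y = m + c * a" "m \<in> M" "c \<in> R" by blast
      have "r * y = r * m + (r * c) * a" using * by (simp add: algebra_simps)
      then show "r * y \<in> ?N" using * \<open>r \<in> R\<close> Mi(4) unital_subringD(4)[OF R] by blast
    qed
    moreover have "?N \<inter> T = {}" using n by blast
    moreover have "J0 \<subseteq> ?N" using MN Mi(5) by (rule subset_trans[rotated])
    ultimately have "?N \<in> S" by (simp add: S_def)
    then have "?N = M" using max MN by blast
    moreover have "a \<in> ?N"
      using Mi(2) unital_subringD(1)[OF R] by (intro CollectI exI[of _ 0] exI[of _ 1]) simp
    ultimately show False using a(2) by blast
  qed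
  have "prime_mod R M"
  proof
    show "1 \<notin> M" using Mi(6) T(1) by blast
    fix a b assume ab: "a \<in> R" "b \<in> R" "a * b \<in> M"
    show "a \<in> M \<or> b \<in> M"
    proof (rule ccontr)
      assume "\<not> ?thesis"
      then obtain m c m' c' where *: "m \<in> M" "c \<in> R" "m + c * a \<in> T" "m' \<in> M" "c' \<in> R" "m' + c' * b \<in> T"
        using ex[OF ab(1)] ex[OF ab(2)] by blast
      have eq: "(m + c * a) * (m' + c' * b) = (m + c * a) * m' + ((c' * b) * m + (c * c') * (a * b))"
        by (simp add: algebra_simps)
      have "m + c * a \<in> R" "c' * b \<in> R" "c * c' \<in> R"
        using * ab Mi(1) by (auto intro!: unital_subringD(4,6)[OF R])
      then have "(m + c * a) * m' + ((c' * b) * m + (c * c') * (a * b)) \<in> M"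
        using Mi(3)[OF Mi(4) Mi(3)[OF Mi(4) Mi(4)]] * ab(3) by blast
      then show False using T(2)[OF *(3,6)] Mi(6) unfolding eq by blast
    qed
  qed (use R Mi in auto)
  then show ?thesis using Mi by blast
qed

text \<open>Over the domain \<open>R\<close> modulo \<open>P\<close>, each root splits off a linear
  factor.\<close>

lemma polynomial_roots_bound:
  fixes R P :: "'a::idom set"
  assumes RP: "prime_mod R P" and p: "\<And>i. i \<le> d \<Longrightarrow> p i \<in> R" and T: "T \<subseteq> R" "card T = Suc d"
    and sep: "\<And>t t'. t \<in> T \<Longrightarrow> t' \<in> T \<Longrightarrow> t \<noteq> t' \<Longrightarrow> t - t' \<notin> P"
    and root: "\<And>t. t \<in> T \<Longrightarrow> (\<Sum>i\<le>d. p i * t ^ i) \<in> P"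
  shows "\<forall>i\<le>d. p i \<in> P"
  using p T sep root
proof (induction d arbitrary: p T)
  case 0
  then obtain t where "t \<in> T" by (metis card.empty equals0I nat.distinct(1))
  then show ?case using "0.prems"(5)[of t] by simp
next
  case (Suc d)
  interpret prime_mod R P by (rule RP)
  from Suc.prems(3) obtain t0 T' where T: "T = insert t0 T'" "t0 \<notin> T'" "card T' = Suc d"
    by (metis card_Suc_eq)
  have t0: "t0 \<in> R" using T Suc.prems(2) by blast
  \<comment> \<open>The coefficients of the quotient by the linear factor of \<open>t0\<close>, in
    the form that \<open>polyfun_diff\<close> gives them.\<close>
  define q where "q j = (\<Sum>k=Suc j..Suc d. p k * t0 ^ (k - Suc j))" for j
  have qR: "q j \<in> R" for j
    unfolding q_def using Suc.prems(1) t0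
    by (intro unital_subring_sum[OF R] unital_subringD(4)[OF R] unital_subringD(7)[OF R]) auto
  have qP: "\<forall>i\<le>d. q i \<in> P"
  proof (rule Suc.IH[of q T'])
    fix t assume t: "t \<in> T'"
    have tR: "t \<in> R" using t T Suc.prems(2) by blast
    have "(\<Sum>i\<le>Suc d. p i * t ^ i) - (\<Sum>i\<le>Suc d. p i * t0 ^ i) = (t - t0) * (\<Sum>j<Suc d. q j * t ^ j)"
    proof -
      have "1 \<le> Suc d" by simp
      from polyfun_diff[OF this, of p t t0] show ?thesis
        by (simp only: q_def diff_diff_left Suc_eq_plus1)
    qed
    moreover have "(\<Sum>i\<le>Suc d. p i * t ^ i) - (\<Sum>i\<le>Suc d. p i * t0 ^ i) \<in> P"
      using Suc.prems(5) t T by (intro P_diff) auto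
    ultimately have "(t - t0) * (\<Sum>j<Suc d. q j * t ^ j) \<in> P" by simp
    moreover have "t - t0 \<notin> P" using Suc.prems(4)[of t t0] t T by auto
    moreover have "(\<Sum>j<Suc d. q j * t ^ j) \<in> R"
      using qR tR by (intro unital_subring_sum[OF R] unital_subringD(4)[OF R] unital_subringD(7)[OF R])
    ultimately show "(\<Sum>i\<le>d. q i * t ^ i) \<in> P"
      using P_prime[OF unital_subringD(3)[OF R tR t0]] by (auto simp: lessThan_Suc_atMost)
  qed (use qR Suc.prems T in auto)
  \<comment> \<open>Undoing the division: \<open>p (Suc i)\<close> is
    \<open>q i - t0 * q (Suc i)\<close>.\<close>
  have pq: "p (Suc i) \<in> P" if "i \<le> d" for i
  proof -
    have "q i = p (Suc i) + t0 * q (Suc i)"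
    proof -
      have "{Suc i..Suc d} = insert (Suc i) {Suc (Suc i)..Suc d}" using that by auto
      then have "q i = p (Suc i) + (\<Sum>k=Suc (Suc i)..Suc d. p k * t0 ^ (k - Suc i))"
        unfolding q_def by simp
      also have "(\<Sum>k=Suc (Suc i)..Suc d. p k * t0 ^ (k - Suc i)) = t0 * q (Suc i)"
        unfolding q_def sum_distrib_left
      proof (rule sum.cong[OF refl])
        fix k assume "k \<in> {Suc (Suc i)..Suc d}"
        then have "k - Suc i = Suc (k - Suc (Suc i))" by auto
        then show "p k * t0 ^ (k - Suc i) = t0 * (p k * t0 ^ (k - Suc (Suc i)))" by simp
      qed
      finally show ?thesis .
    qed
    moreover have "q (Suc i) \<in> P"
    proof (cases "Suc i \<le> d")
      case False
      then have "q (Suc i) = 0" using that by (simp add: q_def)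
      then show ?thesis by (simp add: P_zero)
    qed (use qP in blast)
    then have "t0 * q (Suc i) \<in> P" using P_mult t0 by blast
    ultimately show ?thesis using qP that P_add_iff[of "t0 * q (Suc i)" "p (Suc i)"]
      by (metis add.commute)
  qed
  have t0T: "t0 \<in> T" using T by blast
  have "(\<Sum>i\<le>Suc d. p i * t0 ^ i) = p 0 + (\<Sum>i\<le>d. p (Suc i) * t0 ^ Suc i)"
    by (subst sum.atMost_Suc_shift) simp
  moreover have "(\<Sum>i\<le>d. p (Suc i) * t0 ^ Suc i) \<in> P"
    using pq t0 by (intro P_sum P_mult_right unital_subringD(7)[OF R]) auto
  moreover have "(\<Sum>i\<le>Suc d. p i * t0 ^ i) \<in> P" using Suc.prems(5)[OF t0T] .
  ultimately have "p 0 \<in> P"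
    using P_diff[of "\<Sum>i\<le>Suc d. p i * t0 ^ i" "\<Sum>i\<le>d. p (Suc i) * t0 ^ Suc i"] by simp
  then show ?case using pq by (metis Suc_le_mono not0_implies_Suc)
qed

context prime_mod
begin

lemma prime_mod_subring:
  assumes "unital_subring B" "B \<subseteq> R" shows "prime_mod B (P \<inter> B)"
proof
  fix a b assume "a \<in> B" "b \<in> B" "a * b \<in> P \<inter> B"
  then show "a \<in> P \<inter> B \<or> b \<in> P \<inter> B" using P_prime[of a b] assms(2) by blast
qed (use assms P_one P_zero in \<open>auto intro: P_add P_mult unital_subringD(2,4,6)[OF assms(1)]\<close>)

text \<open>\<open>g\<close> is an equation of \<open>x\<close> of least degree \<open>e\<close>.
  Multiplying a relation \<open>h\<close> by \<open>g e\<close> and subtracting a shifted multiple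
  of \<open>g\<close> lowers its degree; the subtracted coefficients are in \<open>M\<close>,
  because the top coefficient of \<open>h\<close> is. Below degree \<open>e\<close>, minimality puts
  the top coefficient into \<open>P\<close>. The use is to show that an extended ideal contracts
  back into \<open>M\<close>.\<close>

lemma pseudo_division:
  assumes B: "unital_subring B" "B \<subseteq> R" and x: "x \<in> R"
    and g: "\<And>i. g i \<in> B" "(\<Sum>i\<le>e. g i * x ^ i) \<in> P"
    and min: "\<And>e' h. e' < e \<Longrightarrow> (\<And>i. h i \<in> B) \<Longrightarrow> (\<Sum>i\<le>e'. h i * x ^ i) \<in> P \<Longrightarrow> h e' \<in> P"
    and M: "prime_mod B M" "P \<inter> B \<subseteq> M" "g e \<notin> M"
    and h: "\<And>i. h i \<in> B" "(\<Sum>i\<le>d. h i * x ^ i) \<in> P" "\<And>i. e \<le> i \<Longrightarrow> i \<le> d \<Longrightarrow> h i \<in> M"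
  shows "\<forall>i\<le>d. h i \<in> M"
  using h
proof (induction d arbitrary: h)
  case 0
  show ?case
  proof (cases "e = 0")
    case True
    then show ?thesis using 0 by simp
  next
    case False
    then have "h 0 \<in> P" using 0 min[of 0 h] by blast
    then show ?thesis using 0 M(2) by auto
  qed
next
  case (Suc d)
  interpret M: prime_mod B M by (rule M(1))
  show ?case
  proof (cases "Suc d < e")
    case True
    have hP: "h (Suc d) \<in> P" using min[OF True Suc.prems(1,2)] .
    then have "h (Suc d) * x ^ Suc d \<in> P" using x by (intro P_mult_right unital_subringD(7)[OF R])
    then have "(\<Sum>i\<le>d. h i * x ^ i) \<in> P"
      using P_diff[OF Suc.prems(2), of "h (Suc d) * x ^ Suc d"] by simp
    then have "\<forall>i\<le>d. h i \<in> M" using Suc.prems True by (intro Suc.IH) auto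
    then show ?thesis using hP Suc.prems(1) M(2) by (auto simp: le_Suc_eq)
  next
    case False
    define m where "m = Suc d - e"
    have m: "Suc d = m + e" using False by (simp add: m_def)
    define h' where "h' i = g e * h i - h (Suc d) * (if m \<le> i \<and> i \<le> m + e then g (i - m) else 0)" for i
    have h'B: "h' i \<in> B" for i unfolding h'_def
      using Suc.prems(1) g(1) by (auto intro!: unital_subringD(2,3,4)[OF B(1)])
    have hd: "h (Suc d) \<in> M" using Suc.prems(3)[of "Suc d"] False by simp
    have "(\<Sum>i\<le>Suc d. (if m \<le> i \<and> i \<le> m + e then g (i - m) else 0) * x ^ i) = (\<Sum>i\<in>{m..m + e}. g (i - m) * x ^ i)"
      using m by (intro sum.mono_neutral_cong_right) auto
    also have "\<dots> = (\<Sum>i\<le>e. g i * x ^ (i + m))"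
      using sum.shift_bounds_cl_nat_ivl[of "\<lambda>i. g (i - m) * x ^ i" 0 m e]
      by (simp add: atMost_atLeast0 add.commute)
    also have "\<dots> = x ^ m * (\<Sum>i\<le>e. g i * x ^ i)" by (simp add: sum_distrib_left power_add mult_ac)
    finally have shift: "(\<Sum>i\<le>Suc d. (if m \<le> i \<and> i \<le> m + e then g (i - m) else 0) * x ^ i) =
        x ^ m * (\<Sum>i\<le>e. g i * x ^ i)" .
    have "(\<Sum>i\<le>Suc d. h' i * x ^ i) = g e * (\<Sum>i\<le>Suc d. h i * x ^ i) -
        h (Suc d) * (\<Sum>i\<le>Suc d. (if m \<le> i \<and> i \<le> m + e then g (i - m) else 0) * x ^ i)"
      unfolding h'_def left_diff_distrib sum_subtractf sum_distrib_left mult.assoc ..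
    then have "(\<Sum>i\<le>Suc d. h' i * x ^ i) = g e * (\<Sum>i\<le>Suc d. h i * x ^ i) -
        h (Suc d) * (x ^ m * (\<Sum>i\<le>e. g i * x ^ i))" unfolding shift .
    moreover have "g e * (\<Sum>i\<le>Suc d. h i * x ^ i) \<in> P"
      using B(2) g(1) Suc.prems(2) by (intro P_mult) auto
    moreover have "h (Suc d) * (x ^ m * (\<Sum>i\<le>e. g i * x ^ i)) \<in> P"
      by (intro P_mult g(2) unital_subringD(7)[OF R x] subsetD[OF B(2) Suc.prems(1)])
    ultimately have "(\<Sum>i\<le>Suc d. h' i * x ^ i) \<in> P" using P_diff by simp
    moreover have "h' (Suc d) = 0" using m by (simp add: h'_def)
    ultimately have h'P: "(\<Sum>i\<le>d. h' i * x ^ i) \<in> P" by simp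
    have h'M: "h' i \<in> M \<longleftrightarrow> g e * h i \<in> M" for i
    proof -
      have "h (Suc d) * (if m \<le> i \<and> i \<le> m + e then g (i - m) else 0) \<in> M"
        using hd g(1) unital_subringD(2)[OF B(1)] by (intro M.P_mult_right) auto
      then show ?thesis unfolding h'_def using M.P_diff M.P_add by (metis diff_add_cancel)
    qed
    have "\<forall>i\<le>d. h' i \<in> M"
    proof (rule Suc.IH[OF h'B h'P])
      fix i assume "e \<le> i" "i \<le> d"
      then have "h i \<in> M" using Suc.prems(3) by simp
      then show "h' i \<in> M" unfolding h'M using g(1) by (intro M.P_mult)
    qed
    then have "\<forall>i\<le>d. h i \<in> M" using h'M M.P_prime[OF g(1) Suc.prems(1)] M(3) by blast
    then show ?thesis using hd by (auto simp: le_Suc_eq)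
  qed
qed

end

lemma mpolys_Suc_gen: "mpolys (Suc n) \<subseteq> subring_gen (mpolys n \<union> {mpoly_var n})"
proof -
  have "mpolys (Suc n) = subring_gen (range mpoly_const \<union> mpoly_var ` {..<Suc n})"
    by (rule mpolys_eq_gen)
  also have "\<dots> \<subseteq> subring_gen (mpolys n \<union> {mpoly_var n})"
    by (rule subring_gen_mono) (auto simp: less_Suc_eq)
  finally show ?thesis .
qed

lemma alg_extend_prime:
  assumes M: "prime_mod R M" and M': "prime_mod R' M'" and sub: "M' \<subseteq> M" "M \<inter> R' \<subseteq> M'"
    and K: "K \<subseteq> R'" and a: "prime_mod.alg M' K a"
  shows "prime_mod.alg M K a"
proof -
  interpret M: prime_mod R M by fact
  interpret M': prime_mod R' M' by fact
  obtain d p where "\<forall>i\<le>d. p i \<in> K" "\<exists>i\<le>d. p i \<notin> M'" "(\<Sum>i\<le>d. p i * a ^ i) \<in> M'"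
    using a unfolding M'.alg_def by blast
  then show ?thesis unfolding M.alg_def using sub K
    by (intro exI[of _ d], intro exI[of _ p]) blast
qed

lemma alg_generators:
  assumes M: "prime_mod (mpolys (Suc n)) M"
    and alg: "\<And>a. a \<in> mpolys n \<Longrightarrow> prime_mod.alg M (range mpoly_const) a"
      "prime_mod.alg M (range mpoly_const) (mpoly_var n)"
    and a: "a \<in> mpolys (Suc n)"
  shows "prime_mod.alg M (range mpoly_const) a"
proof -
  interpret prime_mod "mpolys (Suc n)" M by fact
  have sub: "mpolys n \<union> {mpoly_var n} \<subseteq> (mpolys (Suc n) :: 'a mpoly set)"
    using mpolys_mono[of n "Suc n"] by auto
  show ?thesis
  proof (rule alg_in_gen[OF unital_subring_range_const _ sub])
    show "a \<in> subring_gen (range mpoly_const \<union> (mpolys n \<union> {mpoly_var n}))"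
      using a mpolys_Suc_gen[of n] subring_gen_mono[of "mpolys n \<union> {mpoly_var n}"
          "range mpoly_const \<union> (mpolys n \<union> {mpoly_var n})"] by blast
  qed (use alg in auto)
qed

text \<open>Modulo \<open>P\<close> the last variable is free over \<open>mpolys n\<close>, so any
  value may be substituted for it. The induction hypothesis keeps one coefficient of
  \<open>f\<close> outside \<open>M'\<close>, and some natural number is then not a root of
  \<open>f\<close> modulo \<open>M'\<close>.\<close>

lemma nullstellensatz_transcendental:
  fixes P :: "'k::field_char_0 mpoly set"
  assumes IH: "\<And>Q f. prime_mod (mpolys n) (Q :: 'k mpoly set) \<Longrightarrow> f \<in> mpolys n \<Longrightarrow> f \<notin> Q \<Longrightarrow>
      \<exists>M. prime_mod (mpolys n) M \<and> Q \<subseteq> M \<and> f \<notin> M \<and> (\<forall>a\<in>mpolys n. prime_mod.alg M (range mpoly_const) a)"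
    and P: "prime_mod (mpolys (Suc n)) P" and f: "f \<in> mpolys (Suc n)" "f \<notin> P"
    and tr: "\<not> prime_mod.alg P (mpolys n) (mpoly_var n)"
  shows "\<exists>M. prime_mod (mpolys (Suc n)) M \<and> P \<subseteq> M \<and> f \<notin> M \<and>
    (\<forall>a\<in>mpolys (Suc n). prime_mod.alg M (range mpoly_const) a)"
proof -
  let ?A = "mpolys (Suc n) :: 'k mpoly set" and ?B = "mpolys n :: 'k mpoly set"
  let ?x = "mpoly_var n :: 'k mpoly"
  interpret prime_mod ?A P by (rule P)
  have BA: "?B \<subseteq> ?A" by (rule mpolys_mono) simp
  have xA: "?x \<in> ?A" by simp
  have P': "prime_mod ?B (P \<inter> ?B)" by (rule prime_mod_subring[OF unital_subring_mpolys BA])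
  have coeffs: "\<exists>d p. (\<forall>i. p i \<in> ?B) \<and> q = (\<Sum>i\<le>d. p i * ?x ^ i)" if "q \<in> ?A" for q
    using subring_gen_insert_sum[OF unital_subring_mpolys, of q n ?x] mpolys_Suc_gen[of n] that by blast
  obtain d p where p: "\<forall>i. p i \<in> ?B" "f = (\<Sum>i\<le>d. p i * ?x ^ i)" using coeffs[OF f(1)] by blast
  have "\<exists>i\<le>d. p i \<notin> P"
  proof (rule ccontr)
    assume "\<not> ?thesis"
    then have "f \<in> P" unfolding p(2) using xA
      by (intro P_sum P_mult_right unital_subringD(7)[OF R]) auto
    then show False using f by blast
  qed
  then obtain j where j: "j \<le> d" "p j \<notin> P" by blast
  obtain M' where M': "prime_mod ?B M'" "P \<inter> ?B \<subseteq> M'" "p j \<notin> M'"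
    and alg: "\<forall>a\<in>?B. prime_mod.alg M' (range mpoly_const) a"
    using IH[OF P', of "p j"] p(1) j by blast
  interpret M': prime_mod ?B M' by (rule M'(1))
  have inj: "inj (\<lambda>i::nat. mpoly_const (of_nat i) :: 'k mpoly)" by (auto simp: inj_def)
  let ?T = "(\<lambda>i::nat. mpoly_const (of_nat i) :: 'k mpoly) ` {..d}"
  \<comment> \<open>Distinct natural numbers stay distinct modulo \<open>M'\<close> in
    characteristic zero, so \<open>d + 1\<close> of them cannot all be roots.\<close>
  have "\<exists>t\<in>?T. (\<Sum>i\<le>d. p i * t ^ i) \<notin> M'"
  proof (rule ccontr)
    assume n: "\<not> ?thesis"
    have "\<forall>i\<le>d. p i \<in> M'"
    proof (rule polynomial_roots_bound[OF M'(1)])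
      show "card ?T = Suc d" using card_image[OF inj_on_subset[OF inj]] by simp
      fix t t' assume tt: "t \<in> ?T" "t' \<in> ?T" "t \<noteq> t'"
      then obtain i i' where "t = mpoly_const (of_nat i)" "t' = mpoly_const (of_nat i')" "i \<noteq> i'" by auto
      then have "t - t' = mpoly_const (of_nat i - of_nat i')" "(of_nat i - of_nat i' :: 'k) \<noteq> 0"
        by (simp_all add: mpoly_const_hom)
      then show "t - t' \<notin> M'" using const_notin_prime[OF M'(1)] by simp
    qed (use p(1) n in auto)
    then show False using j M'(3) by blast
  qed
  then obtain k where k: "(\<Sum>i\<le>d. p i * mpoly_const k ^ i) \<notin> M'" by blast
  define \<sigma> where "\<sigma> = mpoly_subst (\<lambda>i. if i = n then mpoly_const k else mpoly_var i)"
  have \<sigma>: "\<sigma> (a + b) = \<sigma> a + \<sigma> b" "\<sigma> (a * b) = \<sigma> a * \<sigma> b" "\<sigma> 1 = 1" "\<sigma> 0 = 0"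
    "\<sigma> (sum h I) = (\<Sum>i\<in>I. \<sigma> (h i))" "\<sigma> (a ^ m) = \<sigma> a ^ m" "\<sigma> (a - b) = \<sigma> a - \<sigma> b"
    for a b m and h :: "nat \<Rightarrow> 'k mpoly" and I
    by (simp_all add: \<sigma>_def mpoly_subst_add mpoly_subst_mult mpoly_subst_sum mpoly_subst_power mpoly_subst_diff)
  have \<sigma>B: "\<sigma> a = a" if "a \<in> ?B" for a
    unfolding \<sigma>_def by (rule mpoly_subst_id[OF that]) simp
  have \<sigma>x: "\<sigma> ?x = mpoly_const k" "\<sigma> (mpoly_const l) = mpoly_const l" for l by (simp_all add: \<sigma>_def)
  have \<sigma>_closed: "\<sigma> a \<in> ?B" if "a \<in> ?A" for a
    unfolding \<sigma>_def by (rule mpoly_subst_closed[OF that _ unital_subring_mpolys]) auto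
  define M where "M = {q\<in>?A. \<sigma> q \<in> M'}"
  have M: "prime_mod ?A M"
  proof
    fix a b assume "a \<in> ?A" "b \<in> ?A" "a * b \<in> M"
    then show "a \<in> M \<or> b \<in> M" using M'.P_prime[OF \<sigma>_closed \<sigma>_closed, of a b] by (auto simp: M_def \<sigma>)
  qed (use M'.P_one M'.P_zero R in \<open>auto simp: M_def \<sigma> intro: M'.P_add M'.P_mult \<sigma>_closed
        unital_subringD(2,4,6)[OF R]\<close>)
  have \<sigma>f: "\<sigma> (\<Sum>i\<le>e. q i * ?x ^ i) = (\<Sum>i\<le>e. q i * mpoly_const k ^ i)" if "\<forall>i. q i \<in> ?B" for q e
    using that by (simp add: \<sigma> \<sigma>B \<sigma>x)
  have "P \<subseteq> M"
  proof
    fix q assume q: "q \<in> P"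
    then obtain e h where h: "\<forall>i. h i \<in> ?B" "q = (\<Sum>i\<le>e. h i * ?x ^ i)" using coeffs P_sub by blast
    \<comment> \<open>Transcendence means that an element of \<open>P\<close> has all its
      coefficients in \<open>P\<close>; so its values at scalars lie in \<open>M'\<close>.\<close>
    have "\<forall>i\<le>e. h i \<in> P"
    proof (rule ccontr)
      assume "\<not> ?thesis"
      then have "alg ?B ?x" unfolding alg_def using h q by (intro exI[of _ e], intro exI[of _ h]) auto
      then show False using tr by blast
    qed
    then have "(\<Sum>i\<le>e. h i * mpoly_const k ^ i) \<in> M'"
      using h(1) M'(2) by (intro M'.P_sum M'.P_mult_right unital_subringD(7)[OF unital_subring_mpolys]) auto
    then show "q \<in> M" using \<sigma>f[OF h(1), of e] q P_sub unfolding M_def h(2) by auto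
  qed
  moreover have "f \<notin> M" using k \<sigma>f[OF p(1), of d] by (simp add: M_def p(2))
  moreover have "prime_mod.alg M (range mpoly_const) a" if "a \<in> ?A" for a
  proof (rule alg_generators[OF M _ _ that])
    interpret M: prime_mod ?A M by (rule M)
    show "prime_mod.alg M (range mpoly_const) b" if "b \<in> ?B" for b
      using alg that by (intro alg_extend_prime[OF M M'(1)])
        (use M'.P_sub BA \<sigma>B in \<open>auto simp: M_def\<close>)
    have "(\<Sum>i\<le>1. (if i = 0 then - mpoly_const k else 1) * ?x ^ i) \<in> M"
      using R xA M'.P_zero by (auto simp: M_def \<sigma> \<sigma>x intro!: unital_subringD(3)[OF R])
    then show "prime_mod.alg M (range mpoly_const) ?x" unfolding M.alg_def using M.P_one
      by (intro exI[of _ 1], intro exI[of _ "\<lambda>i. if i = 0 then - mpoly_const k else 1"])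
        (auto simp: mpoly_const_hom(3)[symmetric] intro: image_eqI[of _ _ 1])
  qed
  ultimately show ?thesis using M by blast
qed

text \<open>Going up: a prime \<open>M'\<close> of \<open>mpolys n\<close> above \<open>P\<close>
  that misses the leading coefficient \<open>g e\<close> of a minimal equation of the last variable
  has a prime lying over it. To keep \<open>f\<close> out, \<open>M'\<close> must also miss an
  element \<open>r\<close> that is a multiple of \<open>f\<close> modulo \<open>P\<close>.\<close>

lemma nullstellensatz_algebraic:
  fixes P :: "'k::field_char_0 mpoly set"
  assumes IH: "\<And>Q f. prime_mod (mpolys n) (Q :: 'k mpoly set) \<Longrightarrow> f \<in> mpolys n \<Longrightarrow> f \<notin> Q \<Longrightarrow>
      \<exists>M. prime_mod (mpolys n) M \<and> Q \<subseteq> M \<and> f \<notin> M \<and> (\<forall>a\<in>mpolys n. prime_mod.alg M (range mpoly_const) a)"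
    and P: "prime_mod (mpolys (Suc n)) P" and f: "f \<in> mpolys (Suc n)" "f \<notin> P"
    and x_alg: "prime_mod.alg P (mpolys n) (mpoly_var n)"
  shows "\<exists>M. prime_mod (mpolys (Suc n)) M \<and> P \<subseteq> M \<and> f \<notin> M \<and>
    (\<forall>a\<in>mpolys (Suc n). prime_mod.alg M (range mpoly_const) a)"
proof -
  let ?A = "mpolys (Suc n) :: 'k mpoly set" and ?B = "mpolys n :: 'k mpoly set"
  let ?x = "mpoly_var n :: 'k mpoly"
  interpret prime_mod ?A P by (rule P)
  have BA: "?B \<subseteq> ?A" by (rule mpolys_mono) simp
  have Br: "unital_subring ?B" by (rule unital_subring_mpolys)
  have xA: "?x \<in> ?A" by simp
  have P': "prime_mod ?B (P \<inter> ?B)" by (rule prime_mod_subring[OF Br BA])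
  have coeffs: "\<exists>d p. (\<forall>i. p i \<in> ?B) \<and> q = (\<Sum>i\<le>d. p i * ?x ^ i)" if "q \<in> ?A" for q
    using subring_gen_insert_sum[OF Br, of q ?x] mpolys_Suc_gen[of n] that by blast
  define deg_ok where "deg_ok e \<longleftrightarrow> (\<exists>g. (\<forall>i. g i \<in> ?B) \<and> g e \<notin> P \<and> (\<Sum>i\<le>e. g i * ?x ^ i) \<in> P)" for e
  obtain d0 p0 where p0: "\<forall>i\<le>d0. p0 i \<in> ?B" "p0 d0 \<notin> P" "(\<Sum>i\<le>d0. p0 i * ?x ^ i) \<in> P"
    by (rule alg_leading[OF x_alg BA xA])
  have "deg_ok d0" unfolding deg_ok_def
    by (intro exI[of _ "\<lambda>i. if i \<le> d0 then p0 i else 0"]) (use p0 unital_subringD(2)[OF Br] in auto)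
  define e where "e = (LEAST e. deg_ok e)"
  have "deg_ok e" unfolding e_def by (rule LeastI) fact
  then obtain g where g: "\<And>i. g i \<in> ?B" "g e \<notin> P" "(\<Sum>i\<le>e. g i * ?x ^ i) \<in> P"
    unfolding deg_ok_def by blast
  have min: "h e' \<in> P" if "e' < e" "\<And>i. h i \<in> ?B" "(\<Sum>i\<le>e'. h i * ?x ^ i) \<in> P" for e' h
  proof -
    have "\<not> deg_ok e'" using that(1) unfolding e_def by (rule not_less_Least)
    then show ?thesis using that(2,3) unfolding deg_ok_def by blast
  qed
  have e0: "e > 0" using g(2,3) by (cases e) auto
  have "alg ?B f"
    by (rule alg_in_gen[OF Br BA, of "{?x}"]) (use x_alg xA f(1) mpolys_Suc_gen[of n] in auto)
  then obtain r w where r: "r \<in> ?B" "r \<notin> P" "w \<in> ?A" "w * f - r \<in> P"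
    using alg_constant_multiple[of ?B f ?A] BA R f by blast
  have "g e * r \<in> ?B" using g(1) r(1) by (rule unital_subringD(4)[OF Br])
  moreover have "g e * r \<notin> P \<inter> ?B" using P_prime[of "g e" r] g r BA by blast
  ultimately obtain M' where M': "prime_mod ?B M'" "P \<inter> ?B \<subseteq> M'" "g e * r \<notin> M'"
    and alg: "\<forall>a\<in>?B. prime_mod.alg M' (range mpoly_const) a"
    using IH[OF P', of "g e * r"] by blast
  interpret M': prime_mod ?B M' by (rule M'(1))
  have geM: "g e \<notin> M'" and rM: "r \<notin> M'" using M'(3) M'.P_mult[OF g(1), of r e] M'.P_mult_right[of "g e" r] r(1) by auto
  \<comment> \<open>The ideal generated by \<open>P\<close> and \<open>M'\<close>. A prime that
    contains it and misses \<open>mpolys n - M'\<close> lies over \<open>M'\<close>; it exists once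
    \<open>J\<close> meets \<open>mpolys n\<close> inside \<open>M'\<close> only.\<close>
  define J where "J = {p + y |p y. p \<in> P \<and> y \<in> prodspan M' ?A}"
  have prodspan_coeffs: "\<exists>d m. (\<forall>i. m i \<in> M') \<and> y = (\<Sum>i\<le>d. m i * ?x ^ i)" if "y \<in> prodspan M' ?A" for y
    using that
  proof induction
    case (prod a b)
    obtain d p where p: "\<forall>i. p i \<in> ?B" "b = (\<Sum>i\<le>d. p i * ?x ^ i)" using coeffs[OF prod(2)] by blast
    have "a * b = (\<Sum>i\<le>d. (a * p i) * ?x ^ i)" unfolding p(2) by (simp add: sum_distrib_left mult.assoc)
    moreover have "\<forall>i. a * p i \<in> M'" using p(1) prod(1) M'.P_mult_right by blast
    ultimately show ?case by (intro exI[of _ d], intro exI[of _ "\<lambda>i. a * p i"]) blast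
  next
    case (add y z)
    then obtain d m d' m' where m: "\<forall>i. m i \<in> M'" "y = (\<Sum>i\<le>d. m i * ?x ^ i)"
      "\<forall>i. m' i \<in> M'" "z = (\<Sum>i\<le>d'. m' i * ?x ^ i)" by blast
    define D where "D = max d d'"
    define c where "c i = (if i \<le> d then m i else 0) + (if i \<le> d' then m' i else 0)" for i
    have "(\<Sum>i\<le>D. (if i \<le> d then m i else 0) * ?x ^ i) = y"
      unfolding m(2) by (rule sum.mono_neutral_cong_right) (auto simp: D_def)
    moreover have "(\<Sum>i\<le>D. (if i \<le> d' then m' i else 0) * ?x ^ i) = z"
      unfolding m(4) by (rule sum.mono_neutral_cong_right) (auto simp: D_def)
    ultimately have "y + z = (\<Sum>i\<le>D. c i * ?x ^ i)"
      unfolding c_def distrib_right sum.distrib by simp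
    moreover have "\<forall>i. c i \<in> M'" using m(1,3) M'.P_zero by (auto simp: c_def intro!: M'.P_add)
    ultimately show ?case by (intro exI[of _ D], intro exI[of _ c]) blast
  qed
  have zero_ps: "0 \<in> prodspan M' ?A"
    using prodspan.prod[OF M'.P_zero unital_subringD(1)[OF R]] by simp
  have JB: "a \<in> M'" if a: "a \<in> J" "a \<in> ?B" for a
  proof -
    obtain p y where py: "a = p + y" "p \<in> P" "y \<in> prodspan M' ?A" using a unfolding J_def by blast
    obtain d m where m: "\<forall>i. m i \<in> M'" "y = (\<Sum>i\<le>d. m i * ?x ^ i)" using prodspan_coeffs[OF py(3)] by blast
    \<comment> \<open>As a relation of \<open>x\<close> modulo \<open>P\<close>,
      \<open>a - y\<close> has constant coefficient \<open>a - m 0\<close> and all others in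
      \<open>M'\<close>. Since \<open>e > 0\<close>, the coefficients from \<open>e\<close> on are
      in \<open>M'\<close>, and pseudo-division puts \<open>a - m 0\<close> there too.\<close>
    define h where "h i = (if i = 0 then a - m 0 else - m i)" for i
    have mB: "m i \<in> ?B" for i using m(1) M'.P_sub by blast
    have "(\<Sum>i\<le>d. h i * ?x ^ i) = h 0 + (\<Sum>i\<in>{..d} - {0}. h i * ?x ^ i)"
      by (subst sum.remove[of _ 0]) auto
    also have "(\<Sum>i\<in>{..d} - {0}. h i * ?x ^ i) = - (\<Sum>i\<in>{..d} - {0}. m i * ?x ^ i)"
      unfolding sum_negf[symmetric] by (rule sum.cong) (auto simp: h_def)
    also have "h 0 + - (\<Sum>i\<in>{..d} - {0}. m i * ?x ^ i) = a - y"
      unfolding m(2) by (subst (2) sum.remove[of _ 0]) (auto simp: h_def)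
    finally have hP: "(\<Sum>i\<le>d. h i * ?x ^ i) \<in> P" using py by simp
    have hB: "h i \<in> ?B" for i
      using mB a(2) by (auto simp: h_def intro: unital_subringD(3,5)[OF Br])
    have hM: "h i \<in> M'" if "e \<le> i" "i \<le> d" for i using that e0 m(1) M'.P_neg by (simp add: h_def)
    have "\<forall>i\<le>d. h i \<in> M'"
      by (rule pseudo_division[where B = ?B and x = ?x and g = g and e = e])
        (fact Br BA xA g(1) g(3) min M'(1,2) geM hP hB hM)+
    then have "a - m 0 \<in> M'" by (auto simp: h_def dest: spec[of _ 0])
    then show ?thesis using M'.P_cong m(1) by blast
  qed
  have "\<exists>M. prime_mod ?A M \<and> J \<subseteq> M \<and> M \<inter> (?B - M') = {}"
  proof (rule prime_avoiding[OF R])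
    have ps: "y \<in> ?A" if "y \<in> prodspan M' ?A" for y
      using that M'.P_sub BA by induction (auto intro: unital_subringD(4,6)[OF R])
    show "J \<subseteq> ?A" using P_sub ps by (auto simp: J_def intro!: unital_subringD(6)[OF R])
    show "0 \<in> J" unfolding J_def using P_zero zero_ps by (intro CollectI exI[of _ 0]) simp
  next
    fix a b assume "a \<in> J" "b \<in> J"
    then obtain p y q z where *: "a = p + y" "b = q + z" "p \<in> P" "q \<in> P" "y \<in> prodspan M' ?A"
      "z \<in> prodspan M' ?A" unfolding J_def by blast
    have "a + b = (p + q) + (y + z)" by (simp add: *)
    then show "a + b \<in> J" unfolding J_def using P_add[OF *(3,4)] prodspan.add[OF *(5,6)] by blast
  next
    fix a b assume a: "a \<in> ?A" and "b \<in> J"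
    then obtain p y where *: "b = p + y" "p \<in> P" "y \<in> prodspan M' ?A" unfolding J_def by blast
    have "a * y \<in> prodspan M' ?A" using *(3)
    proof induction
      case (prod c d)
      have "c * (a * d) \<in> prodspan M' ?A" using prod a by (intro prodspan.prod unital_subringD(4)[OF R])
      then show ?case by (simp add: mult_ac)
    qed (simp add: distrib_left prodspan.add)
    moreover have "a * b = a * p + a * y" by (simp add: * distrib_left)
    ultimately show "a * b \<in> J" unfolding J_def using P_mult[OF a *(2)] by blast
  next
    show "1 \<in> ?B - M'" using M'.P_one unital_subringD(1)[OF Br] by blast
    show "a * b \<in> ?B - M'" if "a \<in> ?B - M'" "b \<in> ?B - M'" for a b
      using that M'.P_prime[of a b] unital_subringD(4)[OF Br] by blast
    show "J \<inter> (?B - M') = {}" using JB by blast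
  qed
  then obtain M where M: "prime_mod ?A M" "J \<subseteq> M" "M \<inter> (?B - M') = {}" by blast
  interpret M: prime_mod ?A M by (rule M(1))
  have PM: "P \<subseteq> M"
  proof
    fix p assume "p \<in> P"
    then have "p + 0 \<in> J" unfolding J_def using zero_ps by blast
    then show "p \<in> M" using M(2) by auto
  qed
  have M'M: "M' \<subseteq> M"
  proof
    fix m assume "m \<in> M'"
    then have "m * 1 \<in> prodspan M' ?A" by (intro prodspan.prod unital_subringD(1)[OF R])
    then have "0 + m * 1 \<in> J" unfolding J_def using P_zero by blast
    then show "m \<in> M" using M(2) by auto
  qed
  have MB: "M \<inter> ?B \<subseteq> M'" using M(3) by blast
  have "f \<notin> M"
  proof
    assume "f \<in> M"
    then have "w * f \<in> M" using M.P_mult r(3) by blast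
    then have "r \<in> M" using M.P_cong[of "w * f" r] PM r(4) by blast
    then show False using rM MB r(1) by blast
  qed
  moreover have B_alg: "M.alg (range mpoly_const) b" if "b \<in> ?B" for b
    using alg that by (intro alg_extend_prime[OF M(1) M'(1) M'M MB]) auto
  have "M.alg (range mpoly_const) ?x"
  proof (rule M.alg_trans[OF unital_subring_range_const _ BA B_alg xA])
    have "M.alg ?B ?x" unfolding M.alg_def
      using g(1,3) PM geM MB by (intro exI[of _ e], intro exI[of _ g]) blast
    then show "M.alg (subring_gen (range mpoly_const \<union> ?B)) ?x"
      by (rule M.alg_mono) (auto intro: subring_gen.base)
  qed auto
  then have "M.alg (range mpoly_const) a" if "a \<in> ?A" for a
    using alg_generators[OF M(1) B_alg _ that] by blast
  ultimately show ?thesis using M(1) PM by blast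
qed

text \<open>As \<open>k\<close> need not be algebraically closed, residue fields algebraic over
  \<open>k\<close> take the place of points. In the induction, the last variable is either
  transcendental or algebraic over the others modulo \<open>P\<close>.\<close>

theorem nullstellensatz:
  fixes P :: "'k::field_char_0 mpoly set"
  assumes "prime_mod (mpolys n) P" "f \<in> mpolys n" "f \<notin> P"
  shows "\<exists>M. prime_mod (mpolys n) M \<and> P \<subseteq> M \<and> f \<notin> M \<and>
    (\<forall>a\<in>mpolys n. prime_mod.alg M (range mpoly_const) a)"
  using assms
proof (induction n arbitrary: P f)
  case 0
  interpret prime_mod "mpolys 0" P by (rule 0)
  have "(mpolys 0 :: 'k mpoly set) = range mpoly_const"
    unfolding mpolys_eq_gen using subring_gen_self[OF unital_subring_range_const] by simp
  then have "alg (range mpoly_const) a" if "a \<in> mpolys 0" for a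
    using alg_self[OF unital_subring_range_const] that by blast
  then show ?case using 0 by blast
next
  case (Suc n)
  show ?case
  proof (cases "prime_mod.alg P (mpolys n) (mpoly_var n)")
    case True
    then show ?thesis by (intro nullstellensatz_algebraic Suc)
  next
    case False
    then show ?thesis by (intro nullstellensatz_transcendental Suc)
  qed
qed

section \<open>Primitive ideals\<close>

context linear_action
begin

definition stable_ideal :: "'k mpoly set \<Rightarrow> bool" where
  "stable_ideal J \<longleftrightarrow> J \<subseteq> A \<and> 0 \<in> J \<and> (\<forall>a\<in>J. \<forall>b\<in>J. a + b \<in> J) \<and> (\<forall>a\<in>A. \<forall>b\<in>J. a * b \<in> J) \<and>
    (\<forall>i<s. \<forall>f\<in>J. delta i f \<in> J)"

definition core_of :: "'k mpoly set \<Rightarrow> 'k mpoly set \<Rightarrow> bool" where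
  "core_of M P \<longleftrightarrow> P \<subseteq> M \<and> (\<forall>J. stable_ideal J \<longrightarrow> J \<subseteq> M \<longrightarrow> J \<subseteq> P)"

text \<open>By the quotient rule, this says that \<open>a / b\<close> is annihilated by all \<open>delta i\<close>.\<close>

definition const_ratio :: "'k mpoly set \<Rightarrow> 'k mpoly \<Rightarrow> 'k mpoly \<Rightarrow> bool" where
  "const_ratio P a b \<longleftrightarrow> (\<forall>i<s. b * delta i a - a * delta i b \<in> P)"

text \<open>The core of a maximal ideal that lies above \<open>P\<close> and misses \<open>h\<close>
  is a stable prime above \<open>P\<close> which still misses \<open>h\<close>, so it cannot be
  larger than \<open>P\<close>.\<close>

lemma locally_closed_imp_primitive:
  assumes P: "stable_prime P" and h: "h \<in> A" "h \<notin> P" "\<And>Q. stable_prime Q \<Longrightarrow> P \<subset> Q \<Longrightarrow> h \<in> Q"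
  shows "\<exists>M. prime_mod A M \<and> (\<forall>a\<in>A. prime_mod.alg M const_polys a) \<and> core_of M P"
proof -
  have P': "prime_mod A P" using P by (simp add: stable_prime_def)
  obtain M where M: "prime_mod A M" "P \<subseteq> M" "h \<notin> M" "\<forall>a\<in>A. prime_mod.alg M const_polys a"
    using nullstellensatz[OF P' h(1,2)] unfolding const_polys_def by blast
  let ?C = "core {..<s} delta A M"
  have "stable_prime ?C" unfolding stable_prime_def
  proof (intro conjI allI impI ballI)
    show "prime_mod A ?C"
    proof (rule core_prime[OF M(1)])
      show "of_nat n \<notin> M" if "n > 0" for n
        using const_notin_prime[OF M(1), of "of_nat n"] that by (simp add: mpoly_const_of_nat)
    qed (auto simp: derivation_delta delta_closed)
    show "delta i f \<in> ?C" if "i < s" "f \<in> ?C" for i f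
      by (rule core_stable[OF delta_closed that(2)]) (use that in auto)
  qed
  have "P \<subseteq> ?C"
    by (rule core_greatest[OF M(2) prime_mod.P_sub[OF P']]) (use P in \<open>simp add: stable_prime_def\<close>)
  moreover have "h \<notin> ?C" using M(3) core_subset[of "{..<s}" delta A M] by blast
  ultimately have PC: "P = ?C" using h(3)[OF \<open>stable_prime ?C\<close>] by blast
  have "J \<subseteq> P" if "stable_ideal J" "J \<subseteq> M" for J
    unfolding PC by (rule core_greatest[OF that(2)]) (use that(1) in \<open>auto simp: stable_ideal_def\<close>)
  then show ?thesis using M unfolding core_of_def by blast
qed

section \<open>Constants of the fraction field of \<open>A/P\<close>\<close>

context
  fixes P assumes P: "stable_prime P"
begin

interpretation prime_mod A P using P by (simp add: stable_prime_def)

lemma stable_P: "i < s \<Longrightarrow> f \<in> P \<Longrightarrow> delta i f \<in> P"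
  using P by (simp add: stable_prime_def)

text \<open>Being a constant depends on the fraction, not on its representative. The identity
  \<open>id\<close> expresses the new numerator, times \<open>b * b\<close>, through the old one and
  through \<open>a * b' - a' * b\<close> and its derivative, all of them zero modulo
  \<open>P\<close>.\<close>

lemma const_ratio_cong:
  assumes ab: "a \<in> A" "b \<in> A" "b \<notin> P" "const_ratio P a b" and ab': "a' \<in> A" "b' \<in> A"
    and eq: "a * b' - a' * b \<in> P"
  shows "const_ratio P a' b'"
  unfolding const_ratio_def
proof (intro allI impI)
  fix i assume i: "i < s"
  note c = unital_subringD(3,4)[OF A_ring] delta_closed
  let ?D = "delta i"
  have 1: "b * ?D a - a * ?D b \<in> P" using ab(4) i by (simp add: const_ratio_def)
  have 2: "?D (a * b' - a' * b) \<in> P" using stable_P[OF i eq] .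
  have id: "(b * b) * (b' * ?D a' - a' * ?D b') =
     (- (b * b')) * ?D (a * b' - a' * b) + b' * b' * (b * ?D a - a * ?D b) +
     (b * ?D b' + b' * ?D b) * (a * b' - a' * b)"
    by (simp add: deltaD algebra_simps)
  have "(- (b * b')) * ?D (a * b' - a' * b) \<in> P"
    by (rule P_mult[OF _ 2]) (intro unital_subringD(4,5)[OF A_ring] ab ab')
  moreover have "b' * b' * (b * ?D a - a * ?D b) \<in> P"
    by (rule P_mult[OF _ 1]) (intro unital_subringD(4)[OF A_ring] ab')
  moreover have "(b * ?D b' + b' * ?D b) * (a * b' - a' * b) \<in> P"
    by (rule P_mult[OF _ eq]) (intro unital_subringD(4,6)[OF A_ring] ab ab' delta_closed)
  ultimately have "(b * b) * (b' * ?D a' - a' * ?D b') \<in> P" unfolding id by (intro P_add)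
  moreover have "b * b \<in> A" "b' * ?D a' - a' * ?D b' \<in> A" using ab ab' by (auto intro!: c)
  moreover have "b * b \<notin> P" using ab P_prime by blast
  ultimately show "b' * ?D a' - a' * ?D b' \<in> P" using P_prime by blast
qed

lemma const_ratio_mult:
  assumes "const_ratio P a b" "const_ratio P x y" "a \<in> A" "b \<in> A" "x \<in> A" "y \<in> A"
  shows "const_ratio P (a * x) (b * y)"
  unfolding const_ratio_def
proof (intro allI impI)
  fix i assume i: "i < s"
  have "b * y * delta i (a * x) - a * x * delta i (b * y) =
    (a * b) * (y * delta i x - x * delta i y) + (x * y) * (b * delta i a - a * delta i b)"
    by (simp add: deltaD algebra_simps)
  also have "\<dots> \<in> P" using assms i unfolding const_ratio_def
    by (intro P_add P_mult unital_subringD(4)[OF A_ring]) auto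
  finally show "b * y * delta i (a * x) - a * x * delta i (b * y) \<in> P" .
qed

lemma const_ratio_power:
  assumes "const_ratio P a b" "a \<in> A" "b \<in> A"
  shows "const_ratio P (a ^ n) (b ^ n)"
proof (induction n)
  case 0
  show ?case using P_zero by (simp add: const_ratio_def deltaD)
next
  case (Suc n)
  then show ?case using const_ratio_mult[OF assms(1) Suc] assms unital_subringD(7)[OF A_ring] by simp
qed

lemma const_ratio_sum:
  assumes "\<And>t. t \<in> T \<Longrightarrow> const_ratio P (f t) b"
  shows "const_ratio P (\<Sum>t\<in>T. mpoly_const (k t) * f t) b"
  unfolding const_ratio_def
proof (intro allI impI)
  fix i assume i: "i < s"
  have "b * delta i (\<Sum>t\<in>T. mpoly_const (k t) * f t) - (\<Sum>t\<in>T. mpoly_const (k t) * f t) * delta i b =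
    (\<Sum>t\<in>T. mpoly_const (k t) * (b * delta i (f t) - f t * delta i b))"
    by (simp add: deltaD sum_distrib_left sum_distrib_right sum_subtractf[symmetric] algebra_simps)
  also have "\<dots> \<in> P" using assms i unfolding const_ratio_def by (intro P_sum P_mult) auto
  finally show "b * delta i (\<Sum>t\<in>T. mpoly_const (k t) * f t) -
    (\<Sum>t\<in>T. mpoly_const (k t) * f t) * delta i b \<in> P" .
qed

text \<open>For a constant \<open>a / b\<close> of the fraction field, the set of all \<open>y\<close> in \<open>A\<close> that are multiples
  \<open>y = (a / b) c\<close> modulo \<open>P\<close>.\<close>

lemma stable_ideal_multiples:
  assumes ab: "a \<in> A" "b \<in> A" "b \<notin> P" "const_ratio P a b"
  shows "stable_ideal {y\<in>A. \<exists>c\<in>A. y * b - a * c \<in> P}" (is "stable_ideal ?L")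
  unfolding stable_ideal_def
proof (intro conjI allI impI ballI)
  note Ac = unital_subringD[OF A_ring]
  show "?L \<subseteq> A" by blast
  show "0 \<in> ?L" using Ac(2) P_zero by (auto intro!: bexI[of _ 0])
next
  fix y z assume "y \<in> ?L" "z \<in> ?L"
  then obtain c d where *: "y \<in> A" "z \<in> A" "c \<in> A" "d \<in> A" "y * b - a * c \<in> P" "z * b - a * d \<in> P" by blast
  have "(y + z) * b - a * (c + d) = (y * b - a * c) + (z * b - a * d)" by (simp add: algebra_simps)
  also have "\<dots> \<in> P" using * by (intro P_add)
  finally show "y + z \<in> ?L" using * unital_subringD(6)[OF A_ring] by blast
next
  fix r y assume r: "r \<in> A" and "y \<in> ?L"
  then obtain c where *: "y \<in> A" "c \<in> A" "y * b - a * c \<in> P" by blast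
  have "(r * y) * b - a * (r * c) = r * (y * b - a * c)" by (simp add: algebra_simps)
  also have "\<dots> \<in> P" using * r by (intro P_mult)
  finally show "r * y \<in> ?L" using * r unital_subringD(4)[OF A_ring] by blast
next
  fix i y assume i: "i < s" and "y \<in> ?L"
  then obtain c where *: "y \<in> A" "c \<in> A" "y * b - a * c \<in> P" by blast
  let ?D = "delta i"
  have 1: "b * ?D a - a * ?D b \<in> P" using ab(4) i by (simp add: const_ratio_def)
  have id: "b * (?D y * b - a * ?D c) =
      b * ?D (y * b - a * c) - ?D b * (y * b - a * c) + c * (b * ?D a - a * ?D b)"
    by (simp add: deltaD algebra_simps)
  have "b * (?D y * b - a * ?D c) \<in> P" unfolding id
    by (intro P_add P_diff P_mult[OF ab(2) stable_P[OF i *(3)]] P_mult[OF delta_closed[OF ab(2)] *(3)] P_mult[OF *(2) 1])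
  moreover have "?D y * b - a * ?D c \<in> A"
    using * ab by (intro unital_subringD(3)[OF A_ring] unital_subringD(4)[OF A_ring] delta_closed)
  ultimately have "?D y * b - a * ?D c \<in> P" using P_prime ab by blast
  then show "?D y \<in> ?L" using * delta_closed by blast
qed

text \<open>Here \<open>b\<close> is invertible modulo \<open>M\<close>, so \<open>a / b\<close> has
  a value in the residue field, which satisfies an equation \<open>p\<close> over \<open>k\<close>.
  Then \<open>p(a / b)\<close> is a constant whose multiples in \<open>A\<close> all lie in
  \<open>M\<close>; they form a stable ideal, hence lie in the core \<open>P\<close>.\<close>

lemma constant_algebraic_over_core:
  assumes M: "prime_mod A M" "\<forall>a\<in>A. prime_mod.alg M const_polys a" and core: "core_of M P"
    and ab: "a \<in> A" "b \<in> A" "b \<notin> M" "const_ratio P a b"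
  shows "\<exists>d \<kappa>. \<kappa> d \<noteq> 0 \<and> (\<Sum>t\<le>d. mpoly_const (\<kappa> t) * a ^ t * b ^ (d - t)) \<in> P"
proof -
  interpret M: prime_mod A M by (rule M(1))
  note Ac = unital_subringD[OF A_ring]
  have PM: "P \<subseteq> M" using core by (simp add: core_of_def)
  obtain k w where k: "k \<in> const_polys" "k \<notin> M" "w \<in> A" "w * b - k \<in> M"
    using M.alg_constant_multiple[of const_polys b A] M(2) ab(2,3) const_polys_sub_A A_ring by blast
  obtain l where kl: "k = mpoly_const l" using k(1) by (auto simp: const_polys_def)
  have "l \<noteq> 0" using k(2) M.P_zero kl by auto
  note l = kl this
  \<comment> \<open>The inverse of \<open>b\<close> modulo \<open>M\<close>: there
    \<open>w * b\<close> is the nonzero scalar \<open>l\<close>.\<close>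
  define w' where "w' = mpoly_const (inverse l) * w"
  have w': "w' \<in> A" unfolding w'_def using k(3) by (intro Ac(4)) auto
  have "w' * b - 1 = mpoly_const (inverse l) * (w * b - k)"
    using l by (simp add: w'_def algebra_simps mpoly_const_hom(2)[symmetric])
  then have wb: "w' * b - 1 \<in> M" using M.P_mult[OF _ k(4)] by simp
  have yA: "a * w' \<in> A" using ab w' by (intro Ac(4))
  obtain d p where p: "\<forall>i\<le>d. p i \<in> const_polys" "p d \<notin> M" "(\<Sum>i\<le>d. p i * (a * w') ^ i) \<in> M" "d > 0"
    by (rule M.alg_leading[OF M(2)[rule_format, OF yA] const_polys_sub_A yA])
  have "\<forall>i. \<exists>c. i \<le> d \<longrightarrow> p i = mpoly_const c" using p(1) by (auto simp: const_polys_def)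
  then obtain \<kappa> where \<kappa>: "\<And>i. i \<le> d \<Longrightarrow> p i = mpoly_const (\<kappa> i)" by metis
  have \<kappa>d: "\<kappa> d \<noteq> 0" using p(2) \<kappa>[of d] M.P_zero by auto
  \<comment> \<open>The numerator of \<open>p(a / b)\<close> over the denominator
    \<open>b ^ d\<close>.\<close>
  define q where "q = (\<Sum>t\<le>d. mpoly_const (\<kappa> t) * (a ^ t * b ^ (d - t)))"
  have qA: "q \<in> A" unfolding q_def using ab
    by (intro unital_subring_sum[OF A_ring] Ac(4) Ac(7)) auto
  have wbn: "(w' * b) ^ t - 1 \<in> M" for t
  proof (induction t)
    case 0
    show ?case using M.P_zero by simp
  next
    case (Suc t)
    have "(w' * b) ^ Suc t - 1 = (w' * b) * ((w' * b) ^ t - 1) + (w' * b - 1)" by (simp add: algebra_simps)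
    also have "\<dots> \<in> M" using Suc wb w' ab by (intro M.P_add M.P_mult Ac(4)) auto
    finally show ?case .
  qed
  have "(\<Sum>t\<le>d. mpoly_const (\<kappa> t) * (a ^ t * b ^ (d - t))) - b ^ d * (\<Sum>i\<le>d. p i * (a * w') ^ i) \<in> M"
    unfolding sum_distrib_left sum_subtractf[symmetric]
  proof (rule M.P_sum)
    fix t assume t: "t \<in> {..d}"
    then have bd: "b ^ d = b ^ (d - t) * b ^ t" by (simp flip: power_add)
    have pt: "p t = mpoly_const (\<kappa> t)" using \<kappa> t by simp
    have "mpoly_const (\<kappa> t) * (a ^ t * b ^ (d - t)) - b ^ d * (p t * (a * w') ^ t) =
      - ((mpoly_const (\<kappa> t) * (a ^ t * b ^ (d - t))) * ((w' * b) ^ t - 1))"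
      unfolding bd pt by (simp add: algebra_simps power_mult_distrib)
    also have "\<dots> \<in> M" using ab by (intro M.P_neg M.P_mult[OF _ wbn] Ac(4) Ac(7)) auto
    finally show "mpoly_const (\<kappa> t) * (a ^ t * b ^ (d - t)) - b ^ d * (p t * (a * w') ^ t) \<in> M" .
  qed
  moreover have "b ^ d * (\<Sum>i\<le>d. p i * (a * w') ^ i) \<in> M" using p(3) ab by (intro M.P_mult Ac(7))
  ultimately have qM: "q \<in> M" unfolding q_def using M.P_cong by blast
  have bdM: "b ^ d \<notin> M" using M.P_power ab by blast
  have bdA: "b ^ d \<in> A" using ab by (intro Ac(7))
  have "const_ratio P q (b ^ d)" unfolding q_def
  proof (rule const_ratio_sum)
    fix t assume t: "t \<in> {..d}"
    then have bd: "b ^ d = b ^ t * b ^ (d - t)" by (simp flip: power_add)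
    have "const_ratio P (b ^ (d - t)) (b ^ (d - t))" using P_zero by (simp add: const_ratio_def)
    then show "const_ratio P (a ^ t * b ^ (d - t)) (b ^ d)" unfolding bd
      by (rule const_ratio_mult[OF const_ratio_power[OF ab(4,1,2)]]) (intro Ac(7) ab)+
  qed
  then have L: "stable_ideal {y\<in>A. \<exists>c\<in>A. y * b ^ d - q * c \<in> P}" (is "stable_ideal ?L")
    using stable_ideal_multiples[OF qA bdA] bdM PM by blast
  have "?L \<subseteq> M"
  proof
    fix y assume "y \<in> ?L"
    then obtain c where c: "y \<in> A" "c \<in> A" "y * b ^ d - q * c \<in> P" by blast
    have "y * b ^ d \<in> M" using M.P_cong[of "y * b ^ d" "q * c"] c PM M.P_mult_right[OF qM] by blast
    then show "y \<in> M" using M.P_prime[OF c(1) bdA] bdM by blast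
  qed
  then have "?L \<subseteq> P" using core L unfolding core_of_def by blast
  \<comment> \<open>It is the multiple of \<open>q / b ^ d\<close> by \<open>b ^ d\<close>.\<close>
  moreover have "q \<in> ?L" using qA bdA P_zero by (auto intro!: bexI[of _ "b ^ d"])
  ultimately have "q \<in> P" by blast
  then show ?thesis using \<kappa>d unfolding q_def
    by (intro exI[of _ d], intro exI[of _ \<kappa>]) (simp add: mult.assoc)
qed

text \<open>The denominators of \<open>a / b\<close> form a stable ideal that contains
  \<open>b\<close>, so it is not inside the core \<open>P\<close> and therefore not inside
  \<open>M\<close>. A denominator outside \<open>M\<close> reduces the claim to
  \<open>constant_algebraic_over_core\<close>.\<close>

lemma primitive_imp_rational:
  assumes M: "prime_mod A M" "\<forall>a\<in>A. prime_mod.alg M const_polys a" and core: "core_of M P"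
    and ab: "a \<in> A" "b \<in> A" "b \<notin> P" "const_ratio P a b"
  shows "\<exists>d \<kappa>. \<kappa> d \<noteq> 0 \<and> (\<Sum>t\<le>d. mpoly_const (\<kappa> t) * a ^ t * b ^ (d - t)) \<in> P"
proof -
  note Ac = unital_subringD[OF A_ring]
  have PM: "P \<subseteq> M" using core by (simp add: core_of_def)
  define I where "I = {y\<in>A. \<exists>c\<in>A. y * a - b * c \<in> P}"
  show ?thesis
  \<comment> \<open>Stability of \<open>I\<close> is obtained by viewing it as the multiples of
    \<open>b / a\<close>, so \<open>a\<close> must be nonzero modulo \<open>P\<close>; a zero
    fraction satisfies the equation \<open>t = 0\<close>.\<close>
  proof (cases "a \<in> P")
    case True
    have "(\<Sum>t\<le>1. mpoly_const (if t = 1 then 1 else 0) * a ^ t * b ^ (1 - t)) = a" by simp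
    then show ?thesis using True
      by (intro exI[of _ "1::nat"], intro exI[of _ "\<lambda>t. if t = 1 then 1 else 0"]) simp
  next
    case False
    have "const_ratio P b a" unfolding const_ratio_def
    proof (intro allI impI)
      fix i assume "i < s"
      then have "b * delta i a - a * delta i b \<in> P" using ab(4) by (simp add: const_ratio_def)
      from P_neg[OF this] show "a * delta i b - b * delta i a \<in> P" by simp
    qed
    then have "stable_ideal I" unfolding I_def using stable_ideal_multiples[OF ab(2,1) False] by blast
    moreover have "b \<in> I" unfolding I_def using ab P_zero by (auto intro!: bexI[of _ a])
    ultimately have "\<not> I \<subseteq> M" using core ab(3) unfolding core_of_def by blast
    then obtain d c where dc: "d \<in> A" "d \<notin> M" "c \<in> A" "d * a - b * c \<in> P" unfolding I_def by blast
    have dP: "d \<notin> P" using dc PM by blast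
    have eq: "a * d - c * b \<in> P" using dc(4) by (simp add: mult.commute)
    have "const_ratio P c d" by (rule const_ratio_cong[OF ab dc(3,1) eq])
    from constant_algebraic_over_core[OF M core dc(3,1,2) this]
    obtain m \<kappa> where \<kappa>: "\<kappa> m \<noteq> 0" "(\<Sum>t\<le>m. mpoly_const (\<kappa> t) * c ^ t * d ^ (m - t)) \<in> P" by blast
    \<comment> \<open>As \<open>a * d\<close> is congruent to \<open>c * b\<close>, the equation of
      \<open>c / d\<close> times \<open>b ^ m\<close> is that of \<open>a / b\<close> times
      \<open>d ^ m\<close>, and the power of \<open>d\<close> is cancelled.\<close>
    have pw: "(a * d) ^ t - (c * b) ^ t \<in> P" for t
    proof (induction t)
      case (Suc t)
      have "(a * d) ^ Suc t - (c * b) ^ Suc t = (a * d) * ((a * d) ^ t - (c * b) ^ t) + (c * b) ^ t * (a * d - c * b)"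
        by (simp add: algebra_simps)
      also have "\<dots> \<in> P" using Suc eq ab dc by (intro P_add P_mult Ac(4) Ac(7))
      finally show ?case .
    qed (simp add: P_zero)
    let ?s = "\<Sum>t\<le>m. mpoly_const (\<kappa> t) * a ^ t * b ^ (m - t)"
    have "d ^ m * ?s - b ^ m * (\<Sum>t\<le>m. mpoly_const (\<kappa> t) * c ^ t * d ^ (m - t)) \<in> P"
      unfolding sum_distrib_left sum_subtractf[symmetric]
    proof (rule P_sum)
      fix t assume t: "t \<in> {..m}"
      have dm: "d ^ m = d ^ t * d ^ (m - t)" and bm: "b ^ m = b ^ t * b ^ (m - t)"
        using t by (simp_all flip: power_add)
      have "d ^ m * (mpoly_const (\<kappa> t) * a ^ t * b ^ (m - t)) - b ^ m * (mpoly_const (\<kappa> t) * c ^ t * d ^ (m - t)) =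
        (mpoly_const (\<kappa> t) * (b ^ (m - t) * d ^ (m - t))) * ((a * d) ^ t - (c * b) ^ t)"
        unfolding dm bm by (simp add: power_mult_distrib algebra_simps)
      also have "\<dots> \<in> P" using ab dc by (intro P_mult[OF _ pw] Ac(4) Ac(7)) auto
      finally show "d ^ m * (mpoly_const (\<kappa> t) * a ^ t * b ^ (m - t)) -
        b ^ m * (mpoly_const (\<kappa> t) * c ^ t * d ^ (m - t)) \<in> P" .
    qed
    moreover have "b ^ m * (\<Sum>t\<le>m. mpoly_const (\<kappa> t) * c ^ t * d ^ (m - t)) \<in> P"
      using \<kappa>(2) ab by (intro P_mult Ac(7))
    ultimately have "d ^ m * ?s \<in> P" using P_cong by blast
    moreover have "d ^ m \<notin> P" using P_power dc dP by blast
    moreover have "d ^ m \<in> A" "?s \<in> A" using dc ab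
      by (auto intro!: Ac(7) Ac(4) unital_subring_sum[OF A_ring])
    ultimately have "?s \<in> P" using P_prime by blast
    then show ?thesis using \<kappa>(1) by blast
  qed
qed

end

lemma rationality_criterion:
  assumes "\<And>a b. a \<in> A \<Longrightarrow> b \<in> A \<Longrightarrow> b \<notin> P \<Longrightarrow> const_ratio P a b \<Longrightarrow>
    \<exists>d \<kappa>. \<kappa> d \<noteq> 0 \<and> (\<Sum>t\<le>d. mpoly_const (\<kappa> t) * a ^ t * b ^ (d - t)) \<in> P"
  shows "algebraic_constants P"
  unfolding algebraic_constants_def
proof (intro ballI impI)
  fix a b assume "a \<in> A" "b \<in> A" "b \<notin> P" "\<forall>i<s. b * delta i a - a * delta i b \<in> P"
  then obtain d \<kappa> where "\<kappa> d \<noteq> 0" "(\<Sum>t\<le>d. mpoly_const (\<kappa> t) * a ^ t * b ^ (d - t)) \<in> P"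
    using assms unfolding const_ratio_def by blast
  then show "\<exists>d \<kappa>. (\<exists>t\<le>d. \<kappa> t \<noteq> 0) \<and> (\<Sum>t\<le>d. mpoly_const (\<kappa> t) * a ^ t * b ^ (d - t)) \<in> P"
    by (intro exI[of _ d], intro exI[of _ \<kappa>]) blast
qed

end

section \<open>The fraction field of a quotient\<close>

lemma mpoly_ring_simps [simp]:
  "x \<otimes>\<^bsub>mpoly_ring n\<^esub> y = x * y" "x \<oplus>\<^bsub>mpoly_ring n\<^esub> y = x + y"
  "\<one>\<^bsub>mpoly_ring n\<^esub> = 1" "\<zero>\<^bsub>mpoly_ring n\<^esub> = 0"
  by (simp_all add: mpoly_ring_def)

lemma cring_mpoly_ring: "cring (mpoly_ring n :: 'k::comm_ring_1 mpoly ring)"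
proof (rule cringI)
  note c = unital_subringD[OF unital_subring_mpolys]
  show "abelian_group (mpoly_ring n :: 'k mpoly ring)"
  proof (rule abelian_groupI)
    fix x :: "'k mpoly" assume "x \<in> mpolys n"
    then show "\<exists>y\<in>mpolys n. y \<oplus>\<^bsub>mpoly_ring n\<^esub> x = \<zero>\<^bsub>mpoly_ring n\<^esub>"
      by (intro bexI[of _ "- x"] c(5)) simp_all
  qed (auto simp: add_ac intro: c(2,6))
  show "comm_monoid (mpoly_ring n :: 'k mpoly ring)"
    by (rule comm_monoidI) (auto simp: mult_ac intro: c(1,4))
qed (simp add: distrib_right)

lemma ideal_mpoly_ring_iff:
  fixes I :: "'k::comm_ring_1 mpoly set"
  shows "ideal I (mpoly_ring n) \<longleftrightarrow> I \<subseteq> mpolys n \<and> 0 \<in> I \<and> (\<forall>a\<in>I. \<forall>b\<in>I. a + b \<in> I) \<and>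
    (\<forall>a\<in>mpolys n. \<forall>b\<in>I. a * b \<in> I)"
proof
  assume "ideal I (mpoly_ring n)"
  then interpret ideal I "mpoly_ring n" .
  show "I \<subseteq> mpolys n \<and> 0 \<in> I \<and> (\<forall>a\<in>I. \<forall>b\<in>I. a + b \<in> I) \<and> (\<forall>a\<in>mpolys n. \<forall>b\<in>I. a * b \<in> I)"
  proof (intro conjI ballI)
    show "I \<subseteq> mpolys n" by (rule a_subset)
    show "0 \<in> I" using additive_subgroup.zero_closed[OF is_additive_subgroup] by simp
    show "a + b \<in> I" if "a \<in> I" "b \<in> I" for a b
      using additive_subgroup.a_closed[OF is_additive_subgroup that] by simp
    show "a * b \<in> I" if "a \<in> mpolys n" "b \<in> I" for a b using I_l_closed[OF that(2,1)] by simp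
  qed
next
  assume I: "I \<subseteq> mpolys n \<and> 0 \<in> I \<and> (\<forall>a\<in>I. \<forall>b\<in>I. a + b \<in> I) \<and> (\<forall>a\<in>mpolys n. \<forall>b\<in>I. a * b \<in> I)"
  interpret cring "mpoly_ring n :: 'k mpoly ring" by (rule cring_mpoly_ring)
  have neg: "- a \<in> I" if "a \<in> I" for a
  proof -
    have "(- 1) * a \<in> I" using I that unital_subringD(1,5)[OF unital_subring_mpolys] by blast
    then show ?thesis by simp
  qed
  have inv: "\<ominus>\<^bsub>mpoly_ring n\<^esub> a = - a" if "a \<in> mpolys n" for a :: "'k mpoly"
    by (rule minus_equality) (use that in \<open>auto intro: unital_subringD(5)[OF unital_subring_mpolys]\<close>)
  show "ideal I (mpoly_ring n)"
  proof (rule idealI)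
    show "subgroup I (add_monoid (mpoly_ring n))"
    proof (rule add.subgroupI)
      show "I \<noteq> {}" using I by blast
      show "\<ominus>\<^bsub>mpoly_ring n\<^esub> a \<in> I" if "a \<in> I" for a
        using inv[of a] neg[OF that] that I by (metis subsetD)
      show "I \<subseteq> mpolys n" using I by blast
      show "a \<oplus>\<^bsub>mpoly_ring n\<^esub> b \<in> I" if "a \<in> I" "b \<in> I" for a b using I that by simp
    qed
  next
    show "x \<otimes>\<^bsub>mpoly_ring n\<^esub> a \<in> I" if "a \<in> I" "x \<in> mpolys n" for a x using I that by simp
  next
    show "a \<otimes>\<^bsub>mpoly_ring n\<^esub> x \<in> I" if "a \<in> I" "x \<in> mpolys n" for a x
    proof -
      have "x * a \<in> I" using I that by blast
      then show ?thesis by (simp add: mult.commute)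
    qed
  qed (rule ring_axioms)
qed

lemma primeideal_mpoly_ring_iff:
  fixes I :: "'k::comm_ring_1 mpoly set"
  shows "primeideal I (mpoly_ring n) \<longleftrightarrow> prime_mod (mpolys n) I"
proof
  assume "primeideal I (mpoly_ring n)"
  then interpret primeideal I "mpoly_ring n" .
  have I: "I \<subseteq> mpolys n \<and> 0 \<in> I \<and> (\<forall>a\<in>I. \<forall>b\<in>I. a + b \<in> I) \<and> (\<forall>a\<in>mpolys n. \<forall>b\<in>I. a * b \<in> I)"
    using is_ideal unfolding ideal_mpoly_ring_iff .
  show "prime_mod (mpolys n) I"
  proof
    show "1 \<notin> I"
    proof
      assume "1 \<in> I"
      then have "mpolys n = I" by (intro one_imp_carrier[symmetric]) simp
      then show False using I_notcarr by blast
    qed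
    show "a \<in> I \<or> b \<in> I" if "a \<in> mpolys n" "b \<in> mpolys n" "a * b \<in> I" for a b
      using I_prime[of a b] that by simp
  qed (use I in \<open>simp_all add: unital_subring_mpolys\<close>)
next
  assume "prime_mod (mpolys n) I"
  then interpret prime_mod "mpolys n" I .
  show "primeideal I (mpoly_ring n)"
  proof (rule primeidealI)
    show "ideal I (mpoly_ring n)"
      unfolding ideal_mpoly_ring_iff using P_sub P_zero P_add P_mult by simp
    show "mpolys n \<noteq> I" using P_one unital_subringD(1)[OF R] by blast
    show "a \<in> I \<or> b \<in> I" if "a \<in> mpolys n" "b \<in> mpolys n" "a \<otimes>\<^bsub>mpoly_ring n\<^esub> b \<in> I" for a b
      using P_prime that by simp
  qed (rule cring_mpoly_ring)
qed

text \<open>Operations on classes are unions over representatives; independence of the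
  representative collapses the union.\<close>

lemma UN_constant_value: "S \<noteq> {} \<Longrightarrow> (\<And>x. x \<in> S \<Longrightarrow> f x = c) \<Longrightarrow> (\<Union>x\<in>S. f x) = c"
  by auto

locale prime_quotient = prime_mod "mpolys n" P for n and P :: "'k::field mpoly set"
begin

abbreviation Q :: "'k mpoly set ring" where "Q \<equiv> mpoly_ring n Quot P"
abbreviation coset :: "'k mpoly \<Rightarrow> 'k mpoly set" where "coset a \<equiv> P +>\<^bsub>mpoly_ring n\<^esub> a"

definition frac :: "'k mpoly \<Rightarrow> 'k mpoly \<Rightarrow> ('k mpoly set \<times> 'k mpoly set) set" where
  "frac a b = fraction Q (coset a) (coset b)"

lemma primeideal_P: "primeideal P (mpoly_ring n)"
  unfolding primeideal_mpoly_ring_iff by (rule prime_mod_axioms)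

sublocale PI: primeideal P "mpoly_ring n" by (rule primeideal_P)
sublocale QD: domain Q by (rule PI.quotient_is_domain)

lemma mem_coset: "x \<in> coset a \<longleftrightarrow> x - a \<in> P"
  unfolding a_r_coset_def' by force

lemma coset_eq_iff: "coset a = coset b \<longleftrightarrow> a - b \<in> P"
proof
  assume "coset a = coset b"
  then have "a \<in> coset b" using mem_coset[of a a] P_zero by simp
  then show "a - b \<in> P" by (simp add: mem_coset)
next
  assume ab: "a - b \<in> P"
  have "x - a \<in> P \<longleftrightarrow> x - b \<in> P" for x
    using P_add[of "x - a" "a - b"] P_diff[of "x - b" "a - b"] ab by auto
  then show "coset a = coset b" by (auto simp: mem_coset)
qed

lemma carrier_Q: "carrier Q = coset ` mpolys n"
  by (auto simp: FactRing_def A_RCOSETS_def')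

lemma coset_zero: "\<zero>\<^bsub>Q\<^esub> = coset 0"
  by (auto simp: FactRing_def mem_coset)

lemma coset_one: "\<one>\<^bsub>Q\<^esub> = coset 1"
  by (simp add: FactRing_def)

lemma coset_mult: "a \<in> mpolys n \<Longrightarrow> b \<in> mpolys n \<Longrightarrow> coset a \<otimes>\<^bsub>Q\<^esub> coset b = coset (a * b)"
  using PI.rcoset_mult_add[of a b] by (simp add: FactRing_def)

lemma coset_add: "a \<in> mpolys n \<Longrightarrow> b \<in> mpolys n \<Longrightarrow> coset a \<oplus>\<^bsub>Q\<^esub> coset b = coset (a + b)"
  using PI.a_rcos_sum[of a b] by (simp add: FactRing_def)

lemma coset_diff:
  assumes "a \<in> mpolys n" "b \<in> mpolys n" shows "coset a \<ominus>\<^bsub>Q\<^esub> coset b = coset (a - b)"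
proof -
  have nb: "- b \<in> mpolys n" using assms unital_subringD(5)[OF R] by blast
  have "\<ominus>\<^bsub>Q\<^esub> coset b = coset (- b)"
    by (rule QD.minus_equality) (use assms nb in \<open>auto simp: coset_add coset_zero carrier_Q\<close>)
  then show ?thesis using assms nb by (simp add: a_minus_def coset_add)
qed

lemma coset_eq_zero_iff: "coset a = \<zero>\<^bsub>Q\<^esub> \<longleftrightarrow> a \<in> P"
  unfolding coset_zero coset_eq_iff by simp

lemma mem_frac:
  assumes ab: "a \<in> mpolys n" "b \<in> mpolys n" "b \<notin> P"
  shows "(U, V) \<in> frac a b \<longleftrightarrow>
    (\<exists>c d. c \<in> mpolys n \<and> d \<in> mpolys n \<and> d \<notin> P \<and> U = coset c \<and> V = coset d \<and> a * d - c * b \<in> P)"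
proof
  assume "(U, V) \<in> frac a b"
  then have *: "U \<in> carrier Q" "V \<in> carrier Q" "V \<noteq> \<zero>\<^bsub>Q\<^esub>" "coset a \<otimes>\<^bsub>Q\<^esub> V = U \<otimes>\<^bsub>Q\<^esub> coset b"
    unfolding frac_def fraction_def frac_rel_def by auto
  then obtain c d where cd: "c \<in> mpolys n" "d \<in> mpolys n" "U = coset c" "V = coset d"
    unfolding carrier_Q by blast
  moreover have "d \<notin> P" using *(3) coset_eq_zero_iff cd by blast
  moreover have "a * d - c * b \<in> P" using *(4) cd ab by (simp add: coset_mult coset_eq_iff)
  ultimately show "\<exists>c d. c \<in> mpolys n \<and> d \<in> mpolys n \<and> d \<notin> P \<and> U = coset c \<and> V = coset d \<and> a * d - c * b \<in> P"
    by blast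
next
  assume "\<exists>c d. c \<in> mpolys n \<and> d \<in> mpolys n \<and> d \<notin> P \<and> U = coset c \<and> V = coset d \<and> a * d - c * b \<in> P"
  then obtain c d where cd: "c \<in> mpolys n" "d \<in> mpolys n" "d \<notin> P" "U = coset c" "V = coset d" "a * d - c * b \<in> P"
    by blast
  then show "(U, V) \<in> frac a b" using ab
    unfolding frac_def fraction_def frac_rel_def
    by (simp add: carrier_Q imageI coset_mult coset_eq_iff coset_eq_zero_iff)
qed

lemma frac_self: "a \<in> mpolys n \<Longrightarrow> b \<in> mpolys n \<Longrightarrow> b \<notin> P \<Longrightarrow> (coset a, coset b) \<in> frac a b"
  unfolding mem_frac by (rule exI[of _ a], rule exI[of _ b]) (simp add: P_zero)

lemma frac_eq_iff:
  assumes "a \<in> mpolys n" "b \<in> mpolys n" "b \<notin> P" "c \<in> mpolys n" "d \<in> mpolys n" "d \<notin> P"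
  shows "frac a b = frac c d \<longleftrightarrow> a * d - c * b \<in> P"
proof
  assume "frac a b = frac c d"
  then have "(coset c, coset d) \<in> frac a b" using frac_self assms by simp
  then obtain c' d' where "c' \<in> mpolys n" "d' \<in> mpolys n" "c - c' \<in> P" "d - d' \<in> P" "a * d' - c' * b \<in> P"
    unfolding mem_frac[OF assms(1-3)] coset_eq_iff by blast
  moreover from this have "a * (d - d') \<in> P" "(c - c') * b \<in> P"
    using assms P_mult P_mult_right by blast+
  ultimately have "(a * d' - c' * b) + (a * (d - d') - (c - c') * b) \<in> P" using P_add P_diff by blast
  then show "a * d - c * b \<in> P" by (simp add: algebra_simps)
next
  have sub: "frac a b \<subseteq> frac c d" if abcd: "a \<in> mpolys n" "b \<in> mpolys n" "b \<notin> P" "c \<in> mpolys n" "d \<in> mpolys n" "d \<notin> P"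
    and eq: "a * d - c * b \<in> P" for a b c d
  proof
    fix x assume "x \<in> frac a b"
    then obtain e f where ef: "e \<in> mpolys n" "f \<in> mpolys n" "f \<notin> P" "x = (coset e, coset f)" "a * f - e * b \<in> P"
      using mem_frac[OF abcd(1-3)] by (cases x) auto
    \<comment> \<open>Transitivity of the equality of fractions: \<open>b\<close> comes out as a
      common factor and is cancelled modulo \<open>P\<close>.\<close>
    have "d * (a * f - e * b) - f * (a * d - c * b) \<in> P" using P_diff[OF P_mult[OF abcd(5) ef(5)] P_mult[OF ef(2) eq]] .
    then have "b * (c * f - e * d) \<in> P" by (simp add: algebra_simps)
    moreover have "c * f - e * d \<in> mpolys n"
      using ef abcd by (intro unital_subringD(3)[OF R] unital_subringD(4)[OF R])
    ultimately have "c * f - e * d \<in> P" using P_prime abcd by blast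
    then show "x \<in> frac c d" unfolding ef(4) mem_frac[OF abcd(4-6)] using ef by blast
  qed
  assume eq: "a * d - c * b \<in> P"
  then have "c * b - a * d \<in> P" using P_neg[OF eq] by simp
  then show "frac a b = frac c d" using sub eq assms by blast
qed

abbreviation F :: "('k mpoly set \<times> 'k mpoly set) set ring" where "F \<equiv> frac_field Q"

lemma carrier_F: "x \<in> carrier F \<longleftrightarrow> (\<exists>a b. a \<in> mpolys n \<and> b \<in> mpolys n \<and> b \<notin> P \<and> x = frac a b)"
proof
  assume "x \<in> carrier F"
  then obtain U V where "U \<in> carrier Q" "V \<in> carrier Q" "V \<noteq> \<zero>\<^bsub>Q\<^esub>" "x = fraction Q U V"
    unfolding frac_field_def quotient_def fraction_def by auto
  then show "\<exists>a b. a \<in> mpolys n \<and> b \<in> mpolys n \<and> b \<notin> P \<and> x = frac a b"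
    unfolding carrier_Q frac_def using coset_eq_zero_iff by auto
next
  assume "\<exists>a b. a \<in> mpolys n \<and> b \<in> mpolys n \<and> b \<notin> P \<and> x = frac a b"
  then obtain a b where ab: "a \<in> mpolys n" "b \<in> mpolys n" "b \<notin> P" "x = frac a b" by blast
  then have "(coset a, coset b) \<in> carrier Q \<times> (carrier Q - {\<zero>\<^bsub>Q\<^esub>})"
    by (simp add: carrier_Q imageI coset_eq_zero_iff)
  then show "x \<in> carrier F"
    unfolding ab(4) frac_def fraction_def frac_field_def by (simp add: quotientI)
qed

lemma frac_mult:
  assumes "a \<in> mpolys n" "b \<in> mpolys n" "b \<notin> P" "c \<in> mpolys n" "d \<in> mpolys n" "d \<notin> P"
  shows "frac a b \<otimes>\<^bsub>F\<^esub> frac c d = frac (a * c) (b * d)"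
proof -
  have "fraction Q (U \<otimes>\<^bsub>Q\<^esub> U') (V \<otimes>\<^bsub>Q\<^esub> V') = frac (a * c) (b * d)"
    if uv: "(U, V) \<in> frac a b" "(U', V') \<in> frac c d" for U V U' V'
  proof -
    obtain p q p' q' where *: "p \<in> mpolys n" "q \<in> mpolys n" "q \<notin> P" "U = coset p" "V = coset q" "a * q - p * b \<in> P"
      "p' \<in> mpolys n" "q' \<in> mpolys n" "q' \<notin> P" "U' = coset p'" "V' = coset q'" "c * q' - p' * d \<in> P"
      using uv assms unfolding mem_frac[OF assms(1-3)] mem_frac[OF assms(4-6)] by blast
    have "(c * q') * (a * q - p * b) + (p * b) * (c * q' - p' * d) \<in> P"
      by (rule P_add[OF P_mult[OF _ *(6)] P_mult[OF _ *(12)]]) (intro unital_subringD(4)[OF R] * assms)+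
    then have "(a * c) * (q * q') - (p * p') * (b * d) \<in> P" by (simp add: algebra_simps)
    then have "frac (a * c) (b * d) = frac (p * p') (q * q')"
      using * assms P_prime by (subst frac_eq_iff) (auto intro: unital_subringD(4)[OF R])
    then show ?thesis using * by (simp add: coset_mult frac_def)
  qed
  then show ?thesis
    unfolding frac_field_def using frac_self[OF assms(1-3)] frac_self[OF assms(4-6)]
    by (simp, intro UN_constant_value) (auto intro!: UN_constant_value)
qed

lemma frac_add:
  assumes "a \<in> mpolys n" "b \<in> mpolys n" "b \<notin> P" "c \<in> mpolys n" "d \<in> mpolys n" "d \<notin> P"
  shows "frac a b \<oplus>\<^bsub>F\<^esub> frac c d = frac (a * d + c * b) (b * d)"
proof -
  note Rc = unital_subringD(4,6)[OF R]
  have "fraction Q (U \<otimes>\<^bsub>Q\<^esub> V' \<oplus>\<^bsub>Q\<^esub> U' \<otimes>\<^bsub>Q\<^esub> V) (V \<otimes>\<^bsub>Q\<^esub> V') = frac (a * d + c * b) (b * d)"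
    if uv: "(U, V) \<in> frac a b" "(U', V') \<in> frac c d" for U V U' V'
  proof -
    obtain p q p' q' where *: "p \<in> mpolys n" "q \<in> mpolys n" "q \<notin> P" "U = coset p" "V = coset q" "a * q - p * b \<in> P"
      "p' \<in> mpolys n" "q' \<in> mpolys n" "q' \<notin> P" "U' = coset p'" "V' = coset q'" "c * q' - p' * d \<in> P"
      using uv assms unfolding mem_frac[OF assms(1-3)] mem_frac[OF assms(4-6)] by blast
    have "(d * q') * (a * q - p * b) + (b * q) * (c * q' - p' * d) \<in> P"
      by (rule P_add[OF P_mult[OF _ *(6)] P_mult[OF _ *(12)]]) (intro Rc(1) * assms)+
    then have "(a * d + c * b) * (q * q') - (p * q' + p' * q) * (b * d) \<in> P" by (simp add: algebra_simps)
    then have "frac (a * d + c * b) (b * d) = frac (p * q' + p' * q) (q * q')"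
      using * assms P_prime by (subst frac_eq_iff) (auto intro!: Rc)
    then show ?thesis using * by (simp add: coset_mult coset_add frac_def Rc)
  qed
  then show ?thesis
    unfolding frac_field_def using frac_self[OF assms(1-3)] frac_self[OF assms(4-6)]
    by (simp, intro UN_constant_value) (auto intro!: UN_constant_value)
qed

lemma frac_one: "\<one>\<^bsub>F\<^esub> = frac 1 1" and frac_zero: "\<zero>\<^bsub>F\<^esub> = frac 0 1"
  by (simp_all add: frac_field_def frac_def coset_one coset_zero)

lemma frac_eq_zero_iff:
  assumes "a \<in> mpolys n" "b \<in> mpolys n" "b \<notin> P"
  shows "frac a b = \<zero>\<^bsub>F\<^esub> \<longleftrightarrow> a \<in> P"
  unfolding frac_zero
  using frac_eq_iff[OF assms, of 0 1] P_one unital_subringD(1,2)[OF R] by simp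

lemma domain_F: "domain F"
proof -
  note Rc = unital_subringD[OF R]
  have den: "b * d \<in> mpolys n \<and> b * d \<notin> P" if "b \<in> mpolys n" "b \<notin> P" "d \<in> mpolys n" "d \<notin> P" for b d
    using that P_prime Rc(4) by blast
  have one: "(1 :: 'k mpoly) \<in> mpolys n" "1 \<notin> P" "(0 :: 'k mpoly) \<in> mpolys n"
    by (rule Rc(1), rule P_one, rule Rc(2))
  have closed: "frac a b \<in> carrier F" if "a \<in> mpolys n" "b \<in> mpolys n" "b \<notin> P" for a b
    using that carrier_F by blast
  have rep: "\<exists>a b. a \<in> mpolys n \<and> b \<in> mpolys n \<and> b \<notin> P \<and> x = frac a b" if "x \<in> carrier F" for x
    using that carrier_F by blast
  have cr: "cring F"
  proof (rule cringI)
    show "abelian_group F"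
    proof (rule abelian_groupI)
      fix x y assume "x \<in> carrier F" "y \<in> carrier F"
      then obtain a b c d where "a \<in> mpolys n" "b \<in> mpolys n" "b \<notin> P" "x = frac a b"
        "c \<in> mpolys n" "d \<in> mpolys n" "d \<notin> P" "y = frac c d" using rep by meson
      then show "x \<oplus>\<^bsub>F\<^esub> y \<in> carrier F" "x \<oplus>\<^bsub>F\<^esub> y = y \<oplus>\<^bsub>F\<^esub> x"
        using den[of b d] by (simp_all add: frac_add closed Rc(4,6) mult.commute add.commute)
    next
      fix x y z assume "x \<in> carrier F" "y \<in> carrier F" "z \<in> carrier F"
      then obtain a b c d e f where *: "a \<in> mpolys n" "b \<in> mpolys n" "b \<notin> P" "x = frac a b"
        "c \<in> mpolys n" "d \<in> mpolys n" "d \<notin> P" "y = frac c d"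
        "e \<in> mpolys n" "f \<in> mpolys n" "f \<notin> P" "z = frac e f" using rep by meson
      then show "x \<oplus>\<^bsub>F\<^esub> y \<oplus>\<^bsub>F\<^esub> z = x \<oplus>\<^bsub>F\<^esub> (y \<oplus>\<^bsub>F\<^esub> z)"
        using den[of b d] den[of d f] by (simp add: frac_add Rc(4,6)) (simp add: algebra_simps)
    next
      fix x assume "x \<in> carrier F"
      then obtain a b where *: "a \<in> mpolys n" "b \<in> mpolys n" "b \<notin> P" "x = frac a b" using rep by meson
      then show "\<zero>\<^bsub>F\<^esub> \<oplus>\<^bsub>F\<^esub> x = x" by (simp add: frac_zero frac_add one)
      have na: "- a \<in> mpolys n" using * Rc(5) by blast
      have "frac (- a) b \<oplus>\<^bsub>F\<^esub> x = \<zero>\<^bsub>F\<^esub>"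
        using * den[of b b] na one P_zero by (simp add: frac_add frac_zero frac_eq_iff)
      then show "\<exists>y\<in>carrier F. y \<oplus>\<^bsub>F\<^esub> x = \<zero>\<^bsub>F\<^esub>" using closed[OF na *(2,3)] by blast
    qed (simp add: frac_zero closed one)
    show "comm_monoid F"
    proof (rule comm_monoidI)
      fix x y assume "x \<in> carrier F" "y \<in> carrier F"
      then obtain a b c d where "a \<in> mpolys n" "b \<in> mpolys n" "b \<notin> P" "x = frac a b"
        "c \<in> mpolys n" "d \<in> mpolys n" "d \<notin> P" "y = frac c d" using rep by meson
      then show "x \<otimes>\<^bsub>F\<^esub> y \<in> carrier F" "x \<otimes>\<^bsub>F\<^esub> y = y \<otimes>\<^bsub>F\<^esub> x"
        using den[of b d] by (simp_all add: frac_mult closed Rc(4) mult.commute)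
    next
      fix x y z assume "x \<in> carrier F" "y \<in> carrier F" "z \<in> carrier F"
      then obtain a b c d e f where *: "a \<in> mpolys n" "b \<in> mpolys n" "b \<notin> P" "x = frac a b"
        "c \<in> mpolys n" "d \<in> mpolys n" "d \<notin> P" "y = frac c d"
        "e \<in> mpolys n" "f \<in> mpolys n" "f \<notin> P" "z = frac e f" using rep by meson
      then show "x \<otimes>\<^bsub>F\<^esub> y \<otimes>\<^bsub>F\<^esub> z = x \<otimes>\<^bsub>F\<^esub> (y \<otimes>\<^bsub>F\<^esub> z)"
        using den[of b d] den[of d f] by (simp add: frac_mult Rc(4) mult.assoc)
    next
      fix x assume "x \<in> carrier F"
      then obtain a b where "a \<in> mpolys n" "b \<in> mpolys n" "b \<notin> P" "x = frac a b" using rep by meson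
      then show "\<one>\<^bsub>F\<^esub> \<otimes>\<^bsub>F\<^esub> x = x" by (simp add: frac_one frac_mult one)
    qed (simp add: frac_one closed one)
    fix x y z assume "x \<in> carrier F" "y \<in> carrier F" "z \<in> carrier F"
    then obtain a b c d e f where *: "a \<in> mpolys n" "b \<in> mpolys n" "b \<notin> P" "x = frac a b"
      "c \<in> mpolys n" "d \<in> mpolys n" "d \<notin> P" "y = frac c d"
      "e \<in> mpolys n" "f \<in> mpolys n" "f \<notin> P" "z = frac e f" using rep by meson
    have d: "b * d \<in> mpolys n" "b * d \<notin> P" "b * f \<in> mpolys n" "b * f \<notin> P" "d * f \<in> mpolys n" "d * f \<notin> P"
      using den[OF *(2,3) *(6,7)] den[OF *(2,3) *(10,11)] den[OF *(6,7) *(10,11)] by simp_all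
    have bdf: "b * d * f \<in> mpolys n" "b * d * f \<notin> P" "b * f * (d * f) \<in> mpolys n" "b * f * (d * f) \<notin> P"
      using den[OF d(1,2) *(10,11)] den[OF d(3-6)] by simp_all
    have num: "(a * d + c * b) * e \<in> mpolys n" "a * e * (d * f) + c * e * (b * f) \<in> mpolys n"
      using * by (simp_all add: Rc(4,6))
    have 1: "(x \<oplus>\<^bsub>F\<^esub> y) \<otimes>\<^bsub>F\<^esub> z = frac ((a * d + c * b) * e) ((b * d) * f)"
      using * d by (simp add: frac_add frac_mult Rc(4,6))
    have 2: "x \<otimes>\<^bsub>F\<^esub> z \<oplus>\<^bsub>F\<^esub> y \<otimes>\<^bsub>F\<^esub> z = frac ((a * e) * (d * f) + (c * e) * (b * f)) ((b * f) * (d * f))"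
      using * d by (simp add: frac_add frac_mult Rc(4,6))
    have "(a * d + c * b) * e * (b * f * (d * f)) - (a * e * (d * f) + c * e * (b * f)) * (b * d * f) = 0"
      by (simp add: algebra_simps)
    then have "(a * d + c * b) * e * (b * f * (d * f)) - (a * e * (d * f) + c * e * (b * f)) * (b * d * f) \<in> P"
      using P_zero by (simp only:)
    then show "(x \<oplus>\<^bsub>F\<^esub> y) \<otimes>\<^bsub>F\<^esub> z = x \<otimes>\<^bsub>F\<^esub> z \<oplus>\<^bsub>F\<^esub> y \<otimes>\<^bsub>F\<^esub> z"
      unfolding 1 2 frac_eq_iff[OF num(1) bdf(1,2) num(2) bdf(3,4)] .
  qed
  show ?thesis
  proof (rule domain.intro[OF cr], unfold_locales)
    show "\<one>\<^bsub>F\<^esub> \<noteq> \<zero>\<^bsub>F\<^esub>" using frac_eq_zero_iff[of 1 1] one by (simp add: frac_one)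
    fix x y assume xy: "x \<otimes>\<^bsub>F\<^esub> y = \<zero>\<^bsub>F\<^esub>" "x \<in> carrier F" "y \<in> carrier F"
    then obtain a b c d where *: "a \<in> mpolys n" "b \<in> mpolys n" "b \<notin> P" "x = frac a b"
      "c \<in> mpolys n" "d \<in> mpolys n" "d \<notin> P" "y = frac c d" using rep by meson
    then have "a * c \<in> P" using xy(1) den[of b d] frac_eq_zero_iff[of "a * c" "b * d"]
      by (simp add: frac_mult Rc(4))
    then have "a \<in> P \<or> c \<in> P" using * P_prime by blast
    then show "x = \<zero>\<^bsub>F\<^esub> \<or> y = \<zero>\<^bsub>F\<^esub>" using * frac_eq_zero_iff by blast
  qed
qed

end

section \<open>Elements of the fraction field that are algebraic over the scalars\<close>

context prime_quotient
begin

interpretation FD: domain F by (rule domain_F)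

abbreviation scalar :: "'k \<Rightarrow> ('k mpoly set \<times> 'k mpoly set) set" where
  "scalar k \<equiv> frac (mpoly_const k) 1"

lemma one_facts: "(1 :: 'k mpoly) \<in> mpolys n" "1 \<notin> P"
  by (rule unital_subringD(1)[OF R], rule P_one)

lemma scalar_eq_zero_iff: "scalar k = \<zero>\<^bsub>F\<^esub> \<longleftrightarrow> k = 0"
  using frac_eq_zero_iff[OF _ one_facts, of "mpoly_const k"] const_notin_prime[OF prime_mod_axioms, of k] P_zero
  by auto

lemma frac_closed: "a \<in> mpolys n \<Longrightarrow> b \<in> mpolys n \<Longrightarrow> b \<notin> P \<Longrightarrow> frac a b \<in> carrier F"
  using carrier_F by blast

lemma subring_scalars: "subring (range scalar) F"
proof (rule FD.subringI)
  note c = mpoly_const_in_mpolys[of _ n, where 'a = 'k]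
  have mult: "scalar k \<otimes>\<^bsub>F\<^esub> scalar l = scalar (k * l)" for k l
    using frac_mult[OF c one_facts c one_facts, of k l] by (simp add: mpoly_const_hom)
  have add: "scalar k \<oplus>\<^bsub>F\<^esub> scalar l = scalar (k + l)" for k l
    using frac_add[OF c one_facts c one_facts, of k l] by (simp add: mpoly_const_hom)
  show "range scalar \<subseteq> carrier F" using frac_closed[OF c one_facts] by blast
  show "\<one>\<^bsub>F\<^esub> \<in> range scalar" using frac_one by (intro image_eqI[of _ _ 1]) simp_all
  show "\<ominus>\<^bsub>F\<^esub> h \<in> range scalar" if h: "h \<in> range scalar" for h
  proof -
    obtain k where k: "h = scalar k" using h by blast
    have "scalar (- k) \<oplus>\<^bsub>F\<^esub> h = \<zero>\<^bsub>F\<^esub>" unfolding k add using scalar_eq_zero_iff[of 0] by simp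
    then have "\<ominus>\<^bsub>F\<^esub> h = scalar (- k)"
      by (rule FD.minus_equality) (simp_all add: k frac_closed[OF c one_facts])
    then show ?thesis by blast
  qed
  show "h \<otimes>\<^bsub>F\<^esub> h' \<in> range scalar" "h \<oplus>\<^bsub>F\<^esub> h' \<in> range scalar"
    if "h \<in> range scalar" "h' \<in> range scalar" for h h'
    using that mult add by auto
qed

lemma frac_power:
  assumes "a \<in> mpolys n" "b \<in> mpolys n" "b \<notin> P"
  shows "frac a b [^]\<^bsub>F\<^esub> (m::nat) = frac (a ^ m) (b ^ m)"
proof (induction m)
  case 0
  show ?case by (simp add: frac_one)
next
  case (Suc m)
  have "b ^ m \<notin> P" using P_power assms by blast
  then show ?case using assms Suc
    by (simp add: frac_mult unital_subringD(7)[OF R] mult.commute)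
qed

text \<open>Polynomials are coefficient lists with the leading coefficient first, hence
  \<open>rev\<close>. The denominator \<open>b ^ m\<close> is one power more than \<open>m\<close>
  coefficients require, which lets the induction start from the empty list.\<close>

lemma eval_scalars:
  assumes ab: "a \<in> mpolys n" "b \<in> mpolys n" "b \<notin> P"
  shows "FD.eval (map scalar (rev (map \<kappa> [0..<m]))) (frac a b) =
    frac (\<Sum>t<m. mpoly_const (\<kappa> t) * a ^ t * b ^ (m - t)) (b ^ m)"
proof (induction m)
  case 0
  show ?case by (simp add: frac_zero)
next
  case (Suc m)
  note Rc = unital_subringD[OF R]
  let ?M = "\<lambda>m. \<Sum>t<m. mpoly_const (\<kappa> t) * a ^ t * b ^ (m - t)"
  have MA: "?M m \<in> mpolys n" for m
    using ab by (intro unital_subring_sum[OF R] Rc(4) Rc(7)) simp_all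
  have bm: "b ^ m \<in> mpolys n" "b ^ m \<notin> P" for m using P_power ab Rc(7) by blast+
  have bmm: "b ^ m * b ^ m \<in> mpolys n" "b ^ m * b ^ m \<notin> P"
    using bm[of "m + m"] by (simp_all add: power_add)
  have am: "a ^ m \<in> mpolys n" "mpoly_const (\<kappa> m) * a ^ m \<in> mpolys n"
    using ab by (intro Rc(4) Rc(7); simp)+
  have M: "?M (Suc m) = b * ?M m + mpoly_const (\<kappa> m) * a ^ m * b"
  proof -
    have "(\<Sum>t<m. mpoly_const (\<kappa> t) * a ^ t * b ^ (Suc m - t)) = b * ?M m"
      unfolding sum_distrib_left by (rule sum.cong) (simp_all add: Suc_diff_le)
    then show ?thesis by simp
  qed
  have "FD.eval (map scalar (rev (map \<kappa> [0..<Suc m]))) (frac a b) =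
      scalar (\<kappa> m) \<otimes>\<^bsub>F\<^esub> frac a b [^]\<^bsub>F\<^esub> m \<oplus>\<^bsub>F\<^esub> FD.eval (map scalar (rev (map \<kappa> [0..<m]))) (frac a b)"
    by simp
  also have "\<dots> = frac (mpoly_const (\<kappa> m) * a ^ m) (b ^ m) \<oplus>\<^bsub>F\<^esub> frac (?M m) (b ^ m)"
    unfolding Suc.IH frac_power[OF ab]
    using frac_mult[OF mpoly_const_in_mpolys one_facts am(1) bm, of "\<kappa> m" m] by simp
  also have "\<dots> = frac (mpoly_const (\<kappa> m) * a ^ m * b ^ m + ?M m * b ^ m) (b ^ m * b ^ m)"
    by (rule frac_add[OF am(2) bm MA bm])
  also have "\<dots> = frac (?M (Suc m)) (b ^ Suc m)"
  proof (rule frac_eq_iff[THEN iffD2])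
    have "(mpoly_const (\<kappa> m) * a ^ m * b ^ m + ?M m * b ^ m) * b ^ Suc m - ?M (Suc m) * (b ^ m * b ^ m) = 0"
      unfolding M by (simp add: algebra_simps)
    then show "(mpoly_const (\<kappa> m) * a ^ m * b ^ m + ?M m * b ^ m) * b ^ Suc m - ?M (Suc m) * (b ^ m * b ^ m) \<in> P"
      using P_zero by (simp only:)
    show "mpoly_const (\<kappa> m) * a ^ m * b ^ m + ?M m * b ^ m \<in> mpolys n"
      by (intro Rc(6) Rc(4)[OF am(2) bm(1)] Rc(4)[OF MA bm(1)])
  qed (rule bmm MA bm)+
  finally show ?case .
qed

lemma algebraic_frac_iff:
  assumes ab: "a \<in> mpolys n" "b \<in> mpolys n" "b \<notin> P"
  shows "(FD.algebraic over range scalar) (frac a b) \<longleftrightarrow>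
    (\<exists>d \<kappa>. \<kappa> d \<noteq> 0 \<and> (\<Sum>t\<le>d. mpoly_const (\<kappa> t) * a ^ t * b ^ (d - t)) \<in> P)"
proof -
  note Rc = unital_subringD[OF R]
  have bm: "b ^ m \<in> mpolys n" "b ^ m \<notin> P" for m using P_power ab Rc(7) by blast+
  have root: "FD.eval (map scalar (rev (map \<kappa> [0..<Suc d]))) (frac a b) = \<zero>\<^bsub>F\<^esub> \<longleftrightarrow>
      (\<Sum>t\<le>d. mpoly_const (\<kappa> t) * a ^ t * b ^ (d - t)) \<in> P" for \<kappa> d
  proof -
    let ?s = "\<Sum>t\<le>d. mpoly_const (\<kappa> t) * a ^ t * b ^ (d - t)"
    have eq: "(\<Sum>t<Suc d. mpoly_const (\<kappa> t) * a ^ t * b ^ (Suc d - t)) = b * ?s"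
      unfolding sum_distrib_left lessThan_Suc_atMost by (rule sum.cong) (simp_all add: Suc_diff_le)
    have s: "?s \<in> mpolys n" using ab by (intro unital_subring_sum[OF R] Rc(4) Rc(7)) simp_all
    show ?thesis
      unfolding eval_scalars[OF ab] eq frac_eq_zero_iff[OF Rc(4)[OF ab(2) s] bm] P_mult_iff[OF ab(2) s]
      using ab(3) by blast
  qed
  show ?thesis
  proof
    assume "(FD.algebraic over range scalar) (frac a b)"
    then obtain p where p: "p \<in> carrier (univ_poly F (range scalar))" "p \<noteq> []" "FD.eval p (frac a b) = \<zero>\<^bsub>F\<^esub>"
      by (rule FD.algebraicE[OF subring_scalars frac_closed[OF ab]])
    \<comment> \<open>A nonempty coefficient list is normalized by a nonzero head, which becomes the
      leading coefficient \<open>\<kappa> d\<close>.\<close>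
    have p': "set p \<subseteq> range scalar" "hd p \<noteq> \<zero>\<^bsub>F\<^esub>"
      using p(1,2) unfolding univ_poly_carrier[symmetric] polynomial_def by auto
    have "\<exists>ks. p = map scalar ks" using p'(1)
    proof (induction p)
      case (Cons x p)
      then obtain k ks where "x = scalar k" "p = map scalar ks" by auto
      then show ?case by (intro exI[of _ "k # ks"]) simp
    qed simp
    then obtain ks where ks: "p = map scalar ks" by blast
    obtain d where d: "length ks = Suc d" using p(2) ks by (cases ks) auto
    define \<kappa> where "\<kappa> t = rev ks ! t" for t
    have "map \<kappa> [0..<Suc d] = rev ks"
      unfolding \<kappa>_def using map_nth[of "rev ks"] d by simp
    then have ks_eq: "ks = rev (map \<kappa> [0..<Suc d])" by (metis rev_rev_ident)
    have "hd p = scalar (\<kappa> d)" unfolding ks ks_eq by simp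
    then have "\<kappa> d \<noteq> 0" using p'(2) scalar_eq_zero_iff by auto
    moreover have "(\<Sum>t\<le>d. mpoly_const (\<kappa> t) * a ^ t * b ^ (d - t)) \<in> P"
      using p(3) root[of \<kappa> d] unfolding ks ks_eq by blast
    ultimately show "\<exists>d \<kappa>. \<kappa> d \<noteq> 0 \<and> (\<Sum>t\<le>d. mpoly_const (\<kappa> t) * a ^ t * b ^ (d - t)) \<in> P" by blast
  next
    assume "\<exists>d \<kappa>. \<kappa> d \<noteq> 0 \<and> (\<Sum>t\<le>d. mpoly_const (\<kappa> t) * a ^ t * b ^ (d - t)) \<in> P"
    then obtain d \<kappa> where \<kappa>: "\<kappa> d \<noteq> 0" "(\<Sum>t\<le>d. mpoly_const (\<kappa> t) * a ^ t * b ^ (d - t)) \<in> P" by blast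
    let ?p = "map scalar (rev (map \<kappa> [0..<Suc d]))"
    have "?p \<in> carrier (univ_poly F (range scalar))"
      unfolding univ_poly_carrier[symmetric] polynomial_def using \<kappa>(1) scalar_eq_zero_iff by auto
    moreover have "?p \<noteq> []" by simp
    moreover have "FD.eval ?p (frac a b) = \<zero>\<^bsub>F\<^esub>" unfolding root by (rule \<kappa>(2))
    ultimately show "(FD.algebraic over range scalar) (frac a b)" by (rule FD.algebraicI)
  qed
qed

lemma scalars_image: "(\<lambda>c. fraction Q (coset c) \<one>\<^bsub>Q\<^esub>) ` range mpoly_const = range scalar"
  by (auto simp: frac_def coset_one)

end

section \<open>The Poisson center of the fraction field\<close>

context linear_action
begin

text \<open>The chain rule in the first argument, as \<open>delta i g\<close> is the bracket of the
  \<open>i\<close>-th variable with \<open>g\<close>. Antisymmetry is not visible in this form and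
  enters later as the assumption \<open>antisym\<close>.\<close>

definition bracket :: "'k mpoly \<Rightarrow> 'k mpoly \<Rightarrow> 'k mpoly" where
  "bracket f g = (\<Sum>i<s. mpoly_deriv i f * delta i g)"

lemma bracket_var: "i < s \<Longrightarrow> bracket (mpoly_var i) g = delta i g"
  unfolding bracket_def mpoly_deriv_var by (simp add: if_distrib[of "\<lambda>x. x * _"] cong: if_cong)

lemma bracket_one: "bracket 1 g = 0"
  by (simp add: bracket_def derivationD[OF derivation_mpoly_deriv])

lemma bracket_closed: "f \<in> A \<Longrightarrow> g \<in> A \<Longrightarrow> bracket f g \<in> A"
  unfolding bracket_def
  by (intro unital_subring_sum[OF A_ring] unital_subringD(4)[OF A_ring] mpoly_deriv_closed delta_closed)

lemma bracket_diff: "bracket (f - f') g = bracket f g - bracket f' g" "bracket f (g - g') = bracket f g - bracket f g'"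
  by (simp_all add: bracket_def derivationD[OF derivation_mpoly_deriv] deltaD sum_subtractf algebra_simps)

context
  fixes P
  assumes P: "stable_prime P" and antisym: "\<And>f g. bracket f g = - bracket g f"
begin

interpretation prime_quotient s P
  using P by (simp add: prime_quotient_def stable_prime_def)

lemma bracket_P: "f \<in> A \<Longrightarrow> p \<in> P \<Longrightarrow> bracket f p \<in> P"
  unfolding bracket_def using P by (auto simp: stable_prime_def intro!: P_sum P_mult mpoly_deriv_closed)

text \<open>Stability of \<open>P\<close> gives independence of the representative in the second
  argument, and \<open>antisym\<close> carries this over to the first.\<close>

lemma quot_bracket_coset:
  assumes ab: "a \<in> A" "b \<in> A"
  shows "quot_bracket (mpoly_ring s) bracket P (coset a) (coset b) = coset (bracket a b)"
proof -
  have "coset (bracket x y) = coset (bracket a b)" if x: "x \<in> coset a" and y: "y \<in> coset b" for x y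
  proof -
    have xa: "x - a \<in> P" and yb: "y - b \<in> P" using x y by (simp_all add: mem_coset)
    have "(y - b) + b \<in> A" using yb P_sub ab by (intro unital_subringD(6)[OF A_ring]) auto
    then have yA: "y \<in> A" by simp
    have "bracket (x - a) y \<in> P" using P_neg[OF bracket_P[OF yA xa]] antisym[of "x - a" y] by simp
    moreover have "bracket a (y - b) \<in> P" using bracket_P[OF ab(1) yb] .
    ultimately have "bracket (x - a) y + bracket a (y - b) \<in> P" by (rule P_add)
    then show ?thesis unfolding coset_eq_iff bracket_diff by simp
  qed
  moreover have "a \<in> coset a" "b \<in> coset b" using P_zero by (simp_all add: mem_coset)
  ultimately show ?thesis unfolding quot_bracket_def by blast
qed

text \<open>Bracketing with the fractions of a variable by 1 gives the derivations
  \<open>delta i\<close>; conversely, every bracket is a combination of these.\<close>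

lemma center_iff:
  assumes ab: "a \<in> A" "b \<in> A" "b \<notin> P"
  shows "frac a b \<in> poisson_center F (frac_bracket Q (quot_bracket (mpoly_ring s) bracket P)) \<longleftrightarrow> const_ratio P a b"
proof -
  note Ac = unital_subringD[OF A_ring]
  \<comment> \<open>The numerator of the bracket of \<open>c / d\<close> with
    \<open>a / b\<close>.\<close>
  define N where "N c d a b = d * (b * bracket c a - a * bracket c b) - c * (b * bracket d a - a * bracket d b)" for a b c d
  define Z where "Z U V U' V' = fraction Q
       (V \<otimes>\<^bsub>Q\<^esub> (V' \<otimes>\<^bsub>Q\<^esub> quot_bracket (mpoly_ring s) bracket P U U' \<ominus>\<^bsub>Q\<^esub> U' \<otimes>\<^bsub>Q\<^esub> quot_bracket (mpoly_ring s) bracket P U V') \<ominus>\<^bsub>Q\<^esub>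
        U \<otimes>\<^bsub>Q\<^esub> (V' \<otimes>\<^bsub>Q\<^esub> quot_bracket (mpoly_ring s) bracket P V U' \<ominus>\<^bsub>Q\<^esub> U' \<otimes>\<^bsub>Q\<^esub> quot_bracket (mpoly_ring s) bracket P V V'))
       ((V \<otimes>\<^bsub>Q\<^esub> V) \<otimes>\<^bsub>Q\<^esub> (V' \<otimes>\<^bsub>Q\<^esub> V'))" for U V U' V'
  have br: "frac_bracket Q (quot_bracket (mpoly_ring s) bracket P) S T = (\<Union>(U, V)\<in>S. \<Union>(U', V')\<in>T. Z U V U' V')" for S T
    unfolding frac_bracket_def Z_def ..
  have NA: "N c d a b \<in> A" if "a \<in> A" "b \<in> A" "c \<in> A" "d \<in> A" for a b c d
    unfolding N_def using that by (intro Ac(3) Ac(4) bracket_closed)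
  have Z: "Z (coset c) (coset d) (coset a) (coset b) = frac (N c d a b) ((d * d) * (b * b))"
    if "a \<in> A" "b \<in> A" "c \<in> A" "d \<in> A" for a b c d
    unfolding Z_def N_def frac_def using that
    by (simp add: quot_bracket_coset coset_mult coset_diff bracket_closed Ac(3,4))
  have den: "(d * d) * (b * b) \<in> A" "(d * d) * (b * b) \<notin> P" if "b \<in> A" "b \<notin> P" "d \<in> A" "d \<notin> P" for b d
    using that P_mult_iff Ac(4) by simp_all
  show ?thesis
  proof
    assume "frac a b \<in> poisson_center F (frac_bracket Q (quot_bracket (mpoly_ring s) bracket P))"
    then have c: "(\<Union>(U, V)\<in>S. \<Union>(U', V')\<in>frac a b. Z U V U' V') = \<zero>\<^bsub>F\<^esub>" if "S \<in> carrier F" for S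
      using that unfolding poisson_center_def br by blast
    show "const_ratio P a b" unfolding const_ratio_def
    proof (intro allI impI)
      fix i assume i: "i < s"
      let ?x = "mpoly_var i :: 'k mpoly"
      have x: "?x \<in> A" using i by simp
      \<comment> \<open>The bracket is a union over all representatives, so one choice of them gives
        only an inclusion. This suffices, as a single common element makes the numerator zero modulo
        \<open>P\<close>.\<close>
      have sub: "Z (coset ?x) (coset 1) (coset a) (coset b) \<subseteq> \<zero>\<^bsub>F\<^esub>"
        using c[OF frac_closed[OF x one_facts]] frac_self[OF x one_facts] frac_self[OF ab] by blast
      have d: "(1 * 1) * (b * b) \<in> A" "(1 * 1) * (b * b) \<notin> P" using den[OF ab(2,3) one_facts] .
      have "(coset (N ?x 1 a b), coset ((1 * 1) * (b * b))) \<in> \<zero>\<^bsub>F\<^esub>"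
        using sub frac_self[OF NA[OF ab(1,2) x one_facts(1)] d]
        unfolding Z[OF ab(1,2) x one_facts(1)] by blast
      then obtain p q where pq: "p \<in> A" "q \<in> A" "q \<notin> P" "N ?x 1 a b - p \<in> P" "0 * q - p * 1 \<in> P"
        unfolding frac_zero mem_frac[OF Ac(2) one_facts] coset_eq_iff by blast
      then have "p \<in> P" using P_neg[of "- p"] by simp
      then have "N ?x 1 a b \<in> P" using P_cong pq(4) by blast
      then show "b * delta i a - a * delta i b \<in> P" by (simp add: N_def bracket_var[OF i] bracket_one)
    qed
  next
    assume cr: "const_ratio P a b"
    have "(\<Union>(U, V)\<in>S. \<Union>(U', V')\<in>frac a b. Z U V U' V') = \<zero>\<^bsub>F\<^esub>" if S: "S \<in> carrier F" for S
    proof -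
      obtain e f where ef: "e \<in> A" "f \<in> A" "f \<notin> P" "S = frac e f" using S carrier_F by blast
      have zero: "Z U V U' V' = \<zero>\<^bsub>F\<^esub>" if UV: "(U, V) \<in> S" "(U', V') \<in> frac a b" for U V U' V'
      proof -
        obtain c d where cd: "c \<in> A" "d \<in> A" "d \<notin> P" "U = coset c" "V = coset d"
          using UV(1) unfolding ef(4) mem_frac[OF ef(1-3)] by blast
        obtain a' b' where ab': "a' \<in> A" "b' \<in> A" "b' \<notin> P" "U' = coset a'" "V' = coset b'" "a * b' - a' * b \<in> P"
          using UV(2) unfolding mem_frac[OF ab] by blast
        have cr': "const_ratio P a' b'" by (rule const_ratio_cong[OF P ab cr ab'(1,2,6)])
        have z: "b' * bracket h a' - a' * bracket h b' \<in> P" if h: "h \<in> A" for h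
        proof -
          have "b' * bracket h a' - a' * bracket h b' = (\<Sum>i<s. mpoly_deriv i h * (b' * delta i a' - a' * delta i b'))"
            by (simp add: bracket_def sum_distrib_left sum_subtractf[symmetric] algebra_simps)
          also have "\<dots> \<in> P" using cr' h unfolding const_ratio_def
            by (intro P_sum P_mult mpoly_deriv_closed) simp_all
          finally show ?thesis .
        qed
        have "N c d a' b' \<in> P" unfolding N_def by (intro P_diff P_mult[OF cd(2) z[OF cd(1)]] P_mult[OF cd(1) z[OF cd(2)]])
        then show ?thesis unfolding cd(4,5) ab'(4,5) Z[OF ab'(1,2) cd(1,2)]
          using frac_eq_zero_iff[OF NA[OF ab'(1,2) cd(1,2)] den[OF ab'(2,3) cd(2,3)]] by blast
      qed
      have ne: "(coset e, coset f) \<in> S" "(coset a, coset b) \<in> frac a b"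
        unfolding ef(4) by (rule frac_self[OF ef(1-3)], rule frac_self[OF ab])
      have "(\<Union>(U', V')\<in>frac a b. Z U V U' V') = \<zero>\<^bsub>F\<^esub>" if "(U, V) \<in> S" for U V
        by (rule UN_constant_value) (use ne zero[OF that] in auto)
      then show ?thesis
        by (intro UN_constant_value) (use ne in auto)
    qed
    then show "frac a b \<in> poisson_center F (frac_bracket Q (quot_bracket (mpoly_ring s) bracket P))"
      unfolding poisson_center_def br using frac_closed[OF ab] by blast
  qed
qed

lemma poisson_rational_iff:
  "poisson_rational (mpoly_ring s) (range mpoly_const) bracket P \<longleftrightarrow>
    (\<forall>a\<in>A. \<forall>b\<in>A. b \<notin> P \<longrightarrow> const_ratio P a b \<longrightarrow>
      (\<exists>d \<kappa>. \<kappa> d \<noteq> 0 \<and> (\<Sum>t\<le>d. mpoly_const (\<kappa> t) * a ^ t * b ^ (d - t)) \<in> P))"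
  (is "?L \<longleftrightarrow> ?R")
proof
  assume L: ?L
  show ?R
  proof (intro ballI impI)
    fix a b assume ab: "a \<in> A" "b \<in> A" "b \<notin> P" and cr: "const_ratio P a b"
    have "frac a b \<in> poisson_center F (frac_bracket Q (quot_bracket (mpoly_ring s) bracket P))"
      using center_iff[OF ab] cr by blast
    then show "\<exists>d \<kappa>. \<kappa> d \<noteq> 0 \<and> (\<Sum>t\<le>d. mpoly_const (\<kappa> t) * a ^ t * b ^ (d - t)) \<in> P"
      using L algebraic_frac_iff[OF ab] unfolding poisson_rational_def scalars_image by blast
  qed
next
  assume r: ?R
  show ?L unfolding poisson_rational_def scalars_image
  proof
    fix z assume z: "z \<in> poisson_center F (frac_bracket Q (quot_bracket (mpoly_ring s) bracket P))"
    then have "z \<in> carrier F" by (simp add: poisson_center_def)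
    then obtain a b where ab: "a \<in> A" "b \<in> A" "b \<notin> P" "z = frac a b" using carrier_F by blast
    then have "const_ratio P a b" using center_iff[OF ab(1-3)] z by simp
    then show "(ring.algebraic F over range scalar) z"
      unfolding ab(4) algebraic_frac_iff[OF ab(1-3)] using r ab by blast
  qed
qed

end

end

section \<open>The equivalence\<close>

lemma triangular_sum:
  fixes G :: "nat \<Rightarrow> nat \<Rightarrow> 'a::comm_monoid_add"
  assumes "\<And>i. G i i = 0"
  shows "(\<Sum>i<n. \<Sum>j<n. G i j) = (\<Sum>j<n. \<Sum>i<j. G i j + G j i)"
proof (induction n)
  case (Suc n)
  have "(\<Sum>i<Suc n. \<Sum>j<Suc n. G i j) = (\<Sum>i<n. \<Sum>j<n. G i j) + (\<Sum>i<n. G i n) + (\<Sum>j<n. G n j)"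
    using assms by (simp add: sum.distrib add_ac)
  then show ?case by (simp add: Suc sum.distrib add_ac)
qed simp

text \<open>\<open>sym_bracket\<close> takes the Lie bracket only of basis vectors with
  \<open>i < j\<close>; the other coefficients are filled in by antisymmetry to match it.\<close>

definition structure_constant ::
    "('k::field \<Rightarrow> 'g::ab_group_add \<Rightarrow> 'g) \<Rightarrow> ('g \<Rightarrow> 'g \<Rightarrow> 'g) \<Rightarrow> 'g list \<Rightarrow> nat \<Rightarrow> nat \<Rightarrow> nat \<Rightarrow> 'k" where
  "structure_constant scale lie xs i j l =
    (if i < j then module.representation scale (set xs) (lie (xs ! i) (xs ! j)) (xs ! l)
     else if j < i then - module.representation scale (set xs) (lie (xs ! j) (xs ! i)) (xs ! l)
     else 0)"

lemma sym_bracket_eq_bracket: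
  fixes scale :: "'k::field_char_0 \<Rightarrow> 'g::ab_group_add \<Rightarrow> 'g"
  shows "sym_bracket scale lie xs = linear_action.bracket (length xs) (structure_constant scale lie xs)"
proof (intro ext)
  fix f g :: "'k mpoly"
  interpret linear_action "length xs" "structure_constant scale lie xs" .
  let ?s = "length xs"
  define L where "L i j = (\<Sum>l<?s. mpoly_const (structure_constant scale lie xs i j l) * mpoly_var l)" for i j
  have L_less: "L i j = sym_incl scale xs (lie (xs ! i) (xs ! j))" "L j i = - L i j" if "i < j" for i j
    using that unfolding L_def sym_incl_def structure_constant_def
    by (simp_all add: mpoly_const_hom sum_negf)
  have L_diag: "L i i = 0" for i by (simp add: L_def structure_constant_def)
  have "bracket f g = (\<Sum>i<?s. \<Sum>j<?s. mpoly_deriv i f * (L i j * mpoly_deriv j g))"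
    unfolding bracket_def delta_def L_def[symmetric] sum_distrib_left ..
  also have "\<dots> = (\<Sum>j<?s. \<Sum>i<j. mpoly_deriv i f * (L i j * mpoly_deriv j g) +
      mpoly_deriv j f * (L j i * mpoly_deriv i g))"
    by (rule triangular_sum) (simp add: L_diag)
  also have "\<dots> = sym_bracket scale lie xs f g"
    unfolding sym_bracket_def
    by (intro sum.cong) (simp_all add: L_less algebra_simps)
  finally show "sym_bracket scale lie xs f g = bracket f g" ..
qed

lemma sym_bracket_antisym: "sym_bracket scale lie xs f g = - sym_bracket scale lie xs g f"
  by (simp add: sym_bracket_def sum_negf[symmetric] algebra_simps)

context linear_action
begin

text \<open>By the chain rule in the first argument it suffices to bracket with the
  variables.\<close>

lemma poisson_ideal_iff_stable: "poisson_ideal (mpoly_ring s) bracket I \<longleftrightarrow> stable_ideal I"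
proof
  assume I: "poisson_ideal (mpoly_ring s) bracket I"
  then have id: "I \<subseteq> A \<and> 0 \<in> I \<and> (\<forall>a\<in>I. \<forall>b\<in>I. a + b \<in> I) \<and> (\<forall>a\<in>A. \<forall>b\<in>I. a * b \<in> I)"
    unfolding poisson_ideal_def ideal_mpoly_ring_iff by simp
  have "delta i f \<in> I" if "i < s" "f \<in> I" for i f
  proof -
    have "bracket (mpoly_var i) f \<in> I" using I that unfolding poisson_ideal_def by simp
    then show ?thesis by (simp add: bracket_var[OF that(1)])
  qed
  then show "stable_ideal I" using id by (simp add: stable_ideal_def)
next
  assume I: "stable_ideal I"
  have sum: "sum h J \<in> I" if "\<And>i. i \<in> J \<Longrightarrow> h i \<in> I" for h :: "nat \<Rightarrow> 'k mpoly" and J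
    using that I by (induction J rule: infinite_finite_induct) (simp_all add: stable_ideal_def)
  have "bracket a b \<in> I" if "a \<in> A" "b \<in> I" for a b
    unfolding bracket_def
  proof (rule sum)
    fix i assume "i \<in> {..<s}"
    then have "delta i b \<in> I" "mpoly_deriv i a \<in> A" using I that by (simp_all add: stable_ideal_def mpoly_deriv_closed)
    then show "mpoly_deriv i a * delta i b \<in> I" using I by (simp add: stable_ideal_def)
  qed
  then show "poisson_ideal (mpoly_ring s) bracket I"
    using I unfolding poisson_ideal_def ideal_mpoly_ring_iff by (simp add: stable_ideal_def)
qed

lemma poisson_spec_iff: "I \<in> poisson_spec (mpoly_ring s) bracket \<longleftrightarrow> stable_prime I"
proof -
  have "stable_ideal I \<longleftrightarrow> (\<forall>i<s. \<forall>f\<in>I. delta i f \<in> I)" if "prime_mod A I"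
    using prime_mod.P_sub[OF that] prime_mod.P_zero[OF that] prime_mod.P_add[OF that] prime_mod.P_mult[OF that]
    by (auto simp: stable_ideal_def)
  then show ?thesis
    unfolding poisson_spec_def stable_prime_def mem_Collect_eq primeideal_mpoly_ring_iff poisson_ideal_iff_stable by blast
qed

lemma is_poisson_core_iff: "is_poisson_core (mpoly_ring s) bracket M P \<longleftrightarrow> stable_ideal P \<and> core_of M P"
  unfolding is_poisson_core_def poisson_ideal_iff_stable core_of_def by blast

text \<open>For a maximal \<open>M\<close>, the Nullstellensatz with \<open>f = 1\<close> yields a
  prime above \<open>M\<close> with algebraic residue field, which can only be \<open>M\<close>.
  Conversely, an element outside such an \<open>M\<close> divides a nonzero scalar modulo
  \<open>M\<close>, so every larger ideal contains 1.\<close>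

lemma maximalideal_iff:
  "maximalideal M (mpoly_ring s) \<longleftrightarrow> prime_mod A M \<and> (\<forall>a\<in>A. prime_mod.alg M const_polys a)"
proof
  assume "maximalideal M (mpoly_ring s)"
  then interpret maximalideal M "mpoly_ring s" .
  have "primeideal M (mpoly_ring s)"
    by (rule cring.maximalideal_prime[OF cring_mpoly_ring]) (rule maximalideal_axioms)
  then have M: "prime_mod A M" unfolding primeideal_mpoly_ring_iff .
  obtain M' where M': "prime_mod A M'" "M \<subseteq> M'" "\<forall>a\<in>A. prime_mod.alg M' const_polys a"
    using nullstellensatz[OF M unital_subringD(1)[OF A_ring] prime_mod.P_one[OF M]] unfolding const_polys_def by blast
  have "ideal M' (mpoly_ring s)"
    using M'(1) unfolding primeideal_mpoly_ring_iff[symmetric] by (rule primeideal.axioms(1))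
  then have "M' = M \<or> M' = A" using I_maximal M'(2) prime_mod.P_sub[OF M'(1)] by blast
  moreover have "M' \<noteq> A" using prime_mod.P_one[OF M'(1)] unital_subringD(1)[OF A_ring] by blast
  ultimately show "prime_mod A M \<and> (\<forall>a\<in>A. prime_mod.alg M const_polys a)" using M' by blast
next
  assume M: "prime_mod A M \<and> (\<forall>a\<in>A. prime_mod.alg M const_polys a)"
  interpret prime_mod A M using M by blast
  show "maximalideal M (mpoly_ring s)"
  proof (rule maximalidealI)
    show "ideal M (mpoly_ring s)"
      using prime_mod_axioms unfolding primeideal_mpoly_ring_iff[symmetric] by (rule primeideal.axioms(1))
    show "A \<noteq> M" using P_one unital_subringD(1)[OF A_ring] by blast
    fix J assume J: "ideal J (mpoly_ring s)" "M \<subseteq> J" "J \<subseteq> A"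
    have Ji: "\<forall>a\<in>J. \<forall>b\<in>J. a + b \<in> J" "\<forall>a\<in>A. \<forall>b\<in>J. a * b \<in> J"
      using J(1) unfolding ideal_mpoly_ring_iff by blast+
    show "J = M \<or> J = A"
    proof (cases "J = M")
      case False
      then obtain a where a: "a \<in> J" "a \<notin> M" using J(2) by blast
      have aA: "a \<in> A" using a J(3) by blast
      obtain k w where k: "k \<in> const_polys" "k \<notin> M" "w \<in> A" "w * a - k \<in> M"
        by (rule alg_constant_multiple[of const_polys a A]) (use M aA a(2) const_polys_sub_A A_ring in auto)
      obtain l where l: "k = mpoly_const l" using k(1) by (auto simp: const_polys_def)
      have l0: "l \<noteq> 0" using k(2) P_zero l by auto
      have "- (w * a - k) \<in> J" using P_neg[OF k(4)] J(2) by blast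
      moreover have "w * a \<in> J" using Ji(2) k(3) a(1) by blast
      ultimately have "- (w * a - k) + w * a \<in> J" using Ji(1) by blast
      then have "k \<in> J" by simp
      then have "mpoly_const (inverse l) * k \<in> J" using Ji(2) by simp
      then have "1 \<in> J" using l0 by (simp add: l mpoly_const_hom(2)[symmetric])
      then have "a * 1 \<in> J" if "a \<in> A" for a using Ji(2) that by blast
      then show ?thesis using J(3) by auto
    qed simp
  qed
qed

lemma poisson_locally_closed_iff:
  assumes P: "stable_prime P"
  shows "poisson_locally_closed (mpoly_ring s) bracket P \<longleftrightarrow>
    (\<exists>h\<in>A. h \<notin> P \<and> (\<forall>Q. stable_prime Q \<longrightarrow> P \<subset> Q \<longrightarrow> h \<in> Q))"
proof -
  have PA: "P \<subseteq> A" using P by (simp add: stable_prime_def prime_mod.P_sub)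
  let ?I = "A \<inter> \<Inter>{Q. stable_prime Q \<and> P \<subset> Q}"
  have "P \<subseteq> ?I" using PA by auto
  then have "?I \<noteq> P \<longleftrightarrow> (\<exists>h. h \<in> ?I \<and> h \<notin> P)" by auto
  then show ?thesis unfolding poisson_locally_closed_def poisson_spec_iff by auto
qed

theorem poisson_dixmier_moeglin:
  assumes antisym: "\<And>f g. bracket f g = - bracket g f" and P: "stable_prime P"
  shows "poisson_locally_closed (mpoly_ring s) bracket P \<longleftrightarrow> poisson_primitive (mpoly_ring s) bracket P"
    "poisson_primitive (mpoly_ring s) bracket P \<longleftrightarrow> poisson_rational (mpoly_ring s) (range mpoly_const) bracket P"
proof -
  let ?R = "mpoly_ring s :: 'k mpoly ring"
  have P': "prime_mod A P" using P by (simp add: stable_prime_def)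
  have stP: "stable_ideal P"
    using P poisson_spec_iff[of P] poisson_ideal_iff_stable[of P] unfolding poisson_spec_def by blast
  have prim: "poisson_primitive ?R bracket P \<longleftrightarrow>
      (\<exists>M. prime_mod A M \<and> (\<forall>a\<in>A. prime_mod.alg M const_polys a) \<and> core_of M P)"
    unfolding poisson_primitive_def maximalideal_iff is_poisson_core_iff using stP by blast
  have 1: "poisson_primitive ?R bracket P" if lc: "poisson_locally_closed ?R bracket P"
  proof -
    obtain h where "h \<in> A" "h \<notin> P" "\<And>Q. stable_prime Q \<Longrightarrow> P \<subset> Q \<Longrightarrow> h \<in> Q"
      using lc unfolding poisson_locally_closed_iff[OF P] by blast
    then show ?thesis unfolding prim by (rule locally_closed_imp_primitive[OF P])
  qed
  have 2: "poisson_rational ?R (range mpoly_const) bracket P" if pr: "poisson_primitive ?R bracket P"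
  proof -
    obtain M where M: "prime_mod A M" "\<forall>a\<in>A. prime_mod.alg M const_polys a" "core_of M P"
      using pr unfolding prim by blast
    show ?thesis unfolding poisson_rational_iff[OF P antisym]
      using primitive_imp_rational[OF P M] by blast
  qed
  have 3: "poisson_locally_closed ?R bracket P" if ra: "poisson_rational ?R (range mpoly_const) bracket P"
  proof -
    have "algebraic_constants P"
    proof (rule rationality_criterion)
      show "\<exists>d \<kappa>. \<kappa> d \<noteq> 0 \<and> (\<Sum>t\<le>d. mpoly_const (\<kappa> t) * a ^ t * b ^ (d - t)) \<in> P"
        if "a \<in> A" "b \<in> A" "b \<notin> P" "const_ratio P a b" for a b
        using ra that unfolding poisson_rational_iff[OF P antisym] by blast
    qed
    then show ?thesis
      unfolding poisson_locally_closed_iff[OF P] by (rule rational_imp_locally_closed[OF P])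
  qed
  show "poisson_locally_closed ?R bracket P \<longleftrightarrow> poisson_primitive ?R bracket P"
    "poisson_primitive ?R bracket P \<longleftrightarrow> poisson_rational ?R (range mpoly_const) bracket P"
    using 1 2 3 by blast+
qed

end

theorem theorem2:
  fixes scale :: "'k::field_char_0 \<Rightarrow> 'g::ab_group_add \<Rightarrow> 'g"
    and lie :: "'g \<Rightarrow> 'g \<Rightarrow> 'g"
    and xs :: "'g list"
    and A :: "'k mpoly ring"
    and br :: "'k mpoly \<Rightarrow> 'k mpoly \<Rightarrow> 'k mpoly"
    and P :: "'k mpoly set"
  assumes "lie_algebra scale lie"
    and "finite_dimensional_vector_space scale (set xs)" and "distinct xs"
    and "A = mpoly_ring (length xs)"
    and "br = sym_bracket scale lie xs"
    and "P \<in> poisson_spec A br"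
  shows "(poisson_locally_closed A br P \<longleftrightarrow> poisson_primitive A br P) \<and>
         (poisson_primitive A br P \<longleftrightarrow> poisson_rational A (range mpoly_const) br P)"
proof -
  interpret L: linear_action "length xs" "structure_constant scale lie xs" .
  have br: "br = L.bracket" using assms(5) sym_bracket_eq_bracket[of scale lie xs] by simp
  have antisym: "L.bracket f g = - L.bracket g f" for f g
    using sym_bracket_antisym[of scale lie xs f g] unfolding sym_bracket_eq_bracket .
  have "L.stable_prime P" using assms(6) unfolding assms(4) br L.poisson_spec_iff .
  then show ?thesis
    unfolding assms(4) br using L.poisson_dixmier_moeglin[OF antisym] by blast
qed

end
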